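(* Let $d\ge 2$, let $\Lambda_\omega$ be a non-negative self-adjoint operator with domain $\mathrm{dom}(\Lambda_\omega)\subset L^2(\mathbb{S}^{d-1};d\omega)$, and assume that $\Lambda_\omega$ has purely discrete spectrum, consisting of isolated eigenvalues $\lambda_m$, $m\in\mathcal{I}$ (repeated according to multiplicity, $\mathcal I$ a countable index set), which can accumulate only at infinity, with corresponding normalized eigenfunctions $u_m$, $m\in\mathcal{I}$. Let $\mathcal{L}=L_r+\frac{1}{r^2}\Lambda_\omega$, $\mathrm{dom}(\mathcal{L})$ and $\mathcal{D}$ be as defined in the context. Let $\alpha\in\mathbb{R}$. Then for all $\psi\in\mathrm{dom}(\mathcal{L})$ such that $|\cdot|^{-\alpha/2}\mathcal{L}\psi\in L^2(\mathbb{R}^d)$ we have $$\int_{\mathbb{R}^d}\frac{|\mathcal{L}\psi(x)|^2}{|x|^\alpha}\,dx\ \ge\ C(d,\alpha)\int_{\mathbb{R}^d}\frac{\mathcal{D}\psi(x)}{|x|^{\alpha+2}}\,dx,$$ where $$C(d,\alpha)=\begin{cases}\displaystyle\min_{m\in\mathcal{I}}\frac{\big(4\lambda_m+(d+\alpha)(d-\alpha-4)\big)^2}{4\big(4\lambda_m+(d-\alpha-4)^2\big)}, & \text{if } d-\alpha-4\neq 0,\\[2mm] \displaystyle\min\Big((d-2)^2;\ \min_{m\in\mathcal{I},\,\lambda_m\neq 0}\lambda_m\Big), & \text{if } d-\alpha-4=0.\end{cases}$$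
   Context: Write $x\in\mathbb{R}^d\setminus\{0\}$ in spherical coordinates as $x=r\omega$, $r=|x|>0$, $\omega\in\mathbb{S}^{d-1}$; functions are complex-valued. Set $L_r:=-\frac{\partial^2}{\partial r^2}-\frac{d-1}{r}\frac{\partial}{\partial r}$. The operator $\mathcal{L}:=L_r+\frac{1}{r^2}\Lambda_\omega$ (with $\Lambda_\omega$ acting in the variable $\omega$) acts on $$\mathrm{dom}(\mathcal{L}):=\{\psi:\ \psi\in C_0^\infty(\mathbb{R}^d\setminus\{0\}),\ \psi(r,\cdot)\in\mathrm{dom}(\Lambda_\omega)\text{ for } r>0,\ \mathcal{L}\psi\in L^2(\mathbb{R}^d)\}.$$ The first-order operator $\mathcal{D}$ is $\mathcal{D}\psi:=\big|\frac{\partial\psi}{\partial r}\big|^2+\frac{1}{r^2}|\Lambda_\omega^{1/2}\psi|^2$, where $\Lambda_\omega^{1/2}$ is the non-negative self-adjoint square root of $\Lambda_\omega$ given by the functional calculus (so $\Lambda_\omega^{1/2}u_m=\sqrt{\lambda_m}\,u_m$). *)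

theory Defs
  imports "HOL-Analysis.Analysis"
begin

subsection \<open>Surface measure and complex \<open>L\<^sup>2\<close> spaces\<close>

text \<open>The cone formula \<open>\<sigma>(A) = d \<cdot> |{x. 0 < |x| < 1, x/|x| \<in> A}|\<close>; it is normalised so that
  \<open>dx = r^(d-1) dr d\<sigma>(\<omega>)\<close>.\<close>

definition sphere_measure :: "'a::euclidean_space measure" where
  "sphere_measure = scale_measure (of_nat DIM('a))
     (distr (restrict_space lborel (ball 0 1 - {0})) (restrict_space borel (sphere 0 1)) sgn)"

text \<open>Elements of \<open>L\<^sup>2(M)\<close> are represented by functions, with equality a.e. made explicit
  where it matters.\<close>

definition L2 :: "'b measure \<Rightarrow> ('b \<Rightarrow> complex) set" where
  "L2 M = {f \<in> borel_measurable M. integrable M (\<lambda>x. (cmod (f x))\<^sup>2)}"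

definition L2_inner :: "'b measure \<Rightarrow> ('b \<Rightarrow> complex) \<Rightarrow> ('b \<Rightarrow> complex) \<Rightarrow> complex" where
  "L2_inner M f g = (\<integral>x. cnj (f x) * g x \<partial>M)"

definition L2_norm :: "'b measure \<Rightarrow> ('b \<Rightarrow> complex) \<Rightarrow> real" where
  "L2_norm M f = sqrt (\<integral>x. (cmod (f x))\<^sup>2 \<partial>M)"

subsection \<open>Unbounded operators in \<open>L\<^sup>2(M)\<close>\<close>

text \<open>An operator \<open>A\<close> is given by its graph: \<open>(f, g) \<in> A\<close> means \<open>f \<in> dom(A)\<close> and \<open>A f = g\<close>, so
  that \<open>dom(A) = Domain A\<close>. A set of the form \<open>adjoint_op M A\<close> is a linear subspace of
  \<open>L2 M \<times> L2 M\<close> invariant under a.e. modification in both components, and it is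
  single-valued up to a.e. equality if \<open>A\<close> is densely defined. All of this therefore holds
  for self-adjoint operators.\<close>

definition adjoint_op :: "'b measure \<Rightarrow> ('b \<Rightarrow> complex) rel \<Rightarrow> ('b \<Rightarrow> complex) rel" where
  "adjoint_op M A =
     {(g, h). g \<in> L2 M \<and> h \<in> L2 M \<and> (\<forall>(f, k) \<in> A. L2_inner M k g = L2_inner M f h)}"

definition densely_defined :: "'b measure \<Rightarrow> ('b \<Rightarrow> complex) rel \<Rightarrow> bool" where
  "densely_defined M A \<longleftrightarrow>
     (\<forall>g \<in> L2 M. \<forall>e > 0. \<exists>f \<in> Domain A. L2_norm M (\<lambda>x. f x - g x) < e)"

definition self_adjoint :: "'b measure \<Rightarrow> ('b \<Rightarrow> complex) rel \<Rightarrow> bool" where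
  "self_adjoint M A \<longleftrightarrow> densely_defined M A \<and> adjoint_op M A = A"

definition nonneg_op :: "'b measure \<Rightarrow> ('b \<Rightarrow> complex) rel \<Rightarrow> bool" where
  "nonneg_op M A \<longleftrightarrow> (\<forall>(f, k) \<in> A. 0 \<le> Re (L2_inner M f k))"

text \<open>The relational composition \<open>S O S\<close> is the operator \<open>S\<^sup>2\<close> on its natural domain
  \<open>{f \<in> dom(S). S f \<in> dom(S)}\<close>. The square root of a non-negative self-adjoint operator
  exists and is unique as a set.\<close>

definition op_sqrt :: "'b measure \<Rightarrow> ('b \<Rightarrow> complex) rel \<Rightarrow> ('b \<Rightarrow> complex) rel" where
  "op_sqrt M A = (SOME S. self_adjoint M S \<and> nonneg_op M S \<and> S O S = A)"

definition shift_op :: "('b \<Rightarrow> complex) rel \<Rightarrow> complex \<Rightarrow> ('b \<Rightarrow> complex) rel" where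
  "shift_op A z = (\<lambda>(f, k). (f, \<lambda>x. k x - z * f x)) ` A"

text \<open>The bound expresses both that \<open>A - z\<close> is injective and that its inverse is bounded.\<close>

definition resolvent_set :: "'b measure \<Rightarrow> ('b \<Rightarrow> complex) rel \<Rightarrow> complex set" where
  "resolvent_set M A =
     {z. L2 M \<subseteq> Range (shift_op A z) \<and>
         (\<exists>c. \<forall>(f, g) \<in> shift_op A z. L2_norm M f \<le> c * L2_norm M g)}"

definition spectrum :: "'b measure \<Rightarrow> ('b \<Rightarrow> complex) rel \<Rightarrow> complex set" where
  "spectrum M A = - resolvent_set M A"

definition eigenspace :: "('b \<Rightarrow> complex) rel \<Rightarrow> complex \<Rightarrow> ('b \<Rightarrow> complex) set" where
  "eigenspace A z = {f. (f, \<lambda>x. z * f x) \<in> A}"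

text \<open>The finiteness clause says that the eigenvalues, counted with multiplicity, accumulate
  only at infinity; in particular every multiplicity is finite. The last clause says that the
  eigenfunctions belonging to an eigenvalue span its eigenspace, so that the eigenvalue occurs
  in the family exactly as often as its multiplicity. Completeness of the eigenfunctions
  in \<open>L\<^sup>2(M)\<close> is not part of the definition.\<close>

definition purely_discrete_spectrum ::
    "'b measure \<Rightarrow> ('b \<Rightarrow> complex) rel \<Rightarrow> 'i set \<Rightarrow> ('i \<Rightarrow> real) \<Rightarrow> ('i \<Rightarrow> 'b \<Rightarrow> complex) \<Rightarrow> bool" where
  "purely_discrete_spectrum M A I ev u \<longleftrightarrow>
     spectrum M A = (\<lambda>m. complex_of_real (ev m)) ` I \<and>
     (\<forall>m\<in>I. complex_of_real (ev m) isolated_in spectrum M A) \<and>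
     (\<forall>K. finite {m\<in>I. \<bar>ev m\<bar> \<le> K}) \<and>
     (\<forall>m\<in>I. u m \<in> eigenspace A (complex_of_real (ev m))) \<and>
     (\<forall>m\<in>I. \<forall>n\<in>I. L2_inner M (u m) (u n) = (if m = n then 1 else 0)) \<and>
     (\<forall>m\<in>I. \<forall>f \<in> eigenspace A (complex_of_real (ev m)).
        \<exists>c. AE x in M. f x = (\<Sum>k | k \<in> I \<and> ev k = ev m. c k * u k x))"

subsection \<open>Test functions\<close>

primrec Ck_on :: "nat \<Rightarrow> 'a::real_normed_vector set \<Rightarrow> ('a \<Rightarrow> 'b::real_normed_vector) \<Rightarrow> bool" where
  "Ck_on 0 S f \<longleftrightarrow> continuous_on S f"
| "Ck_on (Suc k) S f \<longleftrightarrow>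
     (\<forall>x\<in>S. f differentiable at x) \<and> (\<forall>v. Ck_on k S (\<lambda>x. frechet_derivative f (at x) v))"

definition test_functions :: "'a::euclidean_space set \<Rightarrow> ('a \<Rightarrow> complex) set" where
  "test_functions S = {\<psi>. (\<forall>k. Ck_on k S \<psi>) \<and>
     compact (closure {x. \<psi> x \<noteq> 0}) \<and> closure {x. \<psi> x \<noteq> 0} \<subseteq> S}"

subsection \<open>The operators \<open>\<L>\<close> and \<open>\<D>\<close>\<close>

text \<open>The derivative in \<open>r\<close> at fixed \<open>\<omega>\<close>, where \<open>x = r\<omega>\<close>, i.e. \<open>r = norm x\<close> and \<open>\<omega> = sgn x\<close>.\<close>

definition radial_deriv :: "('a::euclidean_space \<Rightarrow> complex) \<Rightarrow> 'a \<Rightarrow> complex" where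
  "radial_deriv \<psi> x = vector_derivative (\<lambda>r. \<psi> (r *\<^sub>R sgn x)) (at (norm x))"

definition radial_op :: "('a::euclidean_space \<Rightarrow> complex) \<Rightarrow> 'a \<Rightarrow> complex" where
  "radial_op \<psi> x = - radial_deriv (radial_deriv \<psi>) x
     - complex_of_real ((real DIM('a) - 1) / norm x) * radial_deriv \<psi> x"

definition angular_slice :: "('a::euclidean_space \<Rightarrow> complex) \<Rightarrow> real \<Rightarrow> 'a \<Rightarrow> complex" where
  "angular_slice \<psi> r = (\<lambda>\<omega>. \<psi> (r *\<^sub>R \<omega>))"

text \<open>An operator \<open>A\<close> in \<open>L\<^sup>2\<close> of the sphere acts on \<open>\<psi>(r,\<cdot>)\<close> for each \<open>r\<close> separately, which
  determines \<open>A \<psi>(r,\<cdot>)\<close> only up to a null set of the sphere for each \<open>r\<close>. As a function on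
  the whole space, \<open>A \<psi>\<close> is a jointly measurable function with these slices; any two such
  functions agree a.e.\<close>

definition angular_version ::
    "('a::euclidean_space \<Rightarrow> complex) rel \<Rightarrow> ('a \<Rightarrow> complex) \<Rightarrow> ('a \<Rightarrow> complex) \<Rightarrow> bool" where
  "angular_version A \<psi> w \<longleftrightarrow> w \<in> borel_measurable lborel \<and>
     (AE r in lborel. 0 < r \<longrightarrow> (angular_slice \<psi> r, angular_slice w r) \<in> A)"

definition angular_op ::
    "('a::euclidean_space \<Rightarrow> complex) rel \<Rightarrow> ('a \<Rightarrow> complex) \<Rightarrow> 'a \<Rightarrow> complex" where
  "angular_op A \<psi> = (SOME w. angular_version A \<psi> w)"

definition calL ::
    "('a::euclidean_space \<Rightarrow> complex) rel \<Rightarrow> ('a \<Rightarrow> complex) \<Rightarrow> 'a \<Rightarrow> complex" where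
  "calL \<Lambda> \<psi> x = radial_op \<psi> x + angular_op \<Lambda> \<psi> x / complex_of_real ((norm x)\<^sup>2)"

text \<open>For \<open>\<L>\<psi>\<close> to be an element of \<open>L\<^sup>2\<close>, it has to be a measurable function in the first
  place, which is the content of the third condition.\<close>

definition dom_calL :: "('a::euclidean_space \<Rightarrow> complex) rel \<Rightarrow> ('a \<Rightarrow> complex) set" where
  "dom_calL \<Lambda> = {\<psi>. \<psi> \<in> test_functions (- {0}) \<and>
     (\<forall>r>0. angular_slice \<psi> r \<in> Domain \<Lambda>) \<and>
     (\<exists>w. angular_version \<Lambda> \<psi> w) \<and> calL \<Lambda> \<psi> \<in> L2 lborel}"

definition calD ::
    "('a::euclidean_space \<Rightarrow> complex) rel \<Rightarrow> ('a \<Rightarrow> complex) \<Rightarrow> 'a \<Rightarrow> real" where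
  "calD \<Lambda> \<psi> x = (cmod (radial_deriv \<psi> x))\<^sup>2
     + (cmod (angular_op (op_sqrt sphere_measure \<Lambda>) \<psi> x))\<^sup>2 / (norm x)\<^sup>2"

subsection \<open>The constant\<close>

text \<open>The minimum of a possibly infinite family (\<^const>\<open>Min\<close> requires a finite set).\<close>

definition min_over :: "'i set \<Rightarrow> ('i \<Rightarrow> real) \<Rightarrow> real" where
  "min_over I f = (LEAST c. c \<in> f ` I)"

definition hardy_rellich_const :: "nat \<Rightarrow> real \<Rightarrow> 'i set \<Rightarrow> ('i \<Rightarrow> real) \<Rightarrow> real" where
  "hardy_rellich_const d \<alpha> I ev =
     (if real d - \<alpha> - 4 \<noteq> 0
      then min_over I (\<lambda>m. (4 * ev m + (real d + \<alpha>) * (real d - \<alpha> - 4))\<^sup>2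
                            / (4 * (4 * ev m + (real d - \<alpha> - 4)\<^sup>2)))
      else min ((real d - 2)\<^sup>2) (min_over {m\<in>I. ev m \<noteq> 0} ev))"

end

theory Submission
  imports Defs
begin

text \<open>Expanding \<open>\<psi>(r, \<cdot>)\<close> in the eigenfunctions \<open>u m\<close> reduces the claim to one radial inequality for
  each eigenvalue \<open>e\<close>. With \<open>\<beta> = (d - \<alpha> - 4)/2\<close>, \<open>\<gamma> = (d + \<alpha>)/2\<close>, \<open>b = r\<^sup>\<beta> a\<close> and \<open>D = r d/dr\<close>
  the two sides become \<open>\<integral> |(e + \<beta>\<gamma>) b - D\<^sup>2b - (\<gamma> - \<beta>) Db|\<^sup>2 dr/r\<close> and
  \<open>\<integral> (|Db - \<beta>b|\<^sup>2 + e |b|\<^sup>2) dr/r\<close>; their integrands are, up to total derivatives, quadratic forms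
  with constant coefficients in \<open>b\<close>, \<open>Db\<close>, \<open>D\<^sup>2b\<close>, and the constant is optimal at zero frequency.

  On the left the expansion only costs Bessel's inequality, but on the right Parseval's identity is
  indispensable. Completeness of the eigenfunctions holds because an isolated point in the spectrum
  of a self-adjoint operator is an eigenvalue: the restriction of \<open>\<Lambda>\<close> to the orthogonal complement
  of all eigenfunctions has no eigenvectors, hence empty spectrum, and so acts on the zero space.\<close>

subsection \<open>Isolated points of the spectrum\<close>

text \<open>The constant comes from the symbols of the two radial forms. At frequency \<tau> they
  are P^2 + (2P + \<kappa>^2) \<tau>^2 + \<tau>^4, with P = e + \<beta>\<gamma> and \<kappa> =
  \<gamma> - \<beta>, and \<tau>^2 + \<beta>^2 + e. Comparing coefficients asks for K (e +
  \<beta>^2) \<le> P^2 and K \<le> 2P + \<kappa>^2 = 2e + \<beta>^2 + \<gamma>^2. The first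
  condition implies the second unless e = \<beta> = 0, when the first is void and the second reads K
  \<le> \<gamma>^2 = (d - 2)^2; hence the separate case d - \<alpha> - 4 = 0 with its minimum over
  nonzero eigenvalues. The other obstacle is choice: \<open>op_sqrt\<close> and
  \<open>angular_op\<close> are given by \<open>SOME\<close>, so nothing is known about
  \<open>calD\<close> until the square root is shown to be unique and a jointly measurable version
  of its action on \<psi> is shown to exist. The spectral argument uses only real resolvent points,
  so that it runs in a real inner product space and rests on no functional calculus.\<close>

text \<open>For the restriction of an operator to a reducing subspace \<open>H\<close>, given by its graph \<open>G\<close>,
  the real number \<open>c\<close> lies in the resolvent set.\<close>

definition regular_at :: "('v::real_inner \<times> 'v) set \<Rightarrow> 'v set \<Rightarrow> real \<Rightarrow> bool" where
  "regular_at G H c \<longleftrightarrow> (\<forall>g\<in>H. \<exists>f. (f, g + c *\<^sub>R f) \<in> G) \<and>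
     (\<exists>C. \<forall>f k. (f, k) \<in> G \<longrightarrow> norm f \<le> C * norm (k - c *\<^sub>R f))"

definition symmetric_rel :: "('v::real_inner \<times> 'v) set \<Rightarrow> bool" where
  "symmetric_rel G \<longleftrightarrow> (\<forall>f k f' k'. (f, k) \<in> G \<longrightarrow> (f', k') \<in> G \<longrightarrow> inner k f' = inner f k')"

lemma regular_at_bound:
  assumes "regular_at G H c"
  obtains C where "C > 0" "\<And>f k. (f, k) \<in> G \<Longrightarrow> norm f \<le> C * norm (k - c *\<^sub>R f)"
proof -
  obtain C where C: "\<And>f k. (f, k) \<in> G \<Longrightarrow> norm f \<le> C * norm (k - c *\<^sub>R f)"
    using assms by (auto simp: regular_at_def)
  show ?thesis
  proof (rule that[of "max C 1"])
    fix f k assume "(f, k) \<in> G"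
    from C[OF this] show "norm f \<le> max C 1 * norm (k - c *\<^sub>R f)"
      by (rule order_trans) (simp add: mult_right_mono)
  qed simp
qed

text \<open>With \<open>B = (A - c)\<^sup>-\<^sup>1\<close> and \<open>N = \<parallel>B\<parallel>\<close>, the operator \<open>B\<^sup>2 - N\<^sup>2 = (B - N) (B + N)\<close> is not
  bounded below, so one of \<open>c \<plusminus> 1/N\<close> is a spectral point.\<close>

lemma regular_at_dist:
  fixes G :: "('v::real_inner \<times> 'v) set"
  assumes G: "subspace G" "symmetric_rel G" "G \<subseteq> H \<times> H" and H: "subspace H"
    and \<rho>: "\<rho> > 0" and reg: "\<And>z. \<bar>z - c\<bar> < \<rho> \<Longrightarrow> regular_at G H z" and fk: "(f, k) \<in> G"
  shows "\<rho> * norm f \<le> norm (k - c *\<^sub>R f)"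
proof -
  \<comment> \<open>\<open>S\<close> holds the norms of the images of the unit ball under B = (A -
    c)^-1, expressed through the graph with f = B (k - c f); its supremum \<open>N\<close> is
    therefore the operator norm of B.\<close>
  define S where "S = {norm f | f k. (f, k) \<in> G \<and> norm (k - c *\<^sub>R f) \<le> 1}"
  define N where "N = Sup S"
  have regc: "regular_at G H c" using reg[of c] \<rho> by simp
  obtain C where C: "C > 0" "\<And>f k. (f, k) \<in> G \<Longrightarrow> norm f \<le> C * norm (k - c *\<^sub>R f)"
    using regular_at_bound[OF regc] by blast
  have bdd: "bdd_above S"
  proof (rule bdd_aboveI)
    fix x assume "x \<in> S"
    then obtain f k where x: "x = norm f" "(f, k) \<in> G" "norm (k - c *\<^sub>R f) \<le> 1" by (auto simp: S_def)
    have "norm f \<le> C * norm (k - c *\<^sub>R f)" by (rule C) fact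
    also have "\<dots> \<le> C * 1" using x(3) C(1) by (intro mult_left_mono) auto
    finally show "x \<le> C" using x(1) by simp
  qed
  have zero: "(0, 0) \<in> G" using subspace_0[OF G(1)] by (simp add: zero_prod_def)
  have "0 \<in> S" unfolding S_def using zero by force
  then have N0: "N \<ge> 0" unfolding N_def by (rule cSup_upper) (rule bdd)
  have le_N: "norm f \<le> N * norm (k - c *\<^sub>R f)" if "(f, k) \<in> G" for f k
  proof (cases "k - c *\<^sub>R f = 0")
    case True
    then show ?thesis using C(2)[OF that] by simp
  next
    case False
    define t where "t = norm (k - c *\<^sub>R f)"
    have t: "t > 0" using False by (simp add: t_def)
    have "(1/t) *\<^sub>R (f, k) \<in> G" by (rule subspace_scale[OF G(1) that])
    moreover have "norm ((1/t) *\<^sub>R k - c *\<^sub>R ((1/t) *\<^sub>R f)) \<le> 1"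
    proof -
      have "(1/t) *\<^sub>R k - c *\<^sub>R ((1/t) *\<^sub>R f) = (1/t) *\<^sub>R (k - c *\<^sub>R f)" by (simp add: algebra_simps)
      then have "norm ((1/t) *\<^sub>R k - c *\<^sub>R ((1/t) *\<^sub>R f)) = \<bar>1/t\<bar> * t" by (simp only: norm_scaleR t_def)
      then show ?thesis using t by simp
    qed
    ultimately have "norm ((1/t) *\<^sub>R f) \<in> S" unfolding S_def by force
    then have "norm ((1/t) *\<^sub>R f) \<le> N" unfolding N_def by (rule cSup_upper) (rule bdd)
    then show ?thesis using t by (simp add: t_def[symmetric] field_simps)
  qed
  have "N \<le> 1/\<rho>"
  proof (rule ccontr)
    assume "\<not> N \<le> 1/\<rho>"
    then have N: "N > 1/\<rho>" by simp
    then have Npos: "N > 0" using \<rho> by (meson less_trans zero_less_divide_1_iff)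
    \<comment> \<open>N > 1/\<rho> puts both c + 1/N and c - 1/N inside the assumed interval of
      regular points. The two resolvent bounds control the factors B - N and B + N.\<close>
    define s where "s = 1/N"
    have s: "s > 0" "s < \<rho>" "s * N = 1" using N Npos \<rho> by (auto simp: s_def field_simps)
    have r1: "regular_at G H (c + s)" and r2: "regular_at G H (c - s)" using s by (auto intro: reg)
    obtain C1 where C1: "C1 > 0" "\<And>f k. (f, k) \<in> G \<Longrightarrow> norm f \<le> C1 * norm (k - (c + s) *\<^sub>R f)"
      using regular_at_bound[OF r1] by blast
    obtain C2 where C2: "C2 > 0" "\<And>f k. (f, k) \<in> G \<Longrightarrow> norm f \<le> C2 * norm (k - (c - s) *\<^sub>R f)"
      using regular_at_bound[OF r2] by blast
    \<comment> \<open>C1 s bounds B p by (B - N) p, (C1 s + 1) s bounds p itself by (B - N) p, and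
      C2 s bounds B g by (B + N) g. The product bounds B g by (B^2 - N^2) g.\<close>
    define E where "E = C2 * s * ((C1 * s + 1) * s)"
    have E: "E > 0" unfolding E_def using C1 C2 s by (intro mult_pos_pos add_pos_pos) auto
    \<comment> \<open>Solving |f|^2 \<le> E^2 (N^4 - N^2 |f|^2) for |f|^2 gives the bound N^2
      \<theta>. As \<theta> is below 1 and independent of f, this contradicts that \<open>N\<close>
      is the supremum.\<close>
    define \<theta> where "\<theta> = E^2 * N^2 / (1 + E^2 * N^2)"
    have th: "0 \<le> \<theta>" "\<theta> < 1" unfolding \<theta>_def
      by (auto intro!: divide_nonneg_pos add_pos_nonneg simp: divide_less_eq add_pos_nonneg)
    have key: "norm f \<le> N * sqrt \<theta>" if fk: "(f, k) \<in> G" and le1: "norm (k - c *\<^sub>R f) \<le> 1" for f k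
    proof -
      define g where "g = k - c *\<^sub>R f"
      have "f \<in> H" "k \<in> H" using fk G(3) by auto
      then obtain f2 where f2: "(f2, f + c *\<^sub>R f2) \<in> G" using regc by (auto simp: regular_at_def)
      \<comment> \<open>In terms of B: f = B g, f2 = B^2 g, p = (B + N) g and q = B p, so that N p -
        q = -(B^2 - N^2) g.\<close>
      define p where "p = f + N *\<^sub>R g"
      define q where "q = f2 + N *\<^sub>R f"
      have "(f2, f + c *\<^sub>R f2) + N *\<^sub>R (f, k) \<in> G"
        by (intro subspace_add subspace_scale G f2 fk)
      moreover have "(f2, f + c *\<^sub>R f2) + N *\<^sub>R (f, k) = (q, p + c *\<^sub>R q)"
        by (simp add: q_def p_def g_def algebra_simps)
      ultimately have qG: "(q, p + c *\<^sub>R q) \<in> G" by simp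
      have a1: "norm q \<le> C1 * s * norm (N *\<^sub>R p - q)"
      proof -
        have "p + c *\<^sub>R q - (c + s) *\<^sub>R q = s *\<^sub>R (N *\<^sub>R p - q)"
          using s(3) by (simp add: algebra_simps)
        then have "norm (p + c *\<^sub>R q - (c + s) *\<^sub>R q) = s * norm (N *\<^sub>R p - q)"
          using s(1) by simp
        with C1(2)[OF qG] show ?thesis by (simp add: mult.assoc)
      qed
      have a2: "norm p \<le> (C1 * s + 1) * s * norm (N *\<^sub>R p - q)"
      proof -
        have "N * norm p = norm (q + (N *\<^sub>R p - q))" using Npos by simp
        also have "\<dots> \<le> norm q + norm (N *\<^sub>R p - q)" by (rule norm_triangle_ineq)
        also have "\<dots> \<le> (C1 * s + 1) * norm (N *\<^sub>R p - q)" using a1 by (simp add: algebra_simps)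
        finally have "s * (N * norm p) \<le> s * ((C1 * s + 1) * norm (N *\<^sub>R p - q))"
          using s(1) by (intro mult_left_mono) auto
        moreover have "s * (N * norm p) = norm p" using s(3) by (simp add: mult.assoc[symmetric])
        ultimately have "norm p \<le> s * ((C1 * s + 1) * norm (N *\<^sub>R p - q))" by simp
        then show ?thesis by (simp only: mult_ac)
      qed
      have a3: "norm f \<le> C2 * s * norm p"
      proof -
        have "k - (c - s) *\<^sub>R f = s *\<^sub>R p"
          using s(3) by (simp add: p_def g_def algebra_simps)
        then have "norm (k - (c - s) *\<^sub>R f) = s * norm p" using s(1) by simp
        with C2(2)[OF fk] show ?thesis by (simp add: mult.assoc)
      qed
      have "norm f \<le> C2 * s * ((C1 * s + 1) * s * norm (N *\<^sub>R p - q))"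
        using C2(1) s(1) by (intro order_trans[OF a3] mult_left_mono a2) auto
      also have "\<dots> = E * norm (f2 - N^2 *\<^sub>R g)"
      proof -
        have "N *\<^sub>R p - q = - (f2 - N^2 *\<^sub>R g)"
          by (simp add: p_def q_def algebra_simps power2_eq_square)
        then have "norm (N *\<^sub>R p - q) = norm (f2 - N^2 *\<^sub>R g)" by (metis norm_minus_cancel)
        then show ?thesis by (simp add: E_def mult_ac)
      qed
      finally have b1: "norm f ^ 2 \<le> E^2 * norm (f2 - N^2 *\<^sub>R g) ^ 2"
        by (metis norm_ge_zero power_mono power_mult_distrib)
      \<comment> \<open>Symmetry in the form <B^2 g, g> = |B g|^2. Together with |B^2 g| \<le> N |B
        g| it gives |(B^2 - N^2) g|^2 \<le> N^4 |g|^2 - N^2 |B g|^2.\<close>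
      have ip: "inner f2 g = norm f ^ 2"
      proof -
        have "inner (f + c *\<^sub>R f2) f = inner f2 k"
          using G(2) f2 fk unfolding symmetric_rel_def by blast
        then show ?thesis by (simp add: g_def inner_simps power2_norm_eq_inner)
      qed
      have f2N: "norm f2 ^ 2 \<le> N^2 * norm f ^ 2"
        using le_N[OF f2] by (simp add: power_mult_distrib[symmetric] power_mono)
      have "norm (f2 - N^2 *\<^sub>R g) ^ 2 = norm f2 ^ 2 - 2 * N^2 * norm f ^ 2 + N^4 * norm g ^ 2"
        unfolding power2_norm_eq_inner
        by (simp add: inner_simps inner_commute[of g f2] ip power2_norm_eq_inner)
           (simp add: power2_eq_square algebra_simps eval_nat_numeral)
      also have "\<dots> \<le> N^4 * norm g ^ 2 - N^2 * norm f ^ 2" using f2N by simp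
      also have "\<dots> \<le> N^4 - N^2 * norm f ^ 2"
        using le1 by (simp add: g_def mult_left_le power_le_one)
      finally have "E^2 * norm (f2 - N^2 *\<^sub>R g) ^ 2 \<le> E^2 * (N^4 - N^2 * norm f ^ 2)"
        by (rule mult_left_mono) simp
      with b1 have "norm f ^ 2 * (1 + E^2 * N^2) \<le> N^2 * (E^2 * N^2)"
        by (simp add: algebra_simps eval_nat_numeral)
      then have "norm f ^ 2 \<le> N^2 * \<theta>"
        unfolding \<theta>_def using add_pos_nonneg[of 1 "E^2 * N^2"] by (simp add: field_simps)
      also have "\<dots> = (N * sqrt \<theta>) ^ 2" using th by (simp add: power_mult_distrib)
      finally show ?thesis by (rule power2_le_imp_le) (use th Npos in simp)
    qed
    have "Sup S \<le> N * sqrt \<theta>"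
    proof (rule cSup_least)
      show "S \<noteq> {}" using \<open>0 \<in> S\<close> by blast
    qed (use key in \<open>auto simp: S_def\<close>)
    then have "N \<le> N * sqrt \<theta>" by (simp add: N_def)
    moreover have "sqrt \<theta> < 1" using th by simp
    ultimately show False using Npos by simp
  qed
  then have "\<rho> * N \<le> 1" using \<rho> by (simp add: field_simps)
  have "\<rho> * norm f \<le> \<rho> * (N * norm (k - c *\<^sub>R f))" using \<rho> le_N[OF fk] by (intro mult_left_mono) auto
  also have "\<dots> = (\<rho> * N) * norm (k - c *\<^sub>R f)" by simp
  also have "\<dots> \<le> 1 * norm (k - c *\<^sub>R f)" using \<open>\<rho> * N \<le> 1\<close> by (intro mult_right_mono) auto
  finally show ?thesis by simp
qed

text \<open>Discriminant condition for a quadratic in t, tested at its minimiser t = b/y^2; for y =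
  0 a large t already excludes b > 0. Polarisation produces such a family of inequalities, and no
  norm has to be nonzero.\<close>

lemma le_mult_if_quadratic:
  fixes b x y :: real
  assumes q: "\<And>t. 2 * t * b \<le> x^2 + t^2 * y^2" and "x \<ge> 0" "y \<ge> 0"
  shows "b \<le> x * y"
proof (rule ccontr)
  assume n: "\<not> b \<le> x * y"
  moreover have "x * y \<ge> 0" using assms by simp
  ultimately have b: "b > 0" by linarith
  show False
  proof (cases "y = 0")
    case True
    then show False using q[of "(x^2 + 1) / (2 * b)"] b by simp
  next
    case False
    then have y: "y > 0" using assms by simp
    from q[of "b / y^2"] y have "b^2 / y^2 \<le> x^2" by (simp add: power2_eq_square field_simps)
    then have "b^2 \<le> (x * y)^2" using y by (simp add: field_simps power_mult_distrib)
    then have "b \<le> x * y" using \<open>x * y \<ge> 0\<close> by (rule power2_le_imp_le)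
    with n show False by simp
  qed
qed

text \<open>A punctured resolvent neighbourhood \<open>(\<mu> - \<delta>, \<mu> + \<delta>)\<close> gives \<open>A\<^sup>2 \<ge> \<delta> \<bar>A\<bar>\<close> for \<open>A\<close> shifted by
  \<open>\<mu>\<close>; polarised, this is the form used here.\<close>

lemma spectral_gap_form_bound:
  fixes G :: "('v::real_inner \<times> 'v) set"
  assumes G: "subspace G" "symmetric_rel G" "G \<subseteq> H \<times> H" and H: "subspace H" and \<delta>: "\<delta> > 0"
    and reg: "\<And>z. z \<noteq> \<mu> \<Longrightarrow> \<bar>z - \<mu>\<bar> < \<delta> \<Longrightarrow> regular_at G H z"
    and f: "(f, k) \<in> G" and h: "(h, l) \<in> G"
  shows "\<delta> * \<bar>inner (k - \<mu> *\<^sub>R f) h\<bar> \<le> norm (k - \<mu> *\<^sub>R f) * norm (l - \<mu> *\<^sub>R h)"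
proof -
  have diag: "\<delta> * \<bar>inner (k - \<mu> *\<^sub>R f) f\<bar> \<le> norm (k - \<mu> *\<^sub>R f) ^ 2" if fk: "(f, k) \<in> G" for f k
  proof -
    define a where "a = k - \<mu> *\<^sub>R f"
    have *: "\<sigma> * \<delta> * inner a f \<le> norm a ^ 2" if \<sigma>: "\<sigma> = 1 \<or> \<sigma> = -1" for \<sigma> :: real
    proof -
      \<comment> \<open>The open interval of radius \<delta>/2 about \<mu> + \<sigma>\<delta>/2 just
        misses \<mu>. After squaring, the terms in |f|^2 on the two sides cancel and leave the
        claim.\<close>
      have "\<delta>/2 * norm f \<le> norm (k - (\<mu> + \<sigma> * \<delta>/2) *\<^sub>R f)"
      proof (rule regular_at_dist[OF G H])
        fix z assume "\<bar>z - (\<mu> + \<sigma> * \<delta>/2)\<bar> < \<delta>/2"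
        then have "z - (\<mu> + \<sigma> * \<delta>/2) < \<delta>/2" "- (z - (\<mu> + \<sigma> * \<delta>/2)) < \<delta>/2" by linarith+
        then have "z \<noteq> \<mu>" "\<bar>z - \<mu>\<bar> < \<delta>" using \<sigma> \<delta> by (auto simp: abs_less_iff)
        then show "regular_at G H z" by (rule reg)
      qed (use \<delta> fk in auto)
      then have "(\<delta>/2 * norm f)^2 \<le> norm (a - (\<sigma> * \<delta>/2) *\<^sub>R f) ^ 2"
        using \<delta> by (intro power_mono) (auto simp: a_def algebra_simps)
      also have "\<dots> = norm a ^ 2 - \<sigma> * \<delta> * inner a f + \<sigma>^2 * (\<delta>/2 * norm f)^2"
        unfolding power2_norm_eq_inner power_mult_distrib
        by (simp add: inner_simps inner_commute[of f a] power2_eq_square algebra_simps)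
      finally show ?thesis using \<sigma> by auto
    qed
    show ?thesis using *[of 1] *[of "-1"] \<delta> unfolding a_def[symmetric] by (auto simp: abs_if)
  qed
  define a b where "a = k - \<mu> *\<^sub>R f" and "b = l - \<mu> *\<^sub>R h"
  have main: "\<delta> * (\<sigma> * inner a h) \<le> norm a * norm b" if \<sigma>: "\<sigma> = 1 \<or> \<sigma> = -1" for \<sigma> :: real
  proof (rule le_mult_if_quadratic)
    fix t :: real
    define s where "s = t * \<sigma>"
    have s2: "s * s = t^2" using \<sigma> by (auto simp: s_def power2_eq_square)
    have sym: "inner a h = inner b f"
    proof -
      have "inner k h = inner f l" using G(2) f h unfolding symmetric_rel_def by blast
      then show ?thesis by (simp add: a_def b_def inner_simps inner_commute)
    qed
    \<comment> \<open>The diagonal bound at f + s h and, with the opposite sign, at f - s h: the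
      terms in <a, f> and <b, h> cancel, the mixed ones add up to 4 s <a, h>, and the parallelogram
      law handles the right-hand side.\<close>
    have "(f, k) + s *\<^sub>R (h, l) \<in> G" "(f, k) - s *\<^sub>R (h, l) \<in> G"
      by (intro subspace_add subspace_diff subspace_scale G f h)+
    then have p: "(f + s *\<^sub>R h, k + s *\<^sub>R l) \<in> G" and m: "(f - s *\<^sub>R h, k - s *\<^sub>R l) \<in> G" by auto
    have e1: "k + s *\<^sub>R l - \<mu> *\<^sub>R (f + s *\<^sub>R h) = a + s *\<^sub>R b"
      and e2: "k - s *\<^sub>R l - \<mu> *\<^sub>R (f - s *\<^sub>R h) = a - s *\<^sub>R b"
      by (simp_all add: a_def b_def algebra_simps)
    have "\<delta> * inner (a + s *\<^sub>R b) (f + s *\<^sub>R h) \<le> norm (a + s *\<^sub>R b) ^ 2"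
      using diag[OF p] mult_left_mono[OF abs_ge_self less_imp_le[OF \<delta>]] unfolding e1
      by (rule order_trans[rotated])
    moreover have "- (\<delta> * inner (a - s *\<^sub>R b) (f - s *\<^sub>R h)) \<le> norm (a - s *\<^sub>R b) ^ 2"
      using diag[OF m] mult_left_mono[OF abs_ge_minus_self less_imp_le[OF \<delta>]]
      unfolding e2 mult_minus_right by (rule order_trans[rotated])
    ultimately have "\<delta> * (4 * s * inner a h) \<le> 2 * norm a ^ 2 + 2 * (s * s) * norm b ^ 2"
      unfolding power2_norm_eq_inner
      by (simp add: inner_simps sym[symmetric] inner_commute algebra_simps)
    then show "2 * t * (\<delta> * (\<sigma> * inner a h)) \<le> norm a ^ 2 + t^2 * norm b ^ 2"
      unfolding s2 by (simp add: s_def algebra_simps)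
  qed auto
  show ?thesis using main[of 1] main[of "-1"] unfolding a_def[symmetric] b_def[symmetric] by (auto simp: abs_if)
qed

text \<open>An isolated point \<open>\<mu>\<close> of the spectrum is an eigenvalue. With \<open>y\<^sub>\<epsilon> = \<epsilon> (A - \<mu> - \<epsilon>)\<^sup>-\<^sup>1 g\<close> one has
  \<open>\<langle>y\<^sub>\<epsilon>, g + y\<^sub>\<eta>\<rangle> = O(\<epsilon>)\<close> by the gap inequality, so \<open>y\<^sub>\<epsilon>\<close> converges, and its limit is an eigenvector.\<close>

lemma isolated_regular:
  fixes G :: "('v::{real_inner,complete_space} \<times> 'v) set"
  assumes G: "subspace G" "symmetric_rel G" "G \<subseteq> H \<times> H" and H: "subspace H" and cl: "closed G"
    and \<delta>: "\<delta> > 0" and reg: "\<And>z. z \<noteq> \<mu> \<Longrightarrow> \<bar>z - \<mu>\<bar> < \<delta> \<Longrightarrow> regular_at G H z"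
    and ker: "\<And>f. (f, \<mu> *\<^sub>R f) \<in> G \<Longrightarrow> f = 0"
  shows "regular_at G H \<mu>"
proof -
  \<comment> \<open>Approximate solutions of (A - \<mu>) f = g. The error y_n = e_n f_n tends to 0
    although nothing yet bounds the f_n; the lower bound derived from this later makes them
    converge.\<close>
  have approx: "\<exists>f y. (\<forall>n. (f n, g + \<mu> *\<^sub>R f n + y n) \<in> G) \<and> y \<longlonglongrightarrow> 0" if g: "g \<in> H" for g
  proof -
    \<comment> \<open>The offset 2 gives 2 e_n \<le> \<delta>, so the open interval of radius e_n
      about \<mu> + e_n stays within \<delta> of \<mu> and excludes \<mu>.\<close>
    define e where "e = (\<lambda>n::nat. \<delta> / (real n + 2))"
    have e: "e n > 0" "2 * e n \<le> \<delta>" for n using \<delta> by (auto simp: e_def field_simps)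
    have regn: "regular_at G H (\<mu> + e n)" for n using e[of n] \<delta> by (intro reg) auto
    have "\<forall>n. \<exists>f. (f, g + (\<mu> + e n) *\<^sub>R f) \<in> G" using regn g unfolding regular_at_def by blast
    then obtain f where f: "\<And>n. (f n, g + (\<mu> + e n) *\<^sub>R f n) \<in> G" by metis
    define y where "y = (\<lambda>n. e n *\<^sub>R f n)"
    have af: "g + (\<mu> + e n) *\<^sub>R f n - \<mu> *\<^sub>R f n = g + y n" for n by (simp add: y_def algebra_simps)
    have yg: "norm (y n) \<le> norm g" for n
    proof -
      have "e n * norm (f n) \<le> norm (g + (\<mu> + e n) *\<^sub>R f n - (\<mu> + e n) *\<^sub>R f n)"
      proof (rule regular_at_dist[OF G H _ _ f])
        fix z assume "\<bar>z - (\<mu> + e n)\<bar> < e n"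
        then show "regular_at G H z" using e[of n] by (intro reg) auto
      qed (rule e)
      then show ?thesis using e(1)[of n] by (simp add: y_def)
    qed
    have yG: "(y n, \<mu> *\<^sub>R y n + e n *\<^sub>R (g + y n)) \<in> G" for n
    proof -
      have "e n *\<^sub>R (f n, g + (\<mu> + e n) *\<^sub>R f n) \<in> G" by (rule subspace_scale[OF G(1) f])
      moreover have "e n *\<^sub>R (f n, g + (\<mu> + e n) *\<^sub>R f n) = (y n, \<mu> *\<^sub>R y n + e n *\<^sub>R (g + y n))"
        by (simp add: y_def algebra_simps)
      ultimately show ?thesis by simp
    qed
    define K where "K = 4 * norm g ^ 2"
    have small: "\<bar>inner (y n) (g + y m)\<bar> \<le> K / (real n + 2)" for n m
    proof -
      have bd: "norm (g + y j) \<le> 2 * norm g" for j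
        using norm_triangle_ineq[of g "y j"] yg[of j] by linarith
      \<comment> \<open>Since (A - \<mu>) y_n = e_n (g + y_n) and (A - \<mu>) f_m = g + y_m,
        symmetry moves the operator onto y_n and thereby produces the small factor e_n.\<close>
      have eq: "inner (y n) (g + y m) = inner (e n *\<^sub>R (g + y n)) (f m)"
      proof -
        have "inner (\<mu> *\<^sub>R y n + e n *\<^sub>R (g + y n)) (f m) = inner (y n) (g + (\<mu> + e m) *\<^sub>R f m)"
          using G(2) yG f unfolding symmetric_rel_def by blast
        then show ?thesis by (simp add: y_def algebra_simps inner_simps)
      qed
      have "\<delta> * \<bar>inner (e n *\<^sub>R (g + y n)) (f m)\<bar> \<le> norm (e n *\<^sub>R (g + y n)) * norm (g + y m)"
      proof -
        have "\<delta> * \<bar>inner (\<mu> *\<^sub>R y n + e n *\<^sub>R (g + y n) - \<mu> *\<^sub>R y n) (f m)\<bar>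
          \<le> norm (\<mu> *\<^sub>R y n + e n *\<^sub>R (g + y n) - \<mu> *\<^sub>R y n)
            * norm (g + (\<mu> + e m) *\<^sub>R f m - \<mu> *\<^sub>R f m)"
          by (rule spectral_gap_form_bound[OF G H \<delta> _ yG f]) (rule reg)
        then show ?thesis unfolding af by simp
      qed
      also have "\<dots> = e n * (norm (g + y n) * norm (g + y m))" using e(1)[of n] by simp
      also have "\<dots> \<le> e n * ((2 * norm g) * (2 * norm g))"
        using e(1)[of n] by (intro mult_left_mono mult_mono bd) auto
      also have "\<dots> = \<delta> * (K / (real n + 2))" by (simp add: e_def K_def power2_eq_square)
      finally show ?thesis unfolding eq using \<delta> by (simp only: mult_le_cancel_left_pos)
    qed
    \<comment> \<open>Writing y_n - y_m as (g + y_n) - (g + y_m) in one of the two slots leaves four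
      products of the small kind, so the sequence is Cauchy.\<close>
    have diff: "norm (y n - y m) ^ 2 \<le> 2 * K / (real n + 2) + 2 * K / (real m + 2)" for n m
    proof -
      have "norm (y n - y m) ^ 2 = inner (y n) (g + y n) - inner (y n) (g + y m)
          - inner (y m) (g + y n) + inner (y m) (g + y m)"
        unfolding power2_norm_eq_inner by (simp add: inner_simps inner_commute)
      then show ?thesis using small[of n n] small[of n m] small[of m n] small[of m m] by linarith
    qed
    have K0: "K \<ge> 0" by (simp add: K_def)
    have "Cauchy y"
    proof (rule CauchyI)
      fix r :: real assume r: "r > 0"
      obtain N :: nat where N: "4 * K / r^2 < real N" using reals_Archimedean2 by blast
      show "\<exists>M. \<forall>m\<ge>M. \<forall>n\<ge>M. norm (y m - y n) < r"
      proof (intro exI allI impI)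
        fix m n assume mn: "m \<ge> N" "n \<ge> N"
        have *: "2 * K / (real j + 2) \<le> 2 * K / (real N + 2)" if "j \<ge> N" for j
          using that K0 by (intro divide_left_mono mult_pos_pos) auto
        have "norm (y m - y n) ^ 2 \<le> 4 * K / (real N + 2)"
          using diff[of m n] *[OF mn(1)] *[OF mn(2)] by linarith
        also have "\<dots> < r^2"
        proof -
          have "4 * K < real N * r^2" using N r by (simp add: field_simps)
          also have "\<dots> \<le> (real N + 2) * r^2" by (intro mult_right_mono) auto
          finally show ?thesis by (simp add: divide_less_eq mult.commute)
        qed
        finally show "norm (y m - y n) < r" by (rule power2_less_imp_less) (use r in simp)
      qed
    qed
    then obtain Y where Y: "y \<longlonglongrightarrow> Y" using convergent_eq_Cauchy by blast
    have e0: "e \<longlonglongrightarrow> 0"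
    proof -
      have "(\<lambda>n. \<delta> * (1 / (real n + 2))) \<longlonglongrightarrow> \<delta> * 0"
        using LIMSEQ_ignore_initial_segment[OF lim_1_over_n, of 2]
        by (intro tendsto_mult tendsto_const) (simp add: add.commute)
      then show ?thesis by (simp add: e_def)
    qed
    have "(\<lambda>n. (y n, \<mu> *\<^sub>R y n + e n *\<^sub>R (g + y n))) \<longlonglongrightarrow> (Y, \<mu> *\<^sub>R Y + 0 *\<^sub>R (g + Y))"
      by (intro tendsto_intros Y e0)
    then have "(Y, \<mu> *\<^sub>R Y) \<in> G" using closed_sequentially[OF cl, of "\<lambda>n. (y n, \<mu> *\<^sub>R y n + e n *\<^sub>R (g + y n))"] yG by simp
    then have "Y = 0" by (rule ker)
    moreover have "(f n, g + \<mu> *\<^sub>R f n + y n) \<in> G" for n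
      using f[of n] by (simp add: y_def algebra_simps)
    ultimately show ?thesis using Y by (intro exI[of _ f] exI[of _ y]) simp
  qed
  \<comment> \<open>f is tested against approximate solutions h_n of (A - \<mu>) h = f: the form
    bound then reads \<delta> |<f, f + y_n>| \<le> |(A - \<mu>) f| |f + y_n|, and y_n tends to
    0.\<close>
  have bound: "\<delta> * norm f \<le> norm (k - \<mu> *\<^sub>R f)" if fk: "(f, k) \<in> G" for f k
  proof -
    have "f \<in> H" using fk G(3) by auto
    then obtain h y where h: "\<And>n. (h n, f + \<mu> *\<^sub>R h n + y n) \<in> G" and y: "y \<longlonglongrightarrow> 0" using approx by blast
    have "\<delta> * \<bar>inner f (f + y n)\<bar> \<le> norm (k - \<mu> *\<^sub>R f) * norm (f + y n)" for n
    proof -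
      have "inner k (h n) = inner f (f + \<mu> *\<^sub>R h n + y n)"
        using G(2) fk h unfolding symmetric_rel_def by blast
      then have "inner (k - \<mu> *\<^sub>R f) (h n) = inner f (f + y n)" by (simp add: inner_simps)
      moreover have "\<delta> * \<bar>inner (k - \<mu> *\<^sub>R f) (h n)\<bar>
          \<le> norm (k - \<mu> *\<^sub>R f) * norm (f + \<mu> *\<^sub>R h n + y n - \<mu> *\<^sub>R h n)"
        by (rule spectral_gap_form_bound[OF G H \<delta> _ fk h]) (rule reg)
      ultimately show ?thesis by (simp add: algebra_simps)
    qed
    moreover have "(\<lambda>n. \<delta> * \<bar>inner f (f + y n)\<bar>) \<longlonglongrightarrow> \<delta> * \<bar>inner f (f + 0)\<bar>"
      by (intro tendsto_intros y)
    moreover have "(\<lambda>n. norm (k - \<mu> *\<^sub>R f) * norm (f + y n)) \<longlonglongrightarrow> norm (k - \<mu> *\<^sub>R f) * norm (f + 0)"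
      by (intro tendsto_intros y)
    ultimately have "\<delta> * \<bar>inner f (f + 0)\<bar> \<le> norm (k - \<mu> *\<^sub>R f) * norm (f + 0)"
      by (intro LIMSEQ_le) auto
    then have "(\<delta> * norm f) * norm f \<le> norm (k - \<mu> *\<^sub>R f) * norm f"
      by (simp add: power2_norm_eq_inner[symmetric] power2_eq_square)
    then show ?thesis by (cases "f = 0") auto
  qed
  have "\<exists>f. (f, g + \<mu> *\<^sub>R f) \<in> G" if g: "g \<in> H" for g
  proof -
    obtain f y where f: "\<And>n. (f n, g + \<mu> *\<^sub>R f n + y n) \<in> G" and y: "y \<longlonglongrightarrow> 0" using approx[OF g] by blast
    \<comment> \<open>The lower bound, applied to differences, makes the approximate solutions a
      Cauchy sequence, and closedness of G makes the limit an exact solution.\<close>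
    have le: "\<delta> * norm (f n - f m) \<le> norm (y n - y m)" for n m
    proof -
      have "(f n, g + \<mu> *\<^sub>R f n + y n) - (f m, g + \<mu> *\<^sub>R f m + y m) \<in> G"
        by (intro subspace_diff G f)
      then have "(f n - f m, \<mu> *\<^sub>R f n + y n - (\<mu> *\<^sub>R f m + y m)) \<in> G" by (simp add: algebra_simps)
      from bound[OF this] show ?thesis by (simp add: algebra_simps)
    qed
    have "Cauchy f"
    proof (rule CauchyI)
      fix r :: real assume "r > 0"
      then have "\<delta> * r > 0" using \<delta> by simp
      then obtain M where M: "\<And>m n. m \<ge> M \<Longrightarrow> n \<ge> M \<Longrightarrow> norm (y m - y n) < \<delta> * r"
        using CauchyD[OF LIMSEQ_imp_Cauchy[OF y]] by blast
      have "norm (f m - f n) < r" if "m \<ge> M" "n \<ge> M" for m n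
      proof -
        have "\<delta> * norm (f m - f n) < \<delta> * r" by (rule order.strict_trans1[OF le M[OF that]])
        then show ?thesis using \<delta> by simp
      qed
      then show "\<exists>M. \<forall>m\<ge>M. \<forall>n\<ge>M. norm (f m - f n) < r" by blast
    qed
    then obtain F where F: "f \<longlonglongrightarrow> F" using convergent_eq_Cauchy by blast
    have "(\<lambda>n. (f n, g + \<mu> *\<^sub>R f n + y n)) \<longlonglongrightarrow> (F, g + \<mu> *\<^sub>R F + 0)"
      by (intro tendsto_intros F y)
    then have "(F, g + \<mu> *\<^sub>R F + 0) \<in> G" using closed_sequentially[OF cl, of "\<lambda>n. (f n, g + \<mu> *\<^sub>R f n + y n)"] f by simp
    then show ?thesis by auto
  qed
  moreover have "norm f \<le> 1/\<delta> * norm (k - \<mu> *\<^sub>R f)" if "(f, k) \<in> G" for f k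
    using bound[OF that] \<delta> by (simp add: field_simps)
  ultimately show ?thesis
    unfolding regular_at_def by (intro conjI ballI exI[of _ "1/\<delta>"] allI impI)
qed

text \<open>Every real number is regular: the points of E because they are isolated and carry no
  eigenvector, the rest by assumption. The distance bound about 0 then holds with every radius, and
  \<rho> = (|k| + 1)/|f| violates it unless f = 0. Since the operator maps onto H, single-valuedness
  at 0 leaves only the zero space.\<close>

theorem discrete_spectrum_no_eigenvector_trivial:
  fixes G :: "('v::{real_inner,complete_space} \<times> 'v) set"
  assumes G: "subspace G" "symmetric_rel G" "G \<subseteq> H \<times> H" and H: "subspace H" and cl: "closed G"
    and single: "\<And>k. (0, k) \<in> G \<Longrightarrow> k = 0"
    and reg: "\<And>z. z \<notin> E \<Longrightarrow> regular_at G H z"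
    and isolated: "\<And>z. z \<in> E \<Longrightarrow> \<exists>\<delta>>0. \<forall>w. w \<noteq> z \<longrightarrow> \<bar>w - z\<bar> < \<delta> \<longrightarrow> w \<notin> E"
    and ker: "\<And>z f. z \<in> E \<Longrightarrow> (f, z *\<^sub>R f) \<in> G \<Longrightarrow> f = 0"
  shows "H = {0}"
proof -
  have all: "regular_at G H z" for z
  proof (cases "z \<in> E")
    case True
    then obtain \<delta> where \<delta>: "\<delta> > 0" "\<And>w. w \<noteq> z \<Longrightarrow> \<bar>w - z\<bar> < \<delta> \<Longrightarrow> w \<notin> E" using isolated by blast
    show ?thesis by (rule isolated_regular[OF G H cl \<delta>(1) reg[OF \<delta>(2)] ker[OF True]])
  qed (rule reg)
  have zero: "f = 0" if fk: "(f, k) \<in> G" for f k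
  proof (rule ccontr)
    assume "f \<noteq> 0"
    define \<rho> where "\<rho> = (norm k + 1) / norm f"
    have "\<rho> > 0" using \<open>f \<noteq> 0\<close> by (simp add: \<rho>_def add_nonneg_pos)
    then have "\<rho> * norm f \<le> norm (k - 0 *\<^sub>R f)"
      by (rule regular_at_dist[OF G H _ all fk])
    moreover have "\<rho> * norm f = norm k + 1" using \<open>f \<noteq> 0\<close> by (simp add: \<rho>_def)
    ultimately show False by simp
  qed
  have "g = 0" if "g \<in> H" for g
  proof -
    have "\<exists>f. (f, g) \<in> G" using all[of 0] that by (simp add: regular_at_def)
    then obtain f where f: "(f, g) \<in> G" ..
    with zero[OF f] have "(0, g) \<in> G" by simp
    then show ?thesis by (rule single)
  qed
  then show ?thesis using subspace_0[OF H] by (intro equalityI subsetI) (simp_all only: singleton_iff)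
qed

subsection \<open>The Hilbert space of square integrable functions\<close>

lemma borel_measurable_cnj [measurable]:
  "f \<in> borel_measurable M \<Longrightarrow> (\<lambda>x. cnj (f x)) \<in> borel_measurable M"
  by (rule borel_measurable_continuous_on[OF continuous_on_cnj[OF continuous_on_id]])

lemma L2_measurable [measurable_dest]: "f \<in> L2 M \<Longrightarrow> f \<in> borel_measurable M"
  by (simp add: L2_def)

lemma L2_integrable: "f \<in> L2 M \<Longrightarrow> integrable M (\<lambda>x. (cmod (f x))\<^sup>2)"
  by (simp add: L2_def)

lemma L2I_nn_integral:
  assumes "f \<in> borel_measurable M" and "(\<integral>\<^sup>+x. ennreal ((cmod (f x))\<^sup>2) \<partial>M) < \<infinity>"
  shows "f \<in> L2 M"
  using assms by (auto simp: L2_def intro!: integrableI_bounded)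

lemma nn_integral_L2:
  assumes "f \<in> L2 M"
  shows "(\<integral>\<^sup>+x. ennreal ((cmod (f x))\<^sup>2) \<partial>M) = ennreal ((L2_norm M f)\<^sup>2)"
  using assms by (subst nn_integral_eq_integral) (auto simp: L2_def L2_norm_def)

lemma L2_dominated:
  assumes "f \<in> borel_measurable M" "g \<in> L2 M" and "\<And>x. x \<in> space M \<Longrightarrow> cmod (f x) \<le> C * cmod (g x)"
  shows "f \<in> L2 M"
proof -
  have "integrable M (\<lambda>x. C\<^sup>2 * (cmod (g x))\<^sup>2)" using L2_integrable[OF assms(2)] by simp
  then have "integrable M (\<lambda>x. (cmod (f x))\<^sup>2)"
  proof (rule Bochner_Integration.integrable_bound)
    show "AE x in M. norm ((cmod (f x))\<^sup>2) \<le> norm (C\<^sup>2 * (cmod (g x))\<^sup>2)"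
      using assms(3) by (auto simp: power_mult_distrib[symmetric] intro!: power_mono)
  qed (use assms(1) in measurable)
  then show ?thesis using assms(1) by (simp add: L2_def)
qed

lemma L2_scale [intro, simp]: "f \<in> L2 M \<Longrightarrow> (\<lambda>x. c * f x) \<in> L2 M"
  by (rule L2_dominated[of _ _ f "cmod c"]) (auto simp: norm_mult)

lemma L2_uminus [intro, simp]: "f \<in> L2 M \<Longrightarrow> (\<lambda>x. - f x) \<in> L2 M"
  using L2_scale[of f M "-1"] by simp

lemma L2_zero [intro, simp]: "(\<lambda>x. 0) \<in> L2 M"
  by (simp add: L2_def)

lemma L2_add [intro, simp]:
  assumes "f \<in> L2 M" "g \<in> L2 M" shows "(\<lambda>x. f x + g x) \<in> L2 M"
proof -
  have [measurable]: "f \<in> borel_measurable M" "g \<in> borel_measurable M" using assms by auto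
  have "integrable M (\<lambda>x. 2 * (cmod (f x))\<^sup>2 + 2 * (cmod (g x))\<^sup>2)"
    using assms by (simp add: L2_integrable)
  then have "integrable M (\<lambda>x. (cmod (f x + g x))\<^sup>2)"
  proof (rule Bochner_Integration.integrable_bound)
    show "AE x in M. norm ((cmod (f x + g x))\<^sup>2) \<le> norm (2 * (cmod (f x))\<^sup>2 + 2 * (cmod (g x))\<^sup>2)"
    proof (intro AE_I2)
      fix x
      have "(cmod (f x + g x))\<^sup>2 \<le> (cmod (f x) + cmod (g x))\<^sup>2"
        by (intro power_mono norm_triangle_ineq) auto
      also have "\<dots> \<le> 2 * (cmod (f x))\<^sup>2 + 2 * (cmod (g x))\<^sup>2"
        using sum_squares_bound[of "cmod (f x)" "cmod (g x)"] by (simp add: power2_sum)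
      finally show "norm ((cmod (f x + g x))\<^sup>2) \<le> norm (2 * (cmod (f x))\<^sup>2 + 2 * (cmod (g x))\<^sup>2)" by simp
    qed
  qed simp
  then show ?thesis by (simp add: L2_def)
qed

lemma L2_diff [intro, simp]: "f \<in> L2 M \<Longrightarrow> g \<in> L2 M \<Longrightarrow> (\<lambda>x. f x - g x) \<in> L2 M"
  using L2_add[of f M "\<lambda>x. -1 * g x"] L2_scale[of g M "-1"] by simp

lemma L2_sum [intro, simp]: "(\<And>i. i \<in> A \<Longrightarrow> f i \<in> L2 M) \<Longrightarrow> (\<lambda>x. \<Sum>i\<in>A. f i x) \<in> L2 M"
  by (induction A rule: infinite_finite_induct) auto

lemma L2_cong_AE:
  assumes "f \<in> L2 M" "g \<in> borel_measurable M" "AE x in M. f x = g x"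
  shows "g \<in> L2 M"
proof -
  have "integrable M (\<lambda>x. (cmod (f x))\<^sup>2) \<longleftrightarrow> integrable M (\<lambda>x. (cmod (g x))\<^sup>2)"
    using assms by (intro integrable_cong_AE) auto
  then show ?thesis using assms by (simp add: L2_def)
qed

lemma L2_inner_integrable:
  assumes "f \<in> L2 M" "g \<in> L2 M" shows "integrable M (\<lambda>x. cnj (f x) * g x)"
proof -
  have [measurable]: "f \<in> borel_measurable M" "g \<in> borel_measurable M" using assms by auto
  have "integrable M (\<lambda>x. (cmod (f x))\<^sup>2 + (cmod (g x))\<^sup>2)" using assms by (simp add: L2_integrable)
  then show ?thesis
  proof (rule Bochner_Integration.integrable_bound)
    show "AE x in M. norm (cnj (f x) * g x) \<le> norm ((cmod (f x))\<^sup>2 + (cmod (g x))\<^sup>2)"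
    proof (intro AE_I2)
      fix x
      have "0 \<le> cmod (f x) * cmod (g x)" by simp
      then have "cmod (f x) * cmod (g x) \<le> (cmod (f x))\<^sup>2 + (cmod (g x))\<^sup>2"
        using sum_squares_bound[of "cmod (f x)" "cmod (g x)"] by linarith
      then show "norm (cnj (f x) * g x) \<le> norm ((cmod (f x))\<^sup>2 + (cmod (g x))\<^sup>2)"
        by (simp add: norm_mult)
    qed
  qed measurable
qed

lemma L2_inner_cnj: "cnj (L2_inner M f g) = L2_inner M g f"
proof -
  have "cnj (L2_inner M f g) = (\<integral>x. cnj (cnj (f x) * g x) \<partial>M)"
    unfolding L2_inner_def by (rule Bochner_Integration.integral_cnj[symmetric])
  then show ?thesis by (simp add: L2_inner_def mult.commute)
qed

lemma Re_L2_inner_commute: "Re (L2_inner M f g) = Re (L2_inner M g f)"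
  by (subst L2_inner_cnj[symmetric]) (rule cnj.sel)

lemma L2_inner_scale_right: "L2_inner M f (\<lambda>x. c * g x) = c * L2_inner M f g"
  unfolding L2_inner_def by (simp add: mult.left_commute)

lemma L2_inner_scale_left: "L2_inner M (\<lambda>x. c * f x) g = cnj c * L2_inner M f g"
  unfolding L2_inner_def by (simp add: mult.assoc)

lemma L2_inner_add_right:
  "f \<in> L2 M \<Longrightarrow> g \<in> L2 M \<Longrightarrow> h \<in> L2 M \<Longrightarrow>
    L2_inner M f (\<lambda>x. g x + h x) = L2_inner M f g + L2_inner M f h"
  unfolding L2_inner_def by (simp add: distrib_left L2_inner_integrable)

lemma L2_inner_diff_right:
  "f \<in> L2 M \<Longrightarrow> g \<in> L2 M \<Longrightarrow> h \<in> L2 M \<Longrightarrow>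
    L2_inner M f (\<lambda>x. g x - h x) = L2_inner M f g - L2_inner M f h"
  unfolding L2_inner_def by (simp add: right_diff_distrib L2_inner_integrable)

lemma L2_inner_add_left:
  "f \<in> L2 M \<Longrightarrow> g \<in> L2 M \<Longrightarrow> h \<in> L2 M \<Longrightarrow>
    L2_inner M (\<lambda>x. g x + h x) f = L2_inner M g f + L2_inner M h f"
  unfolding L2_inner_def by (simp add: distrib_right L2_inner_integrable)

lemma L2_inner_zero [simp]: "L2_inner M f (\<lambda>x. 0) = 0" "L2_inner M (\<lambda>x. 0) f = 0"
  by (simp_all add: L2_inner_def)

lemma L2_inner_sum_right:
  "f \<in> L2 M \<Longrightarrow> (\<And>i. i \<in> A \<Longrightarrow> g i \<in> L2 M) \<Longrightarrow>
    L2_inner M f (\<lambda>x. \<Sum>i\<in>A. g i x) = (\<Sum>i\<in>A. L2_inner M f (g i))"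
  by (induction A rule: infinite_finite_induct) (simp_all add: L2_inner_add_right)

lemma L2_inner_cong_AE:
  assumes "f \<in> borel_measurable M" "f' \<in> borel_measurable M" "g \<in> borel_measurable M" "g' \<in> borel_measurable M"
    "AE x in M. f x = f' x" "AE x in M. g x = g' x"
  shows "L2_inner M f g = L2_inner M f' g'"
  unfolding L2_inner_def using assms by (intro integral_cong_AE) auto

lemma L2_norm_nonneg [simp]: "0 \<le> L2_norm M f"
  by (simp add: L2_norm_def)

lemma L2_norm_power2: "(L2_norm M f)\<^sup>2 = (\<integral>x. (cmod (f x))\<^sup>2 \<partial>M)"
  by (simp add: L2_norm_def)

lemma L2_inner_self: "L2_inner M f f = complex_of_real ((L2_norm M f)\<^sup>2)"
proof -
  have "cnj (f x) * f x = complex_of_real ((cmod (f x))\<^sup>2)" for x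
    by (simp only: complex_norm_square mult.commute)
  then show ?thesis by (simp add: L2_inner_def L2_norm_power2 del: of_real_power)
qed

lemma L2_norm_eq_0_iff:
  assumes "f \<in> L2 M" shows "L2_norm M f = 0 \<longleftrightarrow> (AE x in M. f x = 0)"
proof -
  have "L2_norm M f = 0 \<longleftrightarrow> (\<integral>x. (cmod (f x))\<^sup>2 \<partial>M) = 0" by (simp add: L2_norm_def)
  also have "\<dots> \<longleftrightarrow> (AE x in M. (cmod (f x))\<^sup>2 = 0)"
    using assms by (intro integral_nonneg_eq_0_iff_AE) (auto simp: L2_def)
  finally show ?thesis by simp
qed

lemma L2_norm_diff_commute: "L2_norm M (\<lambda>x. f x - g x) = L2_norm M (\<lambda>x. g x - f x)"
  by (simp add: L2_norm_def norm_minus_commute)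

lemma L2_norm_diff_expand:
  assumes "f \<in> L2 M" "g \<in> L2 M"
  shows "(L2_norm M (\<lambda>x. f x - g x))\<^sup>2 = (L2_norm M f)\<^sup>2 - 2 * Re (L2_inner M g f) + (L2_norm M g)\<^sup>2"
proof -
  define h where "h x = Re (cnj (g x) * f x)" for x
  have int: "integrable M h"
    unfolding h_def using L2_inner_integrable[OF assms(2,1)] by (rule integrable_Re)
  have "(cmod (f x - g x))\<^sup>2 = (cmod (f x))\<^sup>2 - 2 * h x + (cmod (g x))\<^sup>2" for x
    unfolding cmod_power2 h_def by (simp add: power2_eq_square algebra_simps)
  then have "(L2_norm M (\<lambda>x. f x - g x))\<^sup>2
      = (\<integral>x. (cmod (f x))\<^sup>2 - 2 * h x + (cmod (g x))\<^sup>2 \<partial>M)"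
    by (simp only: L2_norm_power2)
  also have "\<dots> = (L2_norm M f)\<^sup>2 - 2 * (\<integral>x. h x \<partial>M) + (L2_norm M g)\<^sup>2"
    using int assms by (simp add: L2_norm_power2 L2_integrable)
  also have "(\<integral>x. h x \<partial>M) = Re (L2_inner M g f)"
    unfolding L2_inner_def h_def by (rule integral_Re[OF L2_inner_integrable[OF assms(2,1)]])
  finally show ?thesis .
qed

lemma L2_Cauchy_Schwarz:
  assumes "f \<in> L2 M" "g \<in> L2 M"
  shows "cmod (L2_inner M f g) \<le> L2_norm M f * L2_norm M g"
proof -
  have [measurable]: "f \<in> borel_measurable M" "g \<in> borel_measurable M" using assms by auto
  have "ennreal (cmod (L2_inner M f g)) \<le> (\<integral>\<^sup>+x. ennreal (cmod (cnj (f x) * g x)) \<partial>M)"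
    unfolding L2_inner_def by (rule integral_norm_bound_ennreal[OF L2_inner_integrable[OF assms]])
  also have "\<dots> = (\<integral>\<^sup>+x. ennreal (cmod (f x)) * ennreal (cmod (g x)) \<partial>M)"
    by (simp add: norm_mult ennreal_mult)
  finally have "(ennreal (cmod (L2_inner M f g)))\<^sup>2 \<le> (\<integral>\<^sup>+x. ennreal (cmod (f x)) * ennreal (cmod (g x)) \<partial>M)\<^sup>2"
    by (intro power_mono) auto
  also have "\<dots> \<le> (\<integral>\<^sup>+x. (ennreal (cmod (f x)))\<^sup>2 \<partial>M) * (\<integral>\<^sup>+x. (ennreal (cmod (g x)))\<^sup>2 \<partial>M)"
    by (rule Cauchy_Schwarz_nn_integral) auto
  also have "\<dots> = ennreal ((L2_norm M f * L2_norm M g)\<^sup>2)"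
    using assms by (simp add: ennreal_power nn_integral_L2 ennreal_mult power_mult_distrib)
  finally have "(cmod (L2_inner M f g))\<^sup>2 \<le> (L2_norm M f * L2_norm M g)\<^sup>2"
    by (simp add: ennreal_power)
  then show ?thesis by (rule power2_le_imp_le) simp
qed

text \<open>A subsequence with increments below 4^-k in norm makes the sum of 4^k |increment|^2
  integrable, hence finite almost everywhere; pointwise the increments are then O(2^-k) and sum
  absolutely. Fatou's lemma turns the pointwise limit into a limit in norm for the whole
  sequence.\<close>

theorem Riesz_Fischer:
  assumes f: "\<And>n. f n \<in> L2 M"
    and cauchy: "\<And>e. e > 0 \<Longrightarrow> \<exists>N. \<forall>m\<ge>N. \<forall>n\<ge>N. L2_norm M (\<lambda>x. f m x - f n x) < e"
  obtains g where "g \<in> L2 M" "(\<lambda>n. L2_norm M (\<lambda>x. f n x - g x)) \<longlonglongrightarrow> 0"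
proof -
  have [measurable]: "f n \<in> borel_measurable M" for n using f by auto
  have "\<forall>k. \<exists>N. \<forall>m\<ge>N. \<forall>n\<ge>N. L2_norm M (\<lambda>x. f m x - f n x) < (1/4)^k"
    using cauchy by simp
  then obtain N where N: "\<And>k m n. m \<ge> N k \<Longrightarrow> n \<ge> N k \<Longrightarrow> L2_norm M (\<lambda>x. f m x - f n x) < (1/4)^k"
    by metis
  \<comment> \<open>The partial sums of \<open>N\<close> make r nondecreasing with r k \<ge> N k;
    the summand k gives r k \<ge> k, so that the subsequence passes every index.\<close>
  define r where "r k = (\<Sum>i\<le>k. N i) + k" for k
  have rN: "N k \<le> r k" for k
    unfolding r_def using member_le_sum[of k "{..k}" N] by auto
  have r_step: "r k \<le> r (Suc k)" for k by (simp add: r_def)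
  have rk: "k \<le> r k" for k by (simp add: r_def)
  define d where "d k x = (cmod (f (r (Suc k)) x - f (r k) x))\<^sup>2" for k x
  have [measurable]: "d k \<in> borel_measurable M" for k unfolding d_def by measurable
  have int_d: "(\<integral>\<^sup>+x. ennreal (4^k * d k x) \<partial>M) \<le> ennreal ((1/4)^k)" for k
  proof -
    have "(\<integral>\<^sup>+x. ennreal (4^k * d k x) \<partial>M) = ennreal (4^k) * (\<integral>\<^sup>+x. ennreal (d k x) \<partial>M)"
      by (subst nn_integral_cmult[symmetric]) (auto simp: ennreal_mult d_def)
    also have "(\<integral>\<^sup>+x. ennreal (d k x) \<partial>M) = ennreal ((L2_norm M (\<lambda>x. f (r (Suc k)) x - f (r k) x))\<^sup>2)"
      unfolding d_def by (rule nn_integral_L2) (intro L2_diff f)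
    also have "ennreal (4^k) * \<dots> \<le> ennreal (4^k) * ennreal (((1/4)^k)\<^sup>2)"
      using N[of k "r (Suc k)" "r k"] rN[of k] r_step[of k]
      by (intro mult_left_mono ennreal_leI power_mono) (auto intro: less_imp_le)
    also have "\<dots> = ennreal ((1/4)^k)"
      by (simp add: ennreal_mult[symmetric] power2_eq_square power_mult_distrib[symmetric])
    finally show ?thesis .
  qed
  have "(\<integral>\<^sup>+x. (\<Sum>k. ennreal (4^k * d k x)) \<partial>M) = (\<Sum>k. \<integral>\<^sup>+x. ennreal (4^k * d k x) \<partial>M)"
    by (rule nn_integral_suminf) measurable
  also have "\<dots> \<le> (\<Sum>k. ennreal ((1/4)^k))"
    by (intro suminf_le int_d) auto
  also have "\<dots> = ennreal (\<Sum>k. (1/4)^k)"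
    by (rule suminf_ennreal2) (auto intro: summable_geometric)
  finally have "(\<integral>\<^sup>+x. (\<Sum>k. ennreal (4^k * d k x)) \<partial>M) \<noteq> \<infinity>"
    by (auto simp: top_unique)
  then have "AE x in M. (\<Sum>k. ennreal (4^k * d k x)) \<noteq> \<infinity>"
    by (intro nn_integral_noteq_infinite) auto
  then have conv: "AE x in M. convergent (\<lambda>k. f (r k) x)"
  proof eventually_elim
    fix x assume fin: "(\<Sum>k. ennreal (4^k * d k x)) \<noteq> \<infinity>"
    define K where "K = enn2real (\<Sum>k. ennreal (4^k * d k x))"
    have K: "ennreal K = (\<Sum>k. ennreal (4^k * d k x))"
      unfolding K_def using fin by (simp add: less_top)
    have bound: "norm (f (r (Suc k)) x - f (r k) x) \<le> sqrt K * (1/2)^k" for k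
    proof -
      have "ennreal (4^k * d k x) \<le> ennreal K"
        unfolding K using sum_le_suminf[of "\<lambda>k. ennreal (4^k * d k x)" "{k}"] by simp
      then have "4^k * d k x \<le> K"
        by (simp add: K_def d_def)
      then have "sqrt (4^k * d k x) \<le> sqrt K" by simp
      moreover have "sqrt (4^k * d k x) = 2^k * norm (f (r (Suc k)) x - f (r k) x)"
        by (simp add: d_def real_sqrt_mult real_sqrt_power)
      ultimately have "2^k * norm (f (r (Suc k)) x - f (r k) x) \<le> sqrt K" by linarith
      then have "(1/2)^k * (2^k * norm (f (r (Suc k)) x - f (r k) x)) \<le> (1/2)^k * sqrt K"
        by (rule mult_left_mono) simp
      then show ?thesis by (simp add: power_divide mult.commute)
    qed
    have "summable (\<lambda>k. sqrt K * (1/2)^k)" by (intro summable_mult summable_geometric) simp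
    then have "summable (\<lambda>k. f (r (Suc k)) x - f (r k) x)"
      by (rule summable_comparison_test'[where N = 0]) (rule bound)
    then have "convergent (\<lambda>k. f (r k) x - f (r 0) x)"
      unfolding summable_iff_convergent sum_lessThan_telescope[of "\<lambda>k. f (r k) x"] .
    then show "convergent (\<lambda>k. f (r k) x)" by (simp only: convergent_diff_const_right_iff)
  qed
  define g where "g x = lim (\<lambda>k. f (r k) x)" for x
  have [measurable]: "g \<in> borel_measurable M" unfolding g_def by measurable
  have fatou: "(\<integral>\<^sup>+x. ennreal ((cmod (f n x - g x))\<^sup>2) \<partial>M) \<le> ennreal (((1/4)^k)\<^sup>2)" if n: "n \<ge> N k" for n k
  proof -
    have "(\<integral>\<^sup>+x. ennreal ((cmod (f n x - g x))\<^sup>2) \<partial>M)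
        = (\<integral>\<^sup>+x. liminf (\<lambda>j. ennreal ((cmod (f n x - f (r j) x))\<^sup>2)) \<partial>M)"
    proof (rule nn_integral_cong_AE)
      from conv show "AE x in M. ennreal ((cmod (f n x - g x))\<^sup>2)
          = liminf (\<lambda>j. ennreal ((cmod (f n x - f (r j) x))\<^sup>2))"
      proof eventually_elim
        fix x assume "convergent (\<lambda>k. f (r k) x)"
        then have "(\<lambda>k. f (r k) x) \<longlonglongrightarrow> g x" unfolding g_def by (simp add: convergent_LIMSEQ_iff)
        then have "(\<lambda>j. ennreal ((cmod (f n x - f (r j) x))\<^sup>2)) \<longlonglongrightarrow> ennreal ((cmod (f n x - g x))\<^sup>2)"
          by (intro tendsto_intros)
        then show "ennreal ((cmod (f n x - g x))\<^sup>2) = liminf (\<lambda>j. ennreal ((cmod (f n x - f (r j) x))\<^sup>2))"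
          by (rule lim_imp_Liminf[OF sequentially_bot, symmetric])
      qed
    qed
    also have "\<dots> \<le> liminf (\<lambda>j. \<integral>\<^sup>+x. ennreal ((cmod (f n x - f (r j) x))\<^sup>2) \<partial>M)"
      by (rule nn_integral_liminf) measurable
    also have "\<dots> \<le> ennreal (((1/4)^k)\<^sup>2)"
    proof (rule Liminf_le)
      show "\<forall>\<^sub>F j in sequentially. (\<integral>\<^sup>+x. ennreal ((cmod (f n x - f (r j) x))\<^sup>2) \<partial>M) \<le> ennreal (((1/4)^k)\<^sup>2)"
        using eventually_ge_at_top[of "N k"]
      proof eventually_elim
        fix j assume "N k \<le> j"
        then have "N k \<le> r j" using rk[of j] by simp
        then have "L2_norm M (\<lambda>x. f n x - f (r j) x) < (1/4)^k" using n by (intro N)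
        then show "(\<integral>\<^sup>+x. ennreal ((cmod (f n x - f (r j) x))\<^sup>2) \<partial>M) \<le> ennreal (((1/4)^k)\<^sup>2)"
          by (subst nn_integral_L2) (auto intro!: L2_diff f ennreal_leI power_mono less_imp_le)
      qed
    qed simp
    finally show ?thesis .
  qed
  have diff: "(\<lambda>x. f n x - g x) \<in> L2 M" if "n \<ge> N 0" for n
    by (rule L2I_nn_integral, measurable) (rule le_less_trans[OF fatou[OF that]], simp)
  have "(\<lambda>x. f (N 0) x - (f (N 0) x - g x)) \<in> L2 M" by (intro L2_diff f diff) simp
  then have g: "g \<in> L2 M" by simp
  have le: "L2_norm M (\<lambda>x. f n x - g x) \<le> (1/4)^k" if "n \<ge> N k" for n k
  proof -
    have "(L2_norm M (\<lambda>x. f n x - g x))\<^sup>2 \<le> ((1/4)^k)\<^sup>2"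
      using fatou[OF that] nn_integral_L2[OF L2_diff[OF f g], of n] by simp
    then show ?thesis by (rule power2_le_imp_le) simp
  qed
  have "(\<lambda>n. L2_norm M (\<lambda>x. f n x - g x)) \<longlonglongrightarrow> 0"
  proof (rule LIMSEQ_I)
    fix e :: real assume "e > 0"
    then obtain k where "(1/4::real)^k < e" using real_arch_pow_inv[of e "1/4"] by auto
    then have "norm (L2_norm M (\<lambda>x. f n x - g x) - 0) < e" if "n \<ge> N k" for n
      using le[OF that] by simp
    then show "\<exists>no. \<forall>n\<ge>no. norm (L2_norm M (\<lambda>x. f n x - g x) - 0) < e" by blast
  qed
  with g show thesis by (rule that)
qed

text \<open>Orthogonal series have increments of exactly this form, with \<open>S\<close> the sum of
  the squared norms of the terms. It serves both the expansions on the sphere and the series that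
  builds the square root on the whole space.\<close>

lemma L2_convergent_of_bounded_increments:
  assumes f: "\<And>n. f n \<in> L2 M" and S: "incseq S" "\<And>n. S n \<le> (K :: real)"
    and diff: "\<And>k n. k \<le> n \<Longrightarrow> (L2_norm M (\<lambda>x. f n x - f k x))\<^sup>2 = S n - S k"
  obtains g where "g \<in> L2 M" "(\<lambda>n. L2_norm M (\<lambda>x. f n x - g x)) \<longlonglongrightarrow> 0"
proof -
  have eq: "(L2_norm M (\<lambda>x. f m x - f n x))\<^sup>2 = \<bar>S m - S n\<bar>" for m n
  proof (cases "n \<le> m")
    case True
    then show ?thesis using diff[OF True] incseqD[OF S(1) True] by simp
  next
    case False
    then have "m \<le> n" by simp
    then show ?thesis
      using diff[OF \<open>m \<le> n\<close>] incseqD[OF S(1) \<open>m \<le> n\<close>] L2_norm_diff_commute[of M "f m"] by simp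
  qed
  obtain L where "S \<longlonglongrightarrow> L" using incseq_convergent[OF S(1), of K] S(2) by blast
  then have "Cauchy S" by (rule LIMSEQ_imp_Cauchy)
  have "\<exists>N. \<forall>m\<ge>N. \<forall>n\<ge>N. L2_norm M (\<lambda>x. f m x - f n x) < e" if e: "e > 0" for e
  proof -
    have "e\<^sup>2 > 0" using e by simp
    from CauchyD[OF \<open>Cauchy S\<close> this]
    obtain N where N: "\<And>m n. m \<ge> N \<Longrightarrow> n \<ge> N \<Longrightarrow> \<bar>S m - S n\<bar> < e\<^sup>2" by auto
    have "L2_norm M (\<lambda>x. f m x - f n x) < e" if "m \<ge> N" "n \<ge> N" for m n
      by (rule power2_less_imp_less) (use e N[OF that] in \<open>auto simp: eq\<close>)
    then show ?thesis by blast
  qed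
  note cauchy = this
  show thesis by (rule Riesz_Fischer[OF f cauchy]) (assumption | rule that)+
qed

section \<open>The square integrable functions on the sphere modulo null sets, as a Hilbert
  space\<close>

definition sphere_L2_eq :: "('a::euclidean_space \<Rightarrow> complex) \<Rightarrow> ('a \<Rightarrow> complex) \<Rightarrow> bool" where
  "sphere_L2_eq f g \<longleftrightarrow> f \<in> L2 sphere_measure \<and> g \<in> L2 sphere_measure \<and> (AE x in sphere_measure. f x = g x)"

lemma sphere_L2_eq_self [simp]: "sphere_L2_eq f f \<longleftrightarrow> f \<in> L2 sphere_measure"
  by (simp add: sphere_L2_eq_def)

\<comment> \<open>The resolvent argument is stated for a complete inner product space, so functions
  have to be identified almost everywhere. The quotient carries the real structure only, with the
  real part of \<open>L2_inner\<close> as inner product; complex statements are recovered by testing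
  with i f besides f.\<close>
quotient_type (overloaded) 'a sphere_L2 = "'a::euclidean_space \<Rightarrow> complex" / partial: sphere_L2_eq
proof (rule part_equivpI)
  show "\<exists>x. sphere_L2_eq x x" by (rule exI[of _ "\<lambda>x. 0"]) simp
  show "symp sphere_L2_eq" by (auto simp: symp_def sphere_L2_eq_def)
  show "transp sphere_L2_eq" unfolding transp_def sphere_L2_eq_def by (auto elim: eventually_elim2)
qed

instantiation sphere_L2 :: (euclidean_space) real_inner
begin

lift_definition zero_sphere_L2 :: "'a sphere_L2" is "\<lambda>x. 0" by simp

lift_definition plus_sphere_L2 :: "'a sphere_L2 \<Rightarrow> 'a sphere_L2 \<Rightarrow> 'a sphere_L2"
  is "\<lambda>f g x. f x + g x" unfolding sphere_L2_eq_def by (auto elim: eventually_elim2)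

lift_definition minus_sphere_L2 :: "'a sphere_L2 \<Rightarrow> 'a sphere_L2 \<Rightarrow> 'a sphere_L2"
  is "\<lambda>f g x. f x - g x" unfolding sphere_L2_eq_def by (auto elim: eventually_elim2)

lift_definition uminus_sphere_L2 :: "'a sphere_L2 \<Rightarrow> 'a sphere_L2"
  is "\<lambda>f x. - f x" unfolding sphere_L2_eq_def by (auto elim: eventually_mono)

lift_definition scaleR_sphere_L2 :: "real \<Rightarrow> 'a sphere_L2 \<Rightarrow> 'a sphere_L2"
  is "\<lambda>r f x. complex_of_real r * f x" unfolding sphere_L2_eq_def by (auto elim: eventually_mono)

lift_definition inner_sphere_L2 :: "'a sphere_L2 \<Rightarrow> 'a sphere_L2 \<Rightarrow> real"
  is "\<lambda>f g. Re (L2_inner sphere_measure f g)"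
  unfolding sphere_L2_eq_def by (auto intro!: arg_cong[where f = Re] L2_inner_cong_AE)

lift_definition norm_sphere_L2 :: "'a sphere_L2 \<Rightarrow> real"
  is "L2_norm sphere_measure"
  unfolding sphere_L2_eq_def L2_norm_def
  by (intro arg_cong[where f = sqrt] integral_cong_AE) (auto elim: eventually_mono)

definition dist_sphere_L2 :: "'a sphere_L2 \<Rightarrow> 'a sphere_L2 \<Rightarrow> real" where
  "dist_sphere_L2 x y = norm (x - y)"

definition sgn_sphere_L2 :: "'a sphere_L2 \<Rightarrow> 'a sphere_L2" where
  "sgn_sphere_L2 x = scaleR (inverse (norm x)) x"

definition uniformity_sphere_L2 :: "('a sphere_L2 \<times> 'a sphere_L2) filter" where
  "uniformity_sphere_L2 = (INF e\<in>{0 <..}. principal {(x, y). dist x y < e})"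

definition open_sphere_L2 :: "'a sphere_L2 set \<Rightarrow> bool" where
  "open_sphere_L2 U \<longleftrightarrow> (\<forall>x\<in>U. eventually (\<lambda>(x', y). x' = x \<longrightarrow> y \<in> U) uniformity)"

instance
proof
  fix x y z :: "'a sphere_L2" and a b :: real
  show "x + y + z = x + (y + z)" by transfer (simp add: sphere_L2_eq_def add.assoc)
  show "x + y = y + x" by transfer (simp add: sphere_L2_eq_def add.commute)
  show "0 + x = x" by transfer (simp add: sphere_L2_eq_def)
  show "- x + x = 0" by transfer (simp add: sphere_L2_eq_def)
  show "x - y = x + - y" by transfer (auto simp: sphere_L2_eq_def)
  show "a *\<^sub>R (x + y) = a *\<^sub>R x + a *\<^sub>R y" by transfer (simp add: sphere_L2_eq_def distrib_left)
  show "(a + b) *\<^sub>R x = a *\<^sub>R x + b *\<^sub>R x" by transfer (simp add: sphere_L2_eq_def distrib_right)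
  show "a *\<^sub>R b *\<^sub>R x = (a * b) *\<^sub>R x" by transfer (simp add: sphere_L2_eq_def mult.assoc)
  show "1 *\<^sub>R x = x" by transfer (simp add: sphere_L2_eq_def)
  show "dist x y = norm (x - y)" by (simp add: dist_sphere_L2_def)
  show "sgn x = scaleR (inverse (norm x)) x" by (simp add: sgn_sphere_L2_def)
  show "uniformity = (INF e\<in>{0 <..}. principal {(x, y :: 'a sphere_L2). dist x y < e})"
    by (simp add: uniformity_sphere_L2_def)
  show "open U \<longleftrightarrow> (\<forall>x\<in>U. eventually (\<lambda>(x', y). x' = x \<longrightarrow> y \<in> U) uniformity)" for U :: "'a sphere_L2 set"
    by (simp add: open_sphere_L2_def)
  show "inner x y = inner y x"
    by transfer (rule Re_L2_inner_commute)
  show "inner (x + y) z = inner x z + inner y z" by transfer (simp add: L2_inner_add_left)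
  show "inner (a *\<^sub>R x) y = a * inner x y" by transfer (simp add: L2_inner_scale_left)
  show "0 \<le> inner x x" by transfer (simp add: L2_inner_self)
  show "inner x x = 0 \<longleftrightarrow> x = 0"
    by transfer (simp add: L2_inner_self L2_norm_eq_0_iff sphere_L2_eq_def)
  show "norm x = sqrt (inner x x)" by transfer (simp add: L2_inner_self)
qed

end

lemma rep_sphere_L2: "rep_sphere_L2 x \<in> L2 sphere_measure"
  using Quotient3_rep_reflp[OF Quotient3_sphere_L2, of x] by simp

lemma abs_rep_sphere_L2: "abs_sphere_L2 (rep_sphere_L2 x) = x"
  by (rule Quotient3_abs_rep[OF Quotient3_sphere_L2])

lemma abs_sphere_L2_eq_iff:
  "f \<in> L2 sphere_measure \<Longrightarrow> g \<in> L2 sphere_measure \<Longrightarrow>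
    abs_sphere_L2 f = abs_sphere_L2 g \<longleftrightarrow> (AE x in sphere_measure. f x = g x)"
  using Quotient3_rel[OF Quotient3_sphere_L2, of f g] by (auto simp: sphere_L2_eq_def)

lemma norm_diff_abs_sphere_L2:
  "f \<in> L2 sphere_measure \<Longrightarrow> g \<in> L2 sphere_measure \<Longrightarrow>
    norm (abs_sphere_L2 f - abs_sphere_L2 g) = L2_norm sphere_measure (\<lambda>x. f x - g x)"
  by (simp add: minus_sphere_L2.abs_eq norm_sphere_L2.abs_eq)

instance sphere_L2 :: (euclidean_space) complete_space
proof
  fix X :: "nat \<Rightarrow> 'a sphere_L2" assume X: "Cauchy X"
  define f where "f n = rep_sphere_L2 (X n)" for n
  have f: "f n \<in> L2 sphere_measure" and abs_f: "abs_sphere_L2 (f n) = X n" for n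
    by (simp_all add: f_def rep_sphere_L2 abs_rep_sphere_L2)
  have "L2_norm sphere_measure (\<lambda>x. f m x - f n x) = norm (X m - X n)" for m n
    using norm_diff_abs_sphere_L2[OF f f, of m n] by (simp only: abs_f)
  then have cauchy: "\<exists>N. \<forall>m\<ge>N. \<forall>n\<ge>N. L2_norm sphere_measure (\<lambda>x. f m x - f n x) < e" if "e > 0" for e
    using CauchyD[OF X that] by (simp only:)
  obtain g where g: "g \<in> L2 sphere_measure"
      "(\<lambda>n. L2_norm sphere_measure (\<lambda>x. f n x - g x)) \<longlonglongrightarrow> 0"
    by (rule Riesz_Fischer[OF f cauchy])
  have "L2_norm sphere_measure (\<lambda>x. f n x - g x) = norm (X n - abs_sphere_L2 g)" for n
    using norm_diff_abs_sphere_L2[OF f g(1), of n] by (simp only: abs_f)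
  with g(2) have "(\<lambda>n. norm (X n - abs_sphere_L2 g)) \<longlonglongrightarrow> 0" by (simp only:)
  then have "X \<longlonglongrightarrow> abs_sphere_L2 g"
    by (simp add: LIM_zero_iff tendsto_norm_zero_iff)
  then show "convergent X" by (rule convergentI)
qed

subsection \<open>Completeness of the eigenfunctions\<close>

lemma self_adjoint_iff:
  assumes "self_adjoint M A"
  shows "(g, h) \<in> A \<longleftrightarrow>
    g \<in> L2 M \<and> h \<in> L2 M \<and> (\<forall>f k. (f, k) \<in> A \<longrightarrow> L2_inner M k g = L2_inner M f h)"
proof -
  have "(g, h) \<in> A \<longleftrightarrow> (g, h) \<in> adjoint_op M A" using assms by (simp add: self_adjoint_def)
  then show ?thesis by (auto simp: adjoint_op_def)
qed

lemma self_adjoint_L2: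
  assumes "self_adjoint M A" "(f, k) \<in> A" shows "f \<in> L2 M" "k \<in> L2 M"
  using assms(2) unfolding self_adjoint_iff[OF assms(1), of f k] by auto

lemma self_adjoint_symmetric:
  assumes "self_adjoint M A" "(f, k) \<in> A" "(g, h) \<in> A"
  shows "L2_inner M k g = L2_inner M f h"
  using assms(2,3) unfolding self_adjoint_iff[OF assms(1), of g h] by auto

lemma self_adjoint_add:
  assumes A: "self_adjoint M A" and "(f, k) \<in> A" "(g, h) \<in> A"
  shows "(\<lambda>x. f x + g x, \<lambda>x. k x + h x) \<in> A"
  unfolding self_adjoint_iff[OF A, of "\<lambda>x. f x + g x"]
proof (intro conjI allI impI)
  note L2 = self_adjoint_L2[OF A assms(2)] self_adjoint_L2[OF A assms(3)]
  show "(\<lambda>x. f x + g x) \<in> L2 M" "(\<lambda>x. k x + h x) \<in> L2 M" using L2 by auto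
  fix f' k' assume fk': "(f', k') \<in> A"
  show "L2_inner M k' (\<lambda>x. f x + g x) = L2_inner M f' (\<lambda>x. k x + h x)"
    using L2 self_adjoint_L2[OF A fk'] self_adjoint_symmetric[OF A fk'] assms(2,3)
    by (simp add: L2_inner_add_right)
qed

lemma self_adjoint_scale:
  assumes A: "self_adjoint M A" and "(f, k) \<in> A"
  shows "(\<lambda>x. c * f x, \<lambda>x. c * k x) \<in> A"
  unfolding self_adjoint_iff[OF A, of "\<lambda>x. c * f x"]
proof (intro conjI allI impI)
  show "(\<lambda>x. c * f x) \<in> L2 M" "(\<lambda>x. c * k x) \<in> L2 M" using self_adjoint_L2[OF assms] by auto
  fix f' k' assume fk': "(f', k') \<in> A"
  show "L2_inner M k' (\<lambda>x. c * f x) = L2_inner M f' (\<lambda>x. c * k x)"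
    using self_adjoint_symmetric[OF A fk' assms(2)] by (simp add: L2_inner_scale_right)
qed

lemma self_adjoint_cong_AE:
  assumes A: "self_adjoint M A" and fk: "(f, k) \<in> A"
    and "f' \<in> borel_measurable M" "k' \<in> borel_measurable M" "AE x in M. f x = f' x" "AE x in M. k x = k' x"
  shows "(f', k') \<in> A"
  unfolding self_adjoint_iff[OF A, of f']
proof (intro conjI allI impI)
  note L2 = self_adjoint_L2[OF A fk]
  show "f' \<in> L2 M" "k' \<in> L2 M" using L2_cong_AE L2 assms by blast+
  fix g h assume gh: "(g, h) \<in> A"
  have "L2_inner M h f' = L2_inner M h f" "L2_inner M g k' = L2_inner M g k"
    using assms L2 self_adjoint_L2[OF A gh]
    by (auto intro!: L2_inner_cong_AE elim: eventually_mono)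
  then show "L2_inner M h f' = L2_inner M g k'" using self_adjoint_symmetric[OF A gh fk] by simp
qed

text \<open>As f vanishes, k is orthogonal to the whole domain, which is dense: approximating k
  itself by an element of the domain gives |k|^2 \<le> |k| e for every e > 0.\<close>

lemma self_adjoint_single_valued:
  assumes A: "self_adjoint M A" and fk: "(f, k) \<in> A" and f0: "AE x in M. f x = 0"
  shows "AE x in M. k x = 0"
proof -
  have k: "k \<in> L2 M" and f: "f \<in> L2 M" using self_adjoint_L2[OF A fk] by auto
  have le: "L2_norm M k \<le> e" if e: "e > 0" for e
  proof -
    obtain g h where gh: "(g, h) \<in> A" and ge: "L2_norm M (\<lambda>x. g x - k x) < e"
      using A k e unfolding self_adjoint_def densely_defined_def by blast
    have g: "g \<in> L2 M" "h \<in> L2 M" using self_adjoint_L2[OF A gh] by auto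
    have "L2_inner M h f = L2_inner M h (\<lambda>x. 0)"
      using f g f0 by (intro L2_inner_cong_AE) auto
    then have "L2_inner M g k = 0" using self_adjoint_symmetric[OF A gh fk] by simp
    then have "L2_inner M k g = 0" using L2_inner_cnj[of M g k] by simp
    then have "L2_inner M k (\<lambda>x. g x - k x) = - complex_of_real ((L2_norm M k)\<^sup>2)"
      using k g by (simp add: L2_inner_diff_right L2_inner_self)
    then have "cmod (L2_inner M k (\<lambda>x. g x - k x)) = (L2_norm M k)\<^sup>2"
      by (simp only: norm_minus_cancel norm_of_real) simp
    then have "(L2_norm M k)\<^sup>2 \<le> L2_norm M k * L2_norm M (\<lambda>x. g x - k x)"
      using L2_Cauchy_Schwarz[OF k L2_diff[OF g(1) k]] by simp
    also have "\<dots> \<le> L2_norm M k * e" using ge by (intro mult_left_mono) auto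
    finally have "L2_norm M k * L2_norm M k \<le> L2_norm M k * e" by (simp add: power2_eq_square)
    then show ?thesis using e by (cases "L2_norm M k = 0") (auto simp: less_le)
  qed
  have "L2_norm M k = 0" using le[of "L2_norm M k / 2"] L2_norm_nonneg[of M k] by (cases "L2_norm M k > 0") linarith+
  then show ?thesis using k by (simp add: L2_norm_eq_0_iff)
qed

locale discrete_operator =
  fixes \<Lambda> :: "('a::euclidean_space \<Rightarrow> complex) rel"
    and I :: "'i set" and ev :: "'i \<Rightarrow> real" and u :: "'i \<Rightarrow> 'a \<Rightarrow> complex"
  assumes self_adjoint: "self_adjoint sphere_measure \<Lambda>"
    and nonneg: "nonneg_op sphere_measure \<Lambda>"
    and discrete_spectrum: "purely_discrete_spectrum sphere_measure \<Lambda> I ev u"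
begin

abbreviation \<sigma> :: "'a measure" where "\<sigma> \<equiv> sphere_measure"

definition coef :: "'i \<Rightarrow> ('a \<Rightarrow> complex) \<Rightarrow> complex" where
  "coef m f = L2_inner \<sigma> (u m) f"

lemma u_graph: "m \<in> I \<Longrightarrow> (u m, \<lambda>x. complex_of_real (ev m) * u m x) \<in> \<Lambda>"
  using discrete_spectrum by (auto simp: purely_discrete_spectrum_def eigenspace_def)

lemma u_L2 [simp]: "m \<in> I \<Longrightarrow> u m \<in> L2 \<sigma>"
  using self_adjoint_L2(1)[OF self_adjoint u_graph] by blast

lemma coef_u: "m \<in> I \<Longrightarrow> n \<in> I \<Longrightarrow> coef m (u n) = (if m = n then 1 else 0)"
  using discrete_spectrum by (auto simp: purely_discrete_spectrum_def coef_def)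

lemma ev_nonneg: assumes "m \<in> I" shows "0 \<le> ev m"
proof -
  have "0 \<le> Re (L2_inner \<sigma> (u m) (\<lambda>x. complex_of_real (ev m) * u m x))"
    using nonneg u_graph[OF assms] by (auto simp: nonneg_op_def)
  then show ?thesis using coef_u[OF assms assms] by (simp add: L2_inner_scale_right coef_def)
qed

lemma coef_graph:
  assumes "(f, k) \<in> \<Lambda>" "m \<in> I" shows "coef m k = complex_of_real (ev m) * coef m f"
  using self_adjoint_symmetric[OF self_adjoint u_graph[OF assms(2)] assms(1)]
  by (simp add: coef_def L2_inner_scale_left)

lemma coef_scale: "coef m (\<lambda>x. c * f x) = c * coef m f"
  by (simp add: coef_def L2_inner_scale_right)

lemma coef_diff: "m \<in> I \<Longrightarrow> f \<in> L2 \<sigma> \<Longrightarrow> g \<in> L2 \<sigma> \<Longrightarrow> coef m (\<lambda>x. f x - g x) = coef m f - coef m g"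
  by (simp add: coef_def L2_inner_diff_right)

lemma coef_add: "m \<in> I \<Longrightarrow> f \<in> L2 \<sigma> \<Longrightarrow> g \<in> L2 \<sigma> \<Longrightarrow> coef m (\<lambda>x. f x + g x) = coef m f + coef m g"
  by (simp add: coef_def L2_inner_add_right)

lemma coef_cong_AE:
  "m \<in> I \<Longrightarrow> f \<in> borel_measurable \<sigma> \<Longrightarrow> g \<in> borel_measurable \<sigma> \<Longrightarrow> AE x in \<sigma>. f x = g x \<Longrightarrow> coef m f = coef m g"
  unfolding coef_def by (intro L2_inner_cong_AE) (auto intro: L2_measurable[OF u_L2])

text \<open>The eigenspace is spanned by finitely many u n, since only finitely many eigenvalues lie
  below a bound; pairing with each of them shows that every coefficient of f in this span is
  zero.\<close>

lemma eigenvector_orthogonal_eq_0: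
  assumes m: "m \<in> I" and fk: "(f, k) \<in> \<Lambda>" and k: "AE x in \<sigma>. k x = complex_of_real (ev m) * f x"
    and orth: "\<And>n. n \<in> I \<Longrightarrow> coef n f = 0"
  shows "AE x in \<sigma>. f x = 0"
proof -
  have f: "f \<in> L2 \<sigma>" and kL: "k \<in> L2 \<sigma>" using self_adjoint_L2[OF self_adjoint fk] by auto
  have "(f, \<lambda>x. complex_of_real (ev m) * f x) \<in> \<Lambda>"
    by (rule self_adjoint_cong_AE[OF self_adjoint fk _ _ _ k]) (use f in auto)
  then have "f \<in> eigenspace \<Lambda> (complex_of_real (ev m))" by (simp add: eigenspace_def)
  then obtain c where c: "AE x in \<sigma>. f x = (\<Sum>n | n \<in> I \<and> ev n = ev m. c n * u n x)"
    using discrete_spectrum m unfolding purely_discrete_spectrum_def by blast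
  have fin: "finite {n\<in>I. ev n = ev m}"
  proof -
    have "finite {n\<in>I. \<bar>ev n\<bar> \<le> \<bar>ev m\<bar>}"
      using discrete_spectrum by (auto simp: purely_discrete_spectrum_def)
    then show ?thesis by (rule rev_finite_subset) auto
  qed
  have "c n = 0" if n: "n \<in> {n\<in>I. ev n = ev m}" for n
  proof -
    have "coef n f = coef n (\<lambda>x. \<Sum>j\<in>{n\<in>I. ev n = ev m}. c j * u j x)"
      by (rule coef_cong_AE[OF _ _ _ c]) (use n f in \<open>auto intro!: L2_measurable L2_sum\<close>)
    also have "\<dots> = (\<Sum>j\<in>{n\<in>I. ev n = ev m}. c j * coef n (u j))"
      unfolding coef_def using n by (subst L2_inner_sum_right) (auto simp: L2_inner_scale_right)
    also have "\<dots> = (\<Sum>j\<in>{n\<in>I. ev n = ev m}. if j = n then c j else 0)"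
      using n by (intro sum.cong) (auto simp: coef_u)
    also have "\<dots> = c n" using n fin by simp
    finally show ?thesis using orth n by simp
  qed
  then have "(\<Sum>n | n \<in> I \<and> ev n = ev m. c n * u n x) = 0" for x by (intro sum.neutral) auto
  with c show ?thesis by simp
qed

theorem eigenfunctions_complete:
  assumes f: "f \<in> L2 \<sigma>" and orth: "\<And>m. m \<in> I \<Longrightarrow> coef m f = 0"
  shows "AE x in \<sigma>. f x = 0"
proof -
  \<comment> \<open>Orthogonality to both u m and i u m is demanded because \<open>inner\<close>
    sees only real parts; together they say that the complex coefficients vanish.\<close>
  define H :: "'a sphere_L2 set" where
    "H = {x. \<forall>m\<in>I. inner (abs_sphere_L2 (u m)) x = 0 \<and> inner (abs_sphere_L2 (\<lambda>x. \<i> * u m x)) x = 0}"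
  \<comment> \<open>The part of \<Lambda> in H, described by the adjoint relation instead of as an
    image of \<Lambda>. In this form it is an intersection of closed conditions.\<close>
  define G :: "('a sphere_L2 \<times> 'a sphere_L2) set" where
    "G = {p. fst p \<in> H \<and> snd p \<in> H \<and>
      (\<forall>f k. (f, k) \<in> \<Lambda> \<longrightarrow> inner (abs_sphere_L2 k) (fst p) = inner (abs_sphere_L2 f) (snd p))}"
  have inner_abs: "inner (abs_sphere_L2 f) (abs_sphere_L2 g) = Re (L2_inner \<sigma> f g)"
    if "f \<in> L2 \<sigma>" "g \<in> L2 \<sigma>" for f g
    using that by (simp add: inner_sphere_L2.abs_eq)
  have abs_H: "abs_sphere_L2 f \<in> H \<longleftrightarrow> (\<forall>m\<in>I. coef m f = 0)" if f: "f \<in> L2 \<sigma>" for f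
    using f by (auto simp: H_def inner_abs L2_inner_scale_left coef_def complex_eq_iff)
  have abs_G: "(abs_sphere_L2 f, abs_sphere_L2 k) \<in> G \<longleftrightarrow>
      (f, k) \<in> \<Lambda> \<and> (\<forall>m\<in>I. coef m f = 0) \<and> (\<forall>m\<in>I. coef m k = 0)"
    if fk: "f \<in> L2 \<sigma>" "k \<in> L2 \<sigma>" for f k
  proof -
    have "(\<forall>g h. (g, h) \<in> \<Lambda> \<longrightarrow> inner (abs_sphere_L2 h) (abs_sphere_L2 f) = inner (abs_sphere_L2 g) (abs_sphere_L2 k))
        \<longleftrightarrow> (f, k) \<in> \<Lambda>" (is "?L \<longleftrightarrow> ?R")
    proof
      assume L: ?L
      have Re_eq: "Re (L2_inner \<sigma> h f) = Re (L2_inner \<sigma> g k)" if gh: "(g, h) \<in> \<Lambda>" for g h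
        using L gh fk self_adjoint_L2[OF self_adjoint gh] by (simp add: inner_abs[symmetric])
      \<comment> \<open>Replacing (g, h) by (i g, i h), which is again in \<Lambda>, supplies the
        imaginary part.\<close>
      have "L2_inner \<sigma> h f = L2_inner \<sigma> g k" if gh: "(g, h) \<in> \<Lambda>" for g h
        using Re_eq[OF gh] Re_eq[OF self_adjoint_scale[OF self_adjoint gh, of \<i>]]
        by (simp add: L2_inner_scale_left complex_eq_iff)
      then show ?R using fk self_adjoint_iff[OF self_adjoint, of f k] by blast
    next
      assume R: ?R
      show ?L
      proof (intro allI impI)
        fix g h assume gh: "(g, h) \<in> \<Lambda>"
        show "inner (abs_sphere_L2 h) (abs_sphere_L2 f) = inner (abs_sphere_L2 g) (abs_sphere_L2 k)"
          using self_adjoint_symmetric[OF self_adjoint gh R] self_adjoint_L2[OF self_adjoint gh] fk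
          by (simp add: inner_abs)
      qed
    qed
    then show ?thesis using abs_H fk by (auto simp: G_def)
  qed
  have cases: thesis if "\<And>f. f \<in> L2 \<sigma> \<Longrightarrow> x = abs_sphere_L2 f \<Longrightarrow> thesis" for x :: "'a sphere_L2" and thesis
    using that[OF rep_sphere_L2 abs_rep_sphere_L2[symmetric]] .
  have subH: "subspace H" by (auto simp: subspace_def H_def inner_simps)
  have subG: "subspace G" using subH by (auto simp: subspace_def G_def inner_simps)
  have GH: "G \<subseteq> H \<times> H" by (auto simp: G_def)
  have "H = {0}"
  proof (rule discrete_spectrum_no_eigenvector_trivial[OF subG _ GH subH, where E = "ev ` I"])
    have clH: "closed {p :: 'a sphere_L2 \<times> 'a sphere_L2. fst p \<in> H}" "closed {p :: 'a sphere_L2 \<times> 'a sphere_L2. snd p \<in> H}"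
      unfolding H_def mem_Collect_eq Ball_def imp_conv_disj
      by (intro closed_Collect_all closed_Collect_disj closed_Collect_conj closed_Collect_const
          closed_Collect_eq continuous_intros)+
    show "closed G" unfolding G_def imp_conv_disj
      by (intro closed_Collect_all closed_Collect_disj closed_Collect_conj closed_Collect_const
          closed_Collect_eq continuous_intros clH)
    show "symmetric_rel G"
      unfolding symmetric_rel_def
    proof (intro allI impI)
      fix x y x' y' :: "'a sphere_L2" assume xy: "(x, y) \<in> G" "(x', y') \<in> G"
      obtain f k f' k' where a: "f \<in> L2 \<sigma>" "k \<in> L2 \<sigma>" "f' \<in> L2 \<sigma>" "k' \<in> L2 \<sigma>"
        "x = abs_sphere_L2 f" "y = abs_sphere_L2 k" "x' = abs_sphere_L2 f'" "y' = abs_sphere_L2 k'"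
        using cases by metis
      then have "(f, k) \<in> \<Lambda>" "(f', k') \<in> \<Lambda>" using xy by (auto simp: abs_G)
      then show "inner y x' = inner x y'"
        using self_adjoint_symmetric[OF self_adjoint] a by (simp add: inner_abs)
    qed
    show "y = 0" if "(0, y) \<in> G" for y
    proof -
      obtain k where k: "k \<in> L2 \<sigma>" "y = abs_sphere_L2 k" by (rule cases)
      have 0: "(0 :: 'a sphere_L2) = abs_sphere_L2 (\<lambda>x. 0)" by (simp add: zero_sphere_L2.abs_eq)
      have "(\<lambda>x. 0, k) \<in> \<Lambda>" using that k unfolding 0 by (simp add: abs_G)
      then have "AE x in \<sigma>. k x = 0" by (rule self_adjoint_single_valued[OF self_adjoint]) simp
      then show "y = 0" using k unfolding 0 by (simp add: abs_sphere_L2_eq_iff)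
    qed
    show "\<exists>\<delta>>0. \<forall>w. w \<noteq> z \<longrightarrow> \<bar>w - z\<bar> < \<delta> \<longrightarrow> w \<notin> ev ` I" if z: "z \<in> ev ` I" for z
    proof -
      obtain m where m: "m \<in> I" "z = ev m" using z by blast
      have spec: "spectrum \<sigma> \<Lambda> = (\<lambda>m. complex_of_real (ev m)) ` I"
        and "complex_of_real z isolated_in spectrum \<sigma> \<Lambda>"
        using discrete_spectrum m by (auto simp: purely_discrete_spectrum_def)
      then obtain T where T: "open T" "T \<inter> spectrum \<sigma> \<Lambda> = {complex_of_real z}" by (auto simp: isolated_in_def)
      then have "complex_of_real z \<in> T" by blast
      then obtain \<delta> where \<delta>: "\<delta> > 0" "ball (complex_of_real z) \<delta> \<subseteq> T" using T(1) open_contains_ball by blast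
      have "w \<notin> ev ` I" if w: "w \<noteq> z" "\<bar>w - z\<bar> < \<delta>" for w
      proof
        assume "w \<in> ev ` I"
        then have "complex_of_real w \<in> spectrum \<sigma> \<Lambda>" unfolding spec by auto
        moreover have "complex_of_real w \<in> ball (complex_of_real z) \<delta>"
          using w(2) by (simp add: dist_real_def abs_minus_commute)
        then have "complex_of_real w \<in> T" using \<delta>(2) by blast
        ultimately have "complex_of_real w \<in> {complex_of_real z}" unfolding T(2)[symmetric] by blast
        then show False using w by simp
      qed
      then show ?thesis using \<delta>(1) by blast
    qed
    show "x = 0" if z: "z \<in> ev ` I" and x: "(x, z *\<^sub>R x) \<in> G" for z x
    proof -
      obtain m where m: "m \<in> I" "z = ev m" using z by blast
      obtain f where f: "f \<in> L2 \<sigma>" "x = abs_sphere_L2 f" by (rule cases)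
      have zx: "z *\<^sub>R x = abs_sphere_L2 (\<lambda>t. complex_of_real z * f t)"
        using f by (simp add: scaleR_sphere_L2.abs_eq)
      have "(f, \<lambda>t. complex_of_real z * f t) \<in> \<Lambda>" and o: "\<forall>n\<in>I. coef n f = 0"
        using x f unfolding zx by (auto simp: abs_G)
      then have "AE x in \<sigma>. f x = 0"
        using eigenvector_orthogonal_eq_0[OF m(1)] m(2) by simp
      then show "x = 0" using f by (simp add: zero_sphere_L2.abs_eq abs_sphere_L2_eq_iff zero_sphere_L2_def)
    qed
    show "regular_at G H z" if z: "z \<notin> ev ` I" for z
    proof -
      have "complex_of_real z \<notin> spectrum \<sigma> \<Lambda>"
        using discrete_spectrum z by (auto simp: purely_discrete_spectrum_def)
      then have surj: "L2 \<sigma> \<subseteq> Range (shift_op \<Lambda> (complex_of_real z))"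
        and "\<exists>c. \<forall>(f, g)\<in>shift_op \<Lambda> (complex_of_real z). L2_norm \<sigma> f \<le> c * L2_norm \<sigma> g"
        by (auto simp: spectrum_def resolvent_set_def)
      then obtain c where c: "\<And>f k. (f, k) \<in> \<Lambda> \<Longrightarrow> L2_norm \<sigma> f \<le> c * L2_norm \<sigma> (\<lambda>x. k x - complex_of_real z * f x)"
        unfolding shift_op_def by fastforce
      show ?thesis unfolding regular_at_def
      proof (intro conjI ballI exI[of _ c] allI impI)
        fix y assume y: "y \<in> H"
        obtain g where g: "g \<in> L2 \<sigma>" "y = abs_sphere_L2 g" by (rule cases)
        obtain f k where fk: "(f, k) \<in> \<Lambda>" "g = (\<lambda>x. k x - complex_of_real z * f x)"
          using subsetD[OF surj g(1)] by (auto simp: shift_op_def)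
        have L2: "f \<in> L2 \<sigma>" "k \<in> L2 \<sigma>" using self_adjoint_L2[OF self_adjoint fk(1)] by auto
        \<comment> \<open>The resolvent preserves H: coef m g = (ev m - z) coef m f, and the factor
          is nonzero because z is none of the eigenvalues.\<close>
        have "coef m f = 0" if m: "m \<in> I" for m
        proof -
          have "coef m g = 0" using y g abs_H m by auto
          moreover have "coef m g = (complex_of_real (ev m) - complex_of_real z) * coef m f"
            using L2 m fk by (simp add: coef_diff coef_scale coef_graph[OF fk(1)] algebra_simps)
          moreover have "complex_of_real (ev m) \<noteq> complex_of_real z" using z m by auto
          ultimately show ?thesis by simp
        qed
        then have "(abs_sphere_L2 f, abs_sphere_L2 k) \<in> G" using fk coef_graph[OF fk(1)] L2 by (simp add: abs_G)
        moreover have "y + z *\<^sub>R abs_sphere_L2 f = abs_sphere_L2 k"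
          using g L2 fk(2) by (simp add: scaleR_sphere_L2.abs_eq plus_sphere_L2.abs_eq)
        ultimately show "\<exists>f. (f, y + z *\<^sub>R f) \<in> G" by metis
      next
        fix x y :: "'a sphere_L2" assume xy: "(x, y) \<in> G"
        obtain f k where a: "f \<in> L2 \<sigma>" "k \<in> L2 \<sigma>" "x = abs_sphere_L2 f" "y = abs_sphere_L2 k"
          using cases by metis
        then have "(f, k) \<in> \<Lambda>" using xy by (auto simp: abs_G)
        from c[OF this] show "norm x \<le> c * norm (y - z *\<^sub>R x)"
          using a by (simp add: scaleR_sphere_L2.abs_eq minus_sphere_L2.abs_eq norm_sphere_L2.abs_eq)
      qed
    qed
  qed
  moreover have "abs_sphere_L2 f \<in> H" using f orth by (simp add: abs_H)
  ultimately have "abs_sphere_L2 f = abs_sphere_L2 (\<lambda>x. 0)" by (simp add: zero_sphere_L2_def)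
  then show ?thesis using f by (simp add: abs_sphere_L2_eq_iff)
qed

section \<open>Eigenfunction expansions and Parseval's identity\<close>

definition low :: "nat \<Rightarrow> 'i set" where
  "low n = {m\<in>I. \<bar>ev m\<bar> \<le> real n}"

lemma finite_low [simp]: "finite (low n)"
  using discrete_spectrum by (auto simp: purely_discrete_spectrum_def low_def)

lemma low_subset: "low n \<subseteq> I"
  by (auto simp: low_def)

lemma low_mono: "m \<le> n \<Longrightarrow> low m \<subseteq> low n"
  by (auto simp: low_def)

text \<open>The sets \<open>low n\<close> exhaust \<open>I\<close>, and they are finite because the
  eigenvalues accumulate only at infinity. Limits along them stand for all sums over
  \<open>I\<close>, without an enumeration of the index set.\<close>

lemma eventually_low: "m \<in> I \<Longrightarrow> \<forall>\<^sub>F n in sequentially. m \<in> low n"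
proof -
  assume m: "m \<in> I"
  obtain N :: nat where "\<bar>ev m\<bar> \<le> real N" using real_arch_simple by blast
  with m have "m \<in> low N" by (simp add: low_def)
  with low_mono show ?thesis unfolding eventually_sequentially by blast
qed

definition psum :: "'i set \<Rightarrow> ('i \<Rightarrow> complex) \<Rightarrow> 'a \<Rightarrow> complex" where
  "psum F c x = (\<Sum>m\<in>F. c m * u m x)"

lemma psum_L2 [simp]: "F \<subseteq> I \<Longrightarrow> psum F c \<in> L2 \<sigma>"
  unfolding psum_def[abs_def] by (intro L2_sum L2_scale u_L2) auto

lemma inner_psum:
  assumes "F \<subseteq> I" "f \<in> L2 \<sigma>"
  shows "L2_inner \<sigma> f (psum F c) = (\<Sum>m\<in>F. c m * cnj (coef m f))"
proof -
  have "L2_inner \<sigma> f (psum F c) = (\<Sum>m\<in>F. L2_inner \<sigma> f (\<lambda>x. c m * u m x))"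
    unfolding psum_def[abs_def] using assms by (intro L2_inner_sum_right L2_scale u_L2) auto
  then show ?thesis by (simp add: L2_inner_scale_right coef_def L2_inner_cnj)
qed

lemma coef_psum:
  assumes "finite F" "F \<subseteq> I" "m \<in> I"
  shows "coef m (psum F c) = (if m \<in> F then c m else 0)"
proof -
  have "coef m (psum F c) = (\<Sum>n\<in>F. c n * cnj (coef n (u m)))"
    unfolding coef_def[of m] using assms by (intro inner_psum) auto
  also have "\<dots> = (\<Sum>n\<in>F. if n = m then c n else 0)"
    using assms by (intro sum.cong) (auto simp: coef_u)
  finally show ?thesis using assms by simp
qed

lemma norm_psum:
  assumes "finite F" "F \<subseteq> I"
  shows "(L2_norm \<sigma> (psum F c))\<^sup>2 = (\<Sum>m\<in>F. (cmod (c m))\<^sup>2)"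
proof -
  have "complex_of_real ((L2_norm \<sigma> (psum F c))\<^sup>2) = (\<Sum>m\<in>F. c m * cnj (coef m (psum F c)))"
    unfolding L2_inner_self[symmetric] by (rule inner_psum) (use assms in auto)
  also have "\<dots> = (\<Sum>m\<in>F. complex_of_real ((cmod (c m))\<^sup>2))"
    by (intro sum.cong) (use assms in \<open>auto simp: coef_psum subset_iff complex_norm_square simp del: of_real_power\<close>)
  finally show ?thesis unfolding of_real_sum[symmetric] of_real_eq_iff .
qed

lemma norm_diff_psum:
  assumes "finite F" "F \<subseteq> I" "f \<in> L2 \<sigma>"
  shows "(L2_norm \<sigma> (\<lambda>x. f x - psum F (\<lambda>m. coef m f) x))\<^sup>2 = (L2_norm \<sigma> f)\<^sup>2 - (\<Sum>m\<in>F. (cmod (coef m f))\<^sup>2)"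
proof -
  have "L2_inner \<sigma> f (psum F (\<lambda>m. coef m f)) = (\<Sum>m\<in>F. complex_of_real ((cmod (coef m f))\<^sup>2))"
    using assms by (simp add: inner_psum complex_norm_square del: of_real_power)
  then have "Re (L2_inner \<sigma> (psum F (\<lambda>m. coef m f)) f) = (\<Sum>m\<in>F. (cmod (coef m f))\<^sup>2)"
    by (subst Re_L2_inner_commute) (simp only: Re_sum Re_complex_of_real)
  then show ?thesis
    using assms by (simp add: L2_norm_diff_expand norm_psum)
qed

lemma bessel:
  assumes "finite F" "F \<subseteq> I" "f \<in> L2 \<sigma>"
  shows "(\<Sum>m\<in>F. (cmod (coef m f))\<^sup>2) \<le> (L2_norm \<sigma> f)\<^sup>2"
  using norm_diff_psum[OF assms] zero_le_power2[of "L2_norm \<sigma> (\<lambda>x. f x - psum F (\<lambda>m. coef m f) x)"] by linarith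

lemma norm_psum_low_diff:
  assumes "k \<le> n"
  shows "(L2_norm \<sigma> (\<lambda>x. psum (low n) c x - psum (low k) c x))\<^sup>2
    = (\<Sum>m\<in>low n. (cmod (c m))\<^sup>2) - (\<Sum>m\<in>low k. (cmod (c m))\<^sup>2)"
proof -
  have "(\<lambda>x. psum (low n) c x - psum (low k) c x) = psum (low n - low k) c"
    using low_mono[OF assms] by (auto simp: psum_def sum_diff)
  moreover have "low n - low k \<subseteq> I" using low_subset[of n] by blast
  ultimately show ?thesis
    using low_mono[OF assms] by (simp add: norm_psum sum_diff)
qed

lemma tendsto_coef:
  assumes m: "m \<in> I" and f: "\<And>n. f n \<in> L2 \<sigma>" "g \<in> L2 \<sigma>"
    and lim: "(\<lambda>n. L2_norm \<sigma> (\<lambda>x. f n x - g x)) \<longlonglongrightarrow> 0"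
  shows "(\<lambda>n. coef m (f n)) \<longlonglongrightarrow> coef m g"
proof (rule Lim_null_comparison[THEN LIM_zero_cancel])
  show "\<forall>\<^sub>F n in sequentially. norm (coef m (f n) - coef m g) \<le> L2_norm \<sigma> (u m) * L2_norm \<sigma> (\<lambda>x. f n x - g x)"
    using m f by (auto simp: coef_diff[symmetric]) (auto simp: coef_def intro!: always_eventually L2_Cauchy_Schwarz)
  show "(\<lambda>n. L2_norm \<sigma> (u m) * L2_norm \<sigma> (\<lambda>x. f n x - g x)) \<longlonglongrightarrow> 0"
    using tendsto_mult_right_zero[OF lim] .
qed

text \<open>Produces functions from coefficients: bounded square sums make the partial sums converge
  in norm, and each coefficient is eventually constant along them. The values of the square root are
  built this way.\<close>

lemma exists_coef:
  assumes K: "\<And>n. (\<Sum>m\<in>low n. (cmod (c m))\<^sup>2) \<le> K"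
  obtains g where "g \<in> L2 \<sigma>" "\<And>m. m \<in> I \<Longrightarrow> coef m g = c m"
    "(\<lambda>n. L2_norm \<sigma> (\<lambda>x. psum (low n) c x - g x)) \<longlonglongrightarrow> 0"
proof -
  define S where "S n = (\<Sum>m\<in>low n. (cmod (c m))\<^sup>2)" for n
  have S: "incseq S" unfolding S_def by (auto simp: incseq_def intro!: sum_mono2 low_mono)
  have L2: "psum (low n) c \<in> L2 \<sigma>" for n using low_subset by simp
  obtain g where g: "g \<in> L2 \<sigma>" "(\<lambda>n. L2_norm \<sigma> (\<lambda>x. psum (low n) c x - g x)) \<longlonglongrightarrow> 0"
    by (rule L2_convergent_of_bounded_increments[of "\<lambda>n. psum (low n) c" \<sigma> S K])
      (auto simp: L2 S S_def K norm_psum_low_diff)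
  show thesis
  proof (rule that[OF g(1) _ g(2)])
    fix m assume m: "m \<in> I"
    have "(\<lambda>n. coef m (psum (low n) c)) \<longlonglongrightarrow> coef m g" by (rule tendsto_coef[OF m L2 g])
    moreover have "(\<lambda>n. coef m (psum (low n) c)) \<longlonglongrightarrow> c m"
      by (rule tendsto_eventually) (use eventually_low[OF m] in eventually_elim, simp add: coef_psum low_subset m)
    ultimately show "coef m g = c m" by (rule LIMSEQ_unique)
  qed
qed

text \<open>Bessel's inequality alone gives convergence to some g with the coefficients of f. That g
  is f uses completeness, since g - f is orthogonal to every eigenfunction.\<close>

lemma expansion:
  assumes f: "f \<in> L2 \<sigma>"
  shows "(\<lambda>n. L2_norm \<sigma> (\<lambda>x. psum (low n) (\<lambda>m. coef m f) x - f x)) \<longlonglongrightarrow> 0"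
proof -
  have "(\<Sum>m\<in>low n. (cmod (coef m f))\<^sup>2) \<le> (L2_norm \<sigma> f)\<^sup>2" for n
    by (rule bessel) (auto simp: low_subset f)
  then obtain g where g: "g \<in> L2 \<sigma>" "\<And>m. m \<in> I \<Longrightarrow> coef m g = coef m f"
    "(\<lambda>n. L2_norm \<sigma> (\<lambda>x. psum (low n) (\<lambda>m. coef m f) x - g x)) \<longlonglongrightarrow> 0"
    by (rule exists_coef) (rule that)
  have "AE x in \<sigma>. g x - f x = 0"
    by (rule eigenfunctions_complete) (use f g in \<open>auto simp: coef_diff\<close>)
  then have "L2_norm \<sigma> (\<lambda>x. psum (low n) (\<lambda>m. coef m f) x - g x)
      = L2_norm \<sigma> (\<lambda>x. psum (low n) (\<lambda>m. coef m f) x - f x)" for n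
    unfolding L2_norm_def using f g psum_L2[OF low_subset]
    by (intro arg_cong[where f = sqrt] integral_cong_AE)
      (auto elim!: eventually_mono intro!: borel_measurable_power borel_measurable_norm borel_measurable_diff dest: L2_measurable)
  with g(3) show ?thesis by simp
qed

lemma parseval:
  assumes f: "f \<in> L2 \<sigma>"
  shows "(\<lambda>n. \<Sum>m\<in>low n. (cmod (coef m f))\<^sup>2) \<longlonglongrightarrow> (L2_norm \<sigma> f)\<^sup>2"
proof -
  have "(\<lambda>n. (L2_norm \<sigma> f)\<^sup>2 - (L2_norm \<sigma> (\<lambda>x. psum (low n) (\<lambda>m. coef m f) x - f x))\<^sup>2)
      \<longlonglongrightarrow> (L2_norm \<sigma> f)\<^sup>2 - 0\<^sup>2"
    by (intro tendsto_intros expansion f)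
  moreover have "(L2_norm \<sigma> f)\<^sup>2 - (L2_norm \<sigma> (\<lambda>x. psum (low n) (\<lambda>m. coef m f) x - f x))\<^sup>2
      = (\<Sum>m\<in>low n. (cmod (coef m f))\<^sup>2)" for n
    using norm_diff_psum[OF finite_low low_subset f, of n] by (subst L2_norm_diff_commute) simp
  ultimately show ?thesis by simp
qed

lemma parseval_inner:
  assumes f: "f \<in> L2 \<sigma>" and g: "g \<in> L2 \<sigma>"
  shows "(\<lambda>n. \<Sum>m\<in>low n. coef m g * cnj (coef m f)) \<longlonglongrightarrow> L2_inner \<sigma> f g"
proof (rule Lim_null_comparison[THEN LIM_zero_cancel])
  show "\<forall>\<^sub>F n in sequentially. norm ((\<Sum>m\<in>low n. coef m g * cnj (coef m f)) - L2_inner \<sigma> f g)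
      \<le> L2_norm \<sigma> f * L2_norm \<sigma> (\<lambda>x. psum (low n) (\<lambda>m. coef m g) x - g x)"
  proof (rule always_eventually, rule allI)
    fix n
    have "(\<Sum>m\<in>low n. coef m g * cnj (coef m f)) - L2_inner \<sigma> f g
        = L2_inner \<sigma> f (\<lambda>x. psum (low n) (\<lambda>m. coef m g) x - g x)"
      using f g low_subset by (simp add: L2_inner_diff_right inner_psum)
    then show "norm ((\<Sum>m\<in>low n. coef m g * cnj (coef m f)) - L2_inner \<sigma> f g)
        \<le> L2_norm \<sigma> f * L2_norm \<sigma> (\<lambda>x. psum (low n) (\<lambda>m. coef m g) x - g x)"
      using L2_Cauchy_Schwarz[OF f L2_diff[OF psum_L2[OF low_subset] g]] by simp
  qed
  show "(\<lambda>n. L2_norm \<sigma> f * L2_norm \<sigma> (\<lambda>x. psum (low n) (\<lambda>m. coef m g) x - g x)) \<longlonglongrightarrow> 0"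
    using tendsto_mult_right_zero[OF expansion[OF g]] .
qed

end

subsection \<open>Polar coordinates\<close>

lemma space_sphere_measure [simp]: "space (sphere_measure :: 'a::euclidean_space measure) = sphere 0 1"
  by (simp add: sphere_measure_def space_scale_measure space_restrict_space)

lemma sets_sphere_measure [measurable_cong]:
  "sets (sphere_measure :: 'a::euclidean_space measure) = sets (restrict_space borel (sphere 0 1))"
  by (simp add: sphere_measure_def)

lemma sets_sphere_measureD:
  assumes "B \<in> sets (sphere_measure :: 'a::euclidean_space measure)"
  shows "B \<in> sets borel" "B \<subseteq> sphere 0 1"
  using assms by (auto simp: sets_sphere_measure sets_restrict_space_iff)

lemma borel_measurable_sgn [measurable]: "(sgn :: 'a::euclidean_space \<Rightarrow> 'a) \<in> borel_measurable borel"
  unfolding sgn_div_norm[abs_def] by measurable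

lemma measurable_sgn_sphere:
  "sgn \<in> restrict_space lborel (A - {0 :: 'a::euclidean_space}) \<rightarrow>\<^sub>M restrict_space borel (sphere 0 1)"
  by (rule measurable_restrict_space2) (auto simp: space_restrict_space norm_sgn intro: measurable_restrict_space1)

definition truncated_cone :: "real \<Rightarrow> 'a::euclidean_space set \<Rightarrow> 'a set" where
  "truncated_cone R B = {x. x \<noteq> 0 \<and> norm x < R \<and> sgn x \<in> B}"

lemma sets_truncated_cone [measurable]:
  assumes "B \<in> sets borel" shows "truncated_cone R B \<in> sets borel"
proof -
  have "truncated_cone R B = sgn -` B \<inter> ball 0 R - {0}" by (auto simp: truncated_cone_def)
  then show ?thesis using measurable_sets_borel[OF borel_measurable_sgn assms] by simp
qed

lemma emeasure_sphere_measure: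
  assumes "B \<in> sets (sphere_measure :: 'a::euclidean_space measure)"
  shows "emeasure sphere_measure B = of_nat DIM('a) * emeasure lborel (truncated_cone 1 B)"
proof -
  let ?A = "ball 0 1 - {0 :: 'a}"
  have "emeasure sphere_measure B = of_nat DIM('a) * emeasure (restrict_space lborel ?A) (sgn -` B \<inter> ?A)"
    using assms unfolding sphere_measure_def
    by (subst emeasure_scale_measure, subst emeasure_distr[OF measurable_sgn_sphere])
      (auto simp: space_restrict_space)
  also have "sgn -` B \<inter> ?A = truncated_cone 1 B" by (auto simp: truncated_cone_def)
  also have "emeasure (restrict_space lborel ?A) (truncated_cone 1 B) = emeasure lborel (truncated_cone 1 B)"
    by (rule emeasure_restrict_space) (auto simp: truncated_cone_def)
  finally show ?thesis .
qed

lemma emeasure_truncated_cone_finite: "emeasure lborel (truncated_cone R B :: 'a::euclidean_space set) < \<infinity>"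
proof -
  have "emeasure lborel (truncated_cone R B) \<le> emeasure lborel (ball 0 R :: 'a set)"
    by (rule emeasure_mono) (auto simp: truncated_cone_def)
  also have "\<dots> < \<infinity>" using emeasure_bounded_finite[OF bounded_ball] by (simp add: less_top)
  finally show ?thesis .
qed

interpretation sphere_measure: finite_measure "sphere_measure :: 'a::euclidean_space measure"
proof
  have "emeasure (sphere_measure :: 'a measure) (sphere 0 1) < \<infinity>"
    using emeasure_truncated_cone_finite[of 1 "sphere 0 1 :: 'a set"] sets.top[of "sphere_measure :: 'a measure"]
    by (subst emeasure_sphere_measure) (auto simp: ennreal_mult_less_top ennreal_of_nat_eq_real_of_nat)
  then show "emeasure (sphere_measure :: 'a measure) (space sphere_measure) \<noteq> \<infinity>" by simp
qed

text \<open>Dilation by R maps the unit cone over B onto the one of radius R and multiplies volume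
  by the d-th power of R; this homogeneity is what separates radius from direction.\<close>

lemma emeasure_truncated_cone:
  assumes B [measurable]: "B \<in> sets borel" and R: "R > 0"
  shows "emeasure lborel (truncated_cone R B :: 'a::euclidean_space set) = ennreal (R ^ DIM('a)) * emeasure lborel (truncated_cone 1 B)"
proof -
  have "emeasure lborel (truncated_cone R B) = emeasure (density (distr lborel borel (\<lambda>x. 0 + R *\<^sub>R x)) (\<lambda>_. ennreal (\<bar>R\<bar> ^ DIM('a)))) (truncated_cone R B)"
    using lborel_affine[of R "0 :: 'a"] R by simp
  also have "\<dots> = ennreal (R ^ DIM('a)) * emeasure (distr lborel borel (\<lambda>x. 0 + R *\<^sub>R x)) (truncated_cone R B)"
    using R by (subst emeasure_density) (auto simp: nn_integral_cmult_indicator)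
  also have "emeasure (distr lborel borel (\<lambda>x. 0 + R *\<^sub>R x)) (truncated_cone R B) = emeasure lborel ((\<lambda>x. 0 + R *\<^sub>R x) -` truncated_cone R B)"
    by (subst emeasure_distr) auto
  also have "(\<lambda>x. 0 + R *\<^sub>R x) -` truncated_cone R B = truncated_cone 1 B"
    using R by (auto simp: truncated_cone_def sgn_scaleR)
  finally show ?thesis .
qed

definition radial_measure :: "nat \<Rightarrow> real measure" where
  "radial_measure d = density lborel (\<lambda>r. indicator {0<..} r * ennreal (r ^ (d - 1)))"

lemma sets_radial_measure [simp, measurable_cong]: "sets (radial_measure d) = sets borel"
  by (simp add: radial_measure_def)

lemma emeasure_radial_measure:
  assumes "d > 0"
  shows "emeasure (radial_measure d) {..<R} = (if R > 0 then ennreal (R ^ d / d) else 0)"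
proof (cases "R > 0")
  case True
  have "emeasure (radial_measure d) {..<R} = (\<integral>\<^sup>+r. indicator {0<..} r * ennreal (r ^ (d - 1)) * indicator {..<R} r \<partial>lborel)"
    unfolding radial_measure_def by (rule emeasure_density) auto
  also have "\<dots> = (\<integral>\<^sup>+r. ennreal (r ^ (d - 1)) * indicator {0..R} r \<partial>lborel)"
    using AE_lborel_singleton[of 0] AE_lborel_singleton[of R]
    by (intro nn_integral_cong_AE, eventually_elim) (auto split: split_indicator)
  also have "\<dots> = ennreal (R ^ d / d - 0 ^ d / d)"
  proof (rule nn_integral_FTC_Icc)
    show "DERIV (\<lambda>r. r ^ d / d) x :> x ^ (d - 1)" for x :: real
      using assms by (auto intro!: derivative_eq_intros)
  qed (use True in auto)
  finally show ?thesis using assms True by (simp add: zero_power)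
next
  case False
  then have "indicator {0<..} r * ennreal (r ^ (d - 1)) * indicator {..<R} r = 0" for r :: real
    by (auto split: split_indicator)
  then have "emeasure (radial_measure d) {..<R} = 0"
    unfolding radial_measure_def by (subst emeasure_density) (simp_all only:, simp_all)
  with False show ?thesis by simp
qed

lemma sigma_finite_radial_measure: "sigma_finite_measure (radial_measure d)"
  unfolding radial_measure_def
  by (subst sigma_finite_measure.sigma_finite_iff_density_finite[OF sigma_finite_lborel]) (auto split: split_indicator)

lemma measurable_norm_sgn:
  "(\<lambda>x. (norm x, sgn x)) \<in> restrict_space lborel (- {0 :: 'a::euclidean_space}) \<rightarrow>\<^sub>M borel \<Otimes>\<^sub>M sphere_measure"
proof (rule measurable_Pair)
  show "norm \<in> restrict_space lborel (- {0 :: 'a}) \<rightarrow>\<^sub>M borel" by (rule measurable_restrict_space1) simp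
  show "sgn \<in> restrict_space lborel (- {0 :: 'a}) \<rightarrow>\<^sub>M sphere_measure"
    using measurable_sgn_sphere[of UNIV] by (simp add: measurable_cong_sets[OF refl sets_sphere_measure] Compl_eq_Diff_UNIV)
qed

text \<open>Compared on rectangles A x B. For fixed B, both sides are measures in A that agree on
  the half-lines {..<R}: one is the volume of the cone over B truncated at R, the other the measure
  of B times R^d/d, and the factor d in \<open>sphere_measure\<close> matches them.\<close>

lemma polar_measure:
  "radial_measure DIM('a) \<Otimes>\<^sub>M sphere_measure =
    distr (restrict_space lborel (- {0 :: 'a::euclidean_space})) (borel \<Otimes>\<^sub>M sphere_measure) (\<lambda>x. (norm x, sgn x))"
  (is "?P = distr ?L ?T ?f")
proof (rule pair_measure_eqI)
  have f: "?f \<in> ?L \<rightarrow>\<^sub>M ?T" by (rule measurable_norm_sgn)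
  show "sigma_finite_measure (radial_measure DIM('a))" by (rule sigma_finite_radial_measure)
  show "sigma_finite_measure (sphere_measure :: 'a measure)" by unfold_locales
  show "sets ?P = sets (distr ?L ?T ?f)" unfolding sets_distr by (rule sets_pair_measure_cong) simp_all
  fix A and B :: "'a set" assume A: "A \<in> sets (radial_measure DIM('a))" and B: "B \<in> sets sphere_measure"
  then have [measurable]: "A \<in> sets borel" "B \<in> sets borel" by (auto dest: sets_sphere_measureD)
  let ?C = "{x :: 'a. x \<noteq> 0 \<and> sgn x \<in> B}"
  have C [measurable]: "?C \<in> sets borel"
  proof -
    have "?C = sgn -` B - {0}" by auto
    then show ?thesis using measurable_sets_borel[OF borel_measurable_sgn \<open>B \<in> sets borel\<close>] by simp
  qed
  have "emeasure (distr ?L ?T ?f) (A \<times> B) = emeasure ?L {x. x \<noteq> 0 \<and> norm x \<in> A \<and> sgn x \<in> B}"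
    using f B by (subst emeasure_distr) (auto simp: space_restrict_space intro!: arg_cong2[where f = emeasure])
  also have "\<dots> = emeasure lborel {x. x \<noteq> 0 \<and> norm x \<in> A \<and> sgn x \<in> B}"
    by (rule emeasure_restrict_space) auto
  also have "\<dots> = emeasure (distr (restrict_space lborel ?C) borel norm) A"
    by (subst emeasure_distr)
      (auto simp: space_restrict_space emeasure_restrict_space intro!: measurable_restrict_space1 arg_cong2[where f = emeasure])
  also have "distr (restrict_space lborel ?C) borel norm = scale_measure (emeasure sphere_measure B) (radial_measure DIM('a))"
    (is "?M = ?N")
  proof (rule measure_eqI_generator_eq)
    show "Int_stable (range lessThan :: real set set)"
    proof -
      have "{..<a} \<inter> {..<b} = {..<min a b}" for a b :: real by auto
      then show ?thesis by (auto simp: Int_stable_def)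
    qed
    show "range lessThan \<subseteq> Pow (UNIV :: real set)" by simp
    show "sets ?M = sigma_sets UNIV (range lessThan)" "sets ?N = sigma_sets UNIV (range lessThan)"
      by (simp_all add: borel_Iio[where 'a = real] sets_measure_of)
    show "range (\<lambda>n. {..<real n}) \<subseteq> range lessThan" by auto
    show "(\<Union>n. {..<real n}) = UNIV" using reals_Archimedean2 by auto
    have M: "emeasure ?M {..<R} = emeasure lborel (truncated_cone R B)" for R
      by (subst emeasure_distr)
        (auto simp: space_restrict_space emeasure_restrict_space truncated_cone_def intro!: measurable_restrict_space1 arg_cong2[where f = emeasure])
    then show "emeasure ?M {..<real n} \<noteq> \<infinity>" for n
      using emeasure_truncated_cone_finite[of "real n" B] by simp
    fix X :: "real set" assume "X \<in> range lessThan"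
    then obtain R where X: "X = {..<R}" by auto
    show "emeasure ?M X = emeasure ?N X"
    proof (cases "R > 0")
      case True
      have d: "of_nat DIM('a) * ennreal (R ^ DIM('a) / real DIM('a)) = ennreal (R ^ DIM('a))"
        using True by (simp add: ennreal_of_nat_eq_real_of_nat ennreal_mult[symmetric])
      have "emeasure ?N X = of_nat DIM('a) * emeasure lborel (truncated_cone 1 B) * ennreal (R ^ DIM('a) / real DIM('a))"
        unfolding X using True B by (simp add: emeasure_radial_measure emeasure_sphere_measure)
      also have "\<dots> = of_nat DIM('a) * ennreal (R ^ DIM('a) / real DIM('a)) * emeasure lborel (truncated_cone 1 B)"
        by (simp only: mult_ac)
      also have "\<dots> = emeasure ?M X"
        unfolding X M d by (rule emeasure_truncated_cone[OF \<open>B \<in> sets borel\<close> True, symmetric])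
      finally show ?thesis ..
    next
      case False
      have "\<not> norm x < R" for x :: 'a using False norm_ge_zero[of x] by linarith
      then have "truncated_cone R B = {}" by (simp add: truncated_cone_def)
      then show ?thesis unfolding X M using False B by (simp add: emeasure_radial_measure)
    qed
  qed
  finally show "emeasure (radial_measure DIM('a)) A * emeasure sphere_measure B = emeasure (distr ?L ?T ?f) (A \<times> B)"
    by (simp add: mult.commute)
qed

theorem nn_integral_polar:
  fixes f :: "'a::euclidean_space \<Rightarrow> ennreal"
  assumes f [measurable]: "f \<in> borel_measurable borel"
  shows "(\<integral>\<^sup>+x. f x \<partial>lborel) =
    (\<integral>\<^sup>+r. indicator {0<..} r * ennreal (r ^ (DIM('a) - 1)) * (\<integral>\<^sup>+w. f (r *\<^sub>R w) \<partial>sphere_measure) \<partial>lborel)"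
proof -
  let ?L = "restrict_space lborel (- {0 :: 'a})" and ?T = "borel \<Otimes>\<^sub>M (sphere_measure :: 'a measure)"
  have g: "(\<lambda>w. w) \<in> borel_measurable (sphere_measure :: 'a measure)"
    by (simp add: measurable_cong_sets[OF sets_sphere_measure refl] measurable_restrict_space1)
  have h [measurable]: "(\<lambda>p. f (fst p *\<^sub>R snd p)) \<in> borel_measurable ?T"
    by (intro measurable_compose[OF _ f] borel_measurable_scaleR measurable_fst measurable_compose[OF measurable_snd g])
  have m: "(\<lambda>x. (norm x, sgn x)) \<in> ?L \<rightarrow>\<^sub>M ?T" by (rule measurable_norm_sgn)
  have "(\<integral>\<^sup>+x. f x \<partial>lborel) = (\<integral>\<^sup>+x. f x * indicator (- {0}) x \<partial>lborel)"
    using AE_lborel_singleton[of "0 :: 'a"] by (intro nn_integral_cong_AE, eventually_elim) simp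
  also have "\<dots> = (\<integral>\<^sup>+x. f x \<partial>?L)" by (subst nn_integral_restrict_space) auto
  also have "\<dots> = (\<integral>\<^sup>+x. f (fst (norm x, sgn x) *\<^sub>R snd (norm x, sgn x)) \<partial>?L)"
    by (intro nn_integral_cong) (simp add: sgn_div_norm space_restrict_space)
  also have "\<dots> = (\<integral>\<^sup>+p. f (fst p *\<^sub>R snd p) \<partial>distr ?L ?T (\<lambda>x. (norm x, sgn x)))"
    by (rule nn_integral_distr[OF m, symmetric]) (use h in simp)
  also have "\<dots> = (\<integral>\<^sup>+r. \<integral>\<^sup>+w. f (r *\<^sub>R w) \<partial>sphere_measure \<partial>radial_measure DIM('a))"
    unfolding polar_measure[symmetric]
    using h by (subst sphere_measure.nn_integral_fst[symmetric])
      (simp_all add: measurable_cong_sets[OF sets_pair_measure_cong[OF sets_radial_measure refl] refl])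
  also have "\<dots> = (\<integral>\<^sup>+r. indicator {0<..} r * ennreal (r ^ (DIM('a) - 1)) * (\<integral>\<^sup>+w. f (r *\<^sub>R w) \<partial>sphere_measure) \<partial>lborel)"
    unfolding radial_measure_def
    using sphere_measure.borel_measurable_nn_integral_fst[OF h] by (subst nn_integral_density) auto
  finally show ?thesis .
qed

subsection \<open>The square root of the operator\<close>

text \<open>A symmetric extension of A is contained in the adjoint of A, which is A. Hence one
  inclusion suffices to identify two self-adjoint operators; this is used for \<Lambda> and for its
  square root.\<close>

lemma self_adjoint_maximal:
  assumes A: "self_adjoint M A" and B: "self_adjoint M B" and "A \<subseteq> B"
  shows "A = B"
proof
  show "B \<subseteq> A"
  proof (rule subrelI)
    fix g h assume gh: "(g, h) \<in> B"
    show "(g, h) \<in> A"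
      unfolding self_adjoint_iff[OF A, of g h]
      using self_adjoint_L2[OF B gh] self_adjoint_symmetric[OF B _ gh] \<open>A \<subseteq> B\<close> by blast
  qed
qed fact

context discrete_operator
begin

text \<open>Multiplication by \<open>w\<close> on the coefficient side, as in the functional
  calculus. The maximal domain is implicit: f belongs to it when some square integrable k has the
  coefficients w m * coef m f.\<close>

definition multiplier :: "('i \<Rightarrow> real) \<Rightarrow> ('a \<Rightarrow> complex) rel" where
  "multiplier w = {(f, k). f \<in> L2 \<sigma> \<and> k \<in> L2 \<sigma> \<and> (\<forall>m\<in>I. coef m k = complex_of_real (w m) * coef m f)}"

lemma psum_multiplier: "finite F \<Longrightarrow> F \<subseteq> I \<Longrightarrow> (psum F c, psum F (\<lambda>m. complex_of_real (w m) * c m)) \<in> multiplier w"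
  by (auto simp: multiplier_def coef_psum)

text \<open>Finite eigenfunction sums make the domain dense. Testing against u m puts every pair of
  the adjoint into the multiplier; conversely, the real factor w m can be moved across each term of
  Parseval's identity.\<close>

lemma self_adjoint_multiplier: "self_adjoint \<sigma> (multiplier w)"
  unfolding self_adjoint_def
proof
  show "densely_defined \<sigma> (multiplier w)"
    unfolding densely_defined_def
  proof (intro ballI allI impI)
    fix g and e :: real assume g: "g \<in> L2 \<sigma>" and e: "e > 0"
    obtain n where "L2_norm \<sigma> (\<lambda>x. psum (low n) (\<lambda>m. coef m g) x - g x) < e"
      using LIMSEQ_D[OF expansion[OF g] e] by auto
    moreover have "psum (low n) (\<lambda>m. coef m g) \<in> Domain (multiplier w)"
      using psum_multiplier[OF finite_low low_subset] by (rule DomainI)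
    ultimately show "\<exists>f\<in>Domain (multiplier w). L2_norm \<sigma> (\<lambda>x. f x - g x) < e" by blast
  qed
  show "adjoint_op \<sigma> (multiplier w) = multiplier w"
  proof (intro equalityI subrelI)
    fix g h assume gh: "(g, h) \<in> adjoint_op \<sigma> (multiplier w)"
    have "coef m h = complex_of_real (w m) * coef m g" if m: "m \<in> I" for m
    proof -
      have "(u m, \<lambda>x. complex_of_real (w m) * u m x) \<in> multiplier w"
        using m by (auto simp: multiplier_def coef_scale coef_u)
      then have "L2_inner \<sigma> (\<lambda>x. complex_of_real (w m) * u m x) g = L2_inner \<sigma> (u m) h"
        using gh by (auto simp: adjoint_op_def)
      then show ?thesis by (simp add: coef_def L2_inner_scale_left)
    qed
    then show "(g, h) \<in> multiplier w" using gh by (auto simp: multiplier_def adjoint_op_def)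
  next
    fix g h assume gh: "(g, h) \<in> multiplier w"
    have "L2_inner \<sigma> k g = L2_inner \<sigma> f h" if fk: "(f, k) \<in> multiplier w" for f k
    proof (rule LIMSEQ_unique)
      have L2: "f \<in> L2 \<sigma>" "k \<in> L2 \<sigma>" "g \<in> L2 \<sigma>" "h \<in> L2 \<sigma>" using fk gh by (auto simp: multiplier_def)
      show "(\<lambda>n. \<Sum>m\<in>low n. coef m g * cnj (coef m k)) \<longlonglongrightarrow> L2_inner \<sigma> k g"
        by (rule parseval_inner) (rule L2)+
      have "(\<Sum>m\<in>low n. coef m h * cnj (coef m f)) = (\<Sum>m\<in>low n. coef m g * cnj (coef m k))" for n
        using fk gh low_subset[of n] by (intro sum.cong) (auto simp: multiplier_def subset_iff)
      then show "(\<lambda>n. \<Sum>m\<in>low n. coef m g * cnj (coef m k)) \<longlonglongrightarrow> L2_inner \<sigma> f h"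
        using parseval_inner[OF L2(1,4)] by simp
    qed
    then show "(g, h) \<in> adjoint_op \<sigma> (multiplier w)" using gh by (auto simp: multiplier_def adjoint_op_def)
  qed
qed

lemma operator_eq_multiplier: "\<Lambda> = multiplier ev"
proof (rule self_adjoint_maximal[OF self_adjoint self_adjoint_multiplier])
  show "\<Lambda> \<subseteq> multiplier ev"
    using self_adjoint_L2[OF self_adjoint] coef_graph by (auto simp: multiplier_def)
qed

lemma nonneg_multiplier:
  assumes "\<And>m. m \<in> I \<Longrightarrow> 0 \<le> w m" shows "nonneg_op \<sigma> (multiplier w)"
  unfolding nonneg_op_def
proof safe
  fix f k assume fk: "(f, k) \<in> multiplier w"
  then have L2: "f \<in> L2 \<sigma>" "k \<in> L2 \<sigma>" by (auto simp: multiplier_def)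
  have "(\<lambda>n. Re (\<Sum>m\<in>low n. coef m k * cnj (coef m f))) \<longlonglongrightarrow> Re (L2_inner \<sigma> f k)"
    by (intro tendsto_Re parseval_inner L2)
  moreover have "0 \<le> Re (\<Sum>m\<in>low n. coef m k * cnj (coef m f))" for n
  proof -
    have "Re (coef m k * cnj (coef m f)) = w m * (cmod (coef m f))\<^sup>2" if "m \<in> low n" for m
    proof -
      have "m \<in> I" using that low_subset by blast
      then have "coef m k * cnj (coef m f) = complex_of_real (w m) * (coef m f * cnj (coef m f))"
        using fk by (simp add: multiplier_def)
      also have "\<dots> = complex_of_real (w m * (cmod (coef m f))\<^sup>2)"
        by (simp only: complex_norm_square[symmetric] of_real_mult)
      finally show ?thesis by simp
    qed
    then show ?thesis using assms low_subset[of n] by (auto simp: Re_sum subset_iff intro!: sum_nonneg)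
  qed
  ultimately show "0 \<le> Re (L2_inner \<sigma> f k)" by (intro LIMSEQ_le_const) auto
qed

text \<open>The natural domain of the square is no smaller than that of \<Lambda>: ev m \<le> 1 +
  (ev m)^2 bounds the square sums of sqrt (ev m) * coef m f by those of f and \<Lambda> f, so the
  intermediate function exists.\<close>

lemma sqrt_multiplier_square: "multiplier (\<lambda>m. sqrt (ev m)) O multiplier (\<lambda>m. sqrt (ev m)) = \<Lambda>"
proof -
  let ?S = "multiplier (\<lambda>m. sqrt (ev m))"
  have sq: "complex_of_real (sqrt (ev m)) * (complex_of_real (sqrt (ev m)) * z) = complex_of_real (ev m) * z"
    if "m \<in> I" for m z
    using ev_nonneg[OF that] by (simp add: mult.assoc[symmetric] of_real_mult[symmetric])
  show ?thesis unfolding operator_eq_multiplier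
  proof (intro equalityI subrelI)
    fix f h assume "(f, h) \<in> ?S O ?S"
    then show "(f, h) \<in> multiplier ev" by (auto simp: multiplier_def sq)
  next
    fix f h assume fh: "(f, h) \<in> multiplier ev"
    then have L2: "f \<in> L2 \<sigma>" "h \<in> L2 \<sigma>" by (auto simp: multiplier_def)
    have "(\<Sum>m\<in>low n. (cmod (complex_of_real (sqrt (ev m)) * coef m f))\<^sup>2) \<le> (L2_norm \<sigma> f)\<^sup>2 + (L2_norm \<sigma> h)\<^sup>2" for n
    proof -
      have "(\<Sum>m\<in>low n. (cmod (complex_of_real (sqrt (ev m)) * coef m f))\<^sup>2)
          \<le> (\<Sum>m\<in>low n. (cmod (coef m f))\<^sup>2 + (cmod (coef m h))\<^sup>2)"
      proof (rule sum_mono)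
        fix m assume "m \<in> low n"
        then have m: "m \<in> I" using low_subset by blast
        have "ev m \<le> 1 + (ev m)\<^sup>2" using sum_squares_bound[of 1 "ev m"] ev_nonneg[OF m] by simp
        then have "ev m * (cmod (coef m f))\<^sup>2 \<le> (1 + (ev m)\<^sup>2) * (cmod (coef m f))\<^sup>2"
          by (rule mult_right_mono) simp
        moreover have "cmod (coef m h) = ev m * cmod (coef m f)"
          using fh m ev_nonneg[OF m] by (simp add: multiplier_def norm_mult)
        ultimately show "(cmod (complex_of_real (sqrt (ev m)) * coef m f))\<^sup>2 \<le> (cmod (coef m f))\<^sup>2 + (cmod (coef m h))\<^sup>2"
          using ev_nonneg[OF m] by (simp add: norm_mult power_mult_distrib algebra_simps)
      qed
      also have "\<dots> \<le> (L2_norm \<sigma> f)\<^sup>2 + (L2_norm \<sigma> h)\<^sup>2"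
        unfolding sum.distrib by (intro add_mono bessel finite_low low_subset L2)
      finally show ?thesis .
    qed
    then obtain g where g: "g \<in> L2 \<sigma>" "\<And>m. m \<in> I \<Longrightarrow> coef m g = complex_of_real (sqrt (ev m)) * coef m f"
      "(\<lambda>n. L2_norm \<sigma> (\<lambda>x. psum (low n) (\<lambda>m. complex_of_real (sqrt (ev m)) * coef m f) x - g x)) \<longlonglongrightarrow> 0"
      by (rule exists_coef) (rule that)
    have "(f, g) \<in> ?S" "(g, h) \<in> ?S" using g L2 fh by (auto simp: multiplier_def sq)
    then show "(f, h) \<in> ?S O ?S" by blast
  qed
qed

text \<open>With s = sqrt (ev m), the difference v = S u - s u satisfies (S + s) v = (S^2 - s^2) u =
  0, so a nonzero v would be an eigenvector for -s, which non-negativity rules out when s > 0. For s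
  = 0, |S u|^2 = <u, S^2 u> = 0.\<close>

lemma square_root_eigenfunction:
  assumes S: "self_adjoint \<sigma> S" "nonneg_op \<sigma> S" "S O S = \<Lambda>" and m: "m \<in> I"
  obtains k where "(u m, k) \<in> S" "AE x in \<sigma>. k x = complex_of_real (sqrt (ev m)) * u m x"
proof -
  define s where "s = sqrt (ev m)"
  have s: "s \<ge> 0" "s * s = ev m" using ev_nonneg[OF m] by (simp_all add: s_def)
  obtain k where k: "(u m, k) \<in> S" "(k, \<lambda>x. complex_of_real (ev m) * u m x) \<in> S"
    using u_graph[OF m] unfolding S(3)[symmetric] by auto
  define v where "v x = k x - complex_of_real s * u m x" for x
  have kL: "k \<in> L2 \<sigma>" using self_adjoint_L2[OF S(1) k(1)] by blast
  have v: "v \<in> L2 \<sigma>" unfolding v_def[abs_def] using kL m by simp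
  have "L2_norm \<sigma> v = 0"
  proof (cases "s = 0")
    case True
    then have "ev m = 0" using s by simp
    then have "L2_inner \<sigma> k k = 0" using self_adjoint_symmetric[OF S(1) k] by simp
    then have "L2_norm \<sigma> k = 0" unfolding L2_inner_self by simp
    moreover have "v = k" using True by (simp add: v_def[abs_def])
    ultimately show ?thesis by simp
  next
    case False
    then have sp: "s > 0" using s by simp
    have "(\<lambda>x. k x + (- complex_of_real s) * u m x, \<lambda>x. complex_of_real (ev m) * u m x + (- complex_of_real s) * k x) \<in> S"
      by (intro self_adjoint_add[OF S(1)] self_adjoint_scale[OF S(1)] k)
    moreover have "(\<lambda>x. k x + (- complex_of_real s) * u m x) = v" by (simp add: v_def[abs_def])
    moreover have "(\<lambda>x. complex_of_real (ev m) * u m x + (- complex_of_real s) * k x) = (\<lambda>x. (- complex_of_real s) * v x)"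
      unfolding s(2)[symmetric] by (auto simp: v_def algebra_simps)
    ultimately have "(v, \<lambda>x. (- complex_of_real s) * v x) \<in> S" by simp
    then have "0 \<le> Re (L2_inner \<sigma> v (\<lambda>x. (- complex_of_real s) * v x))"
      using S(2) by (auto simp: nonneg_op_def)
    then have "0 \<le> - (s * (L2_norm \<sigma> v)\<^sup>2)" unfolding L2_inner_scale_right L2_inner_self by simp
    then have "s * (L2_norm \<sigma> v)\<^sup>2 \<le> 0" by simp
    then show ?thesis using sp by (simp add: mult_le_0_iff)
  qed
  then have "AE x in \<sigma>. v x = 0" using L2_norm_eq_0_iff[OF v] by simp
  then have "AE x in \<sigma>. k x = complex_of_real (sqrt (ev m)) * u m x" by (simp add: v_def s_def)
  then show thesis using k(1) that by blast
qed

text \<open>Existence is needed to unfold the choice in \<open>op_sqrt\<close>. Any candidate acts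
  on the eigenfunctions as the multiplier does, so by symmetry it has the right coefficients on its
  whole domain, and maximality gives equality.\<close>

theorem op_sqrt_eq_multiplier: "op_sqrt \<sigma> \<Lambda> = multiplier (\<lambda>m. sqrt (ev m))"
proof -
  define S where "S = op_sqrt \<sigma> \<Lambda>"
  have "\<exists>S. self_adjoint \<sigma> S \<and> nonneg_op \<sigma> S \<and> S O S = \<Lambda>"
    using self_adjoint_multiplier sqrt_multiplier_square nonneg_multiplier[of "\<lambda>m. sqrt (ev m)"] ev_nonneg
    by (intro exI[of _ "multiplier (\<lambda>m. sqrt (ev m))"]) simp
  from someI_ex[OF this] have S: "self_adjoint \<sigma> S" "nonneg_op \<sigma> S" "S O S = \<Lambda>"
    unfolding S_def op_sqrt_def by auto
  have "S \<subseteq> multiplier (\<lambda>m. sqrt (ev m))"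
  proof (rule subrelI)
    fix f g assume fg: "(f, g) \<in> S"
    have L2: "f \<in> L2 \<sigma>" "g \<in> L2 \<sigma>" using self_adjoint_L2[OF S(1) fg] by auto
    have "coef m g = complex_of_real (sqrt (ev m)) * coef m f" if m: "m \<in> I" for m
    proof -
      obtain k where k: "(u m, k) \<in> S" "AE x in \<sigma>. k x = complex_of_real (sqrt (ev m)) * u m x"
        by (rule square_root_eigenfunction[OF S m])
      have "coef m g = L2_inner \<sigma> k f" using self_adjoint_symmetric[OF S(1) k(1) fg] by (simp add: coef_def)
      also have "\<dots> = L2_inner \<sigma> (\<lambda>x. complex_of_real (sqrt (ev m)) * u m x) f"
        using k(2) L2 self_adjoint_L2[OF S(1) k(1)] L2_scale[OF u_L2[OF m]]
        by (intro L2_inner_cong_AE) (auto intro: L2_measurable)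
      finally show ?thesis by (simp add: L2_inner_scale_left coef_def)
    qed
    then show "(f, g) \<in> multiplier (\<lambda>m. sqrt (ev m))" using L2 by (simp add: multiplier_def)
  qed
  then show ?thesis using self_adjoint_maximal[OF S(1) self_adjoint_multiplier] by (simp add: S_def)
qed

end

subsection \<open>Test functions on rays\<close>

definition smooth_punctured :: "('a::euclidean_space \<Rightarrow> complex) \<Rightarrow> bool" where
  "smooth_punctured \<phi> \<longleftrightarrow> (\<forall>k. Ck_on k (- {0}) \<phi>)"

definition partial :: "'a::euclidean_space \<Rightarrow> ('a \<Rightarrow> complex) \<Rightarrow> 'a \<Rightarrow> complex" where
  "partial v \<phi> x = frechet_derivative \<phi> (at x) v"

lemma smooth_punctured_partial: "smooth_punctured \<phi> \<Longrightarrow> smooth_punctured (partial v \<phi>)"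
  unfolding smooth_punctured_def partial_def[abs_def] by (metis Ck_on.simps(2))

lemma smooth_punctured_differentiable: "smooth_punctured \<phi> \<Longrightarrow> x \<noteq> 0 \<Longrightarrow> \<phi> differentiable at x"
  unfolding smooth_punctured_def by (metis Ck_on.simps(2) ComplI singletonD)

lemma smooth_punctured_continuous: "smooth_punctured \<phi> \<Longrightarrow> continuous_on (- {0}) \<phi>"
  unfolding smooth_punctured_def by (metis Ck_on.simps(1))

lemma has_derivative_partial:
  assumes "smooth_punctured \<phi>" "x \<noteq> 0"
  shows "(\<phi> has_derivative (\<lambda>v. \<Sum>i\<in>Basis. (v \<bullet> i) *\<^sub>R partial i \<phi> x)) (at x)"
proof -
  have D: "(\<phi> has_derivative frechet_derivative \<phi> (at x)) (at x)"
    using smooth_punctured_differentiable[OF assms] by (simp add: frechet_derivative_works)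
  then have lin: "linear (frechet_derivative \<phi> (at x))"
    by (rule has_derivative_linear)
  have "frechet_derivative \<phi> (at x) v = (\<Sum>i\<in>Basis. (v \<bullet> i) *\<^sub>R partial i \<phi> x)" for v
  proof -
    have "frechet_derivative \<phi> (at x) v = frechet_derivative \<phi> (at x) (\<Sum>i\<in>Basis. (v \<bullet> i) *\<^sub>R i)"
      by (simp only: euclidean_representation)
    also have "\<dots> = (\<Sum>i\<in>Basis. (v \<bullet> i) *\<^sub>R partial i \<phi> x)"
      by (simp add: linear_sum[OF lin] linear_scale[OF lin] partial_def)
    finally show ?thesis .
  qed
  then have "frechet_derivative \<phi> (at x) = (\<lambda>v. \<Sum>i\<in>Basis. (v \<bullet> i) *\<^sub>R partial i \<phi> x)" by (rule ext)
  with D show ?thesis by simp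
qed

text \<open>The derivative at x in direction w, spelled out in coordinates: for smooth
  \<open>\<phi>\<close> it is jointly continuous in w and x, and it is a sum of products of w
  \<bullet> i with partial derivatives, which can be differentiated again under an integral over
  w.\<close>

definition ray_deriv :: "('a::euclidean_space \<Rightarrow> complex) \<Rightarrow> 'a \<Rightarrow> 'a \<Rightarrow> complex" where
  "ray_deriv \<phi> w x = (\<Sum>i\<in>Basis. (w \<bullet> i) *\<^sub>R partial i \<phi> x)"

lemma has_vector_derivative_ray:
  assumes "smooth_punctured \<phi>" "r *\<^sub>R w \<noteq> 0"
  shows "((\<lambda>s. \<phi> (s *\<^sub>R w)) has_vector_derivative ray_deriv \<phi> w (r *\<^sub>R w)) (at r)"
proof -
  have "((\<lambda>s. s *\<^sub>R w) has_derivative (\<lambda>h. h *\<^sub>R w)) (at r)"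
    by (rule bounded_linear_imp_has_derivative) (rule bounded_linear_scaleR_left)
  from has_derivative_compose[OF this has_derivative_partial[OF assms]]
  have "((\<lambda>s. \<phi> (s *\<^sub>R w)) has_derivative (\<lambda>h. \<Sum>i\<in>Basis. ((h *\<^sub>R w) \<bullet> i) *\<^sub>R partial i \<phi> (r *\<^sub>R w))) (at r)" .
  then show ?thesis
    unfolding has_vector_derivative_def ray_deriv_def
    by (rule has_derivative_eq_rhs) (simp add: scaleR_sum_right fun_eq_iff)
qed

lemma continuous_on_ray_deriv:
  assumes "smooth_punctured \<phi>" "continuous_on S f" "continuous_on S g" "\<And>x. x \<in> S \<Longrightarrow> g x \<noteq> 0"
  shows "continuous_on S (\<lambda>x. ray_deriv \<phi> (f x) (g x))"
  unfolding ray_deriv_def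
  by (intro continuous_intros assms continuous_on_compose2[OF smooth_punctured_continuous[OF smooth_punctured_partial[OF assms(1)]]])
    (use assms(4) in auto)

lemma radial_deriv_eq:
  assumes "smooth_punctured \<phi>" "x \<noteq> 0"
  shows "radial_deriv \<phi> x = ray_deriv \<phi> (sgn x) x"
proof -
  have x: "norm x *\<^sub>R sgn x = x" using assms(2) by (simp add: sgn_div_norm)
  have "((\<lambda>s. \<phi> (s *\<^sub>R sgn x)) has_vector_derivative ray_deriv \<phi> (sgn x) (norm x *\<^sub>R sgn x)) (at (norm x))"
    by (rule has_vector_derivative_ray[OF assms(1)]) (use assms(2) in \<open>simp add: x\<close>)
  then show ?thesis unfolding radial_deriv_def x by (rule vector_derivative_at)
qed

lemma radial_deriv_twice_eq:
  assumes \<phi>: "smooth_punctured \<phi>" and x: "x \<noteq> 0"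
  shows "radial_deriv (radial_deriv \<phi>) x = (\<Sum>i\<in>Basis. (sgn x \<bullet> i) *\<^sub>R ray_deriv (partial i \<phi>) (sgn x) x)"
proof -
  have xx: "norm x *\<^sub>R sgn x = x" using x by (simp add: sgn_div_norm)
  have "((\<lambda>s. \<Sum>i\<in>Basis. (sgn x \<bullet> i) *\<^sub>R partial i \<phi> (s *\<^sub>R sgn x)) has_vector_derivative
      (\<Sum>i\<in>Basis. (sgn x \<bullet> i) *\<^sub>R ray_deriv (partial i \<phi>) (sgn x) (norm x *\<^sub>R sgn x))) (at (norm x))"
    by (intro has_vector_derivative_sum bounded_linear.has_vector_derivative[OF bounded_linear_scaleR_right]
        has_vector_derivative_ray smooth_punctured_partial \<phi>) (use x in \<open>simp add: xx\<close>)
  then have "((\<lambda>s. radial_deriv \<phi> (s *\<^sub>R sgn x)) has_vector_derivative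
      (\<Sum>i\<in>Basis. (sgn x \<bullet> i) *\<^sub>R ray_deriv (partial i \<phi>) (sgn x) (norm x *\<^sub>R sgn x))) (at (norm x))"
  proof (rule has_vector_derivative_transform_within_open[where S = "{0<..}"])
    fix s :: real assume "s \<in> {0<..}"
    moreover have "sgn (sgn x) = sgn x" using x by (simp add: sgn_div_norm)
    ultimately have "sgn (s *\<^sub>R sgn x) = sgn x" "s *\<^sub>R sgn x \<noteq> 0" using x by (auto simp: sgn_scaleR sgn_zero_iff)
    then show "(\<Sum>i\<in>Basis. (sgn x \<bullet> i) *\<^sub>R partial i \<phi> (s *\<^sub>R sgn x)) = radial_deriv \<phi> (s *\<^sub>R sgn x)"
      by (simp add: radial_deriv_eq[OF \<phi>] ray_deriv_def)
  qed (use x in auto)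
  then show ?thesis unfolding radial_deriv_def[of "radial_deriv \<phi>"] xx by (rule vector_derivative_at)
qed

lemma continuous_on_radial_deriv:
  assumes "smooth_punctured \<phi>" shows "continuous_on (- {0}) (radial_deriv \<phi>)"
proof -
  have "continuous_on (- {0}) (\<lambda>x. ray_deriv \<phi> (sgn x) x)"
    unfolding sgn_div_norm by (intro continuous_on_ray_deriv assms continuous_intros) auto
  then show ?thesis by (rule continuous_on_eq) (use radial_deriv_eq[OF assms] in auto)
qed

lemma borel_measurable_radial_deriv:
  assumes "smooth_punctured \<phi>" shows "radial_deriv \<phi> \<in> borel_measurable borel"
  by (rule borel_measurable_continuous_countable_exceptions[of "{0}"])
    (simp_all add: continuous_on_radial_deriv assms)

lemma sphere_continuous_measurable:
  "continuous_on (sphere 0 1) f \<Longrightarrow> f \<in> borel_measurable (sphere_measure :: 'a::euclidean_space measure)"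
  using borel_measurable_continuous_on_restrict[of "sphere 0 1" f]
  by (simp add: measurable_cong_sets[OF sets_sphere_measure refl])

lemma sphere_continuous_bounded:
  assumes "continuous_on (sphere 0 1 :: 'a::euclidean_space set) (f :: 'a \<Rightarrow> 'b::real_normed_vector)"
  obtains C where "\<And>w. w \<in> sphere 0 1 \<Longrightarrow> norm (f w) \<le> C"
proof -
  have "compact (f ` sphere 0 1)" by (rule compact_continuous_image[OF assms compact_sphere])
  then show thesis using that unfolding bounded_iff[symmetric] by (metis bounded_iff compact_imp_bounded imageI)
qed

lemma sphere_continuous_L2:
  assumes "continuous_on (sphere 0 1 :: 'a::euclidean_space set) (f :: 'a \<Rightarrow> complex)"
  shows "f \<in> L2 sphere_measure"
proof -
  obtain C where C: "\<And>w. w \<in> sphere 0 1 \<Longrightarrow> norm (f w) \<le> C" by (rule sphere_continuous_bounded[OF assms]) blast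
  have 1: "(\<lambda>w. 1) \<in> L2 (sphere_measure :: 'a measure)" by (simp add: L2_def)
  show ?thesis by (rule L2_dominated[OF sphere_continuous_measurable[OF assms] 1, of C]) (simp add: C)
qed

lemma integrable_mult_continuous:
  assumes g: "integrable sphere_measure (g :: 'a::euclidean_space \<Rightarrow> complex)"
    and f: "continuous_on (sphere 0 1) f"
  shows "integrable sphere_measure (\<lambda>w. g w * f w)"
proof -
  obtain C where C: "\<And>w. w \<in> sphere 0 1 \<Longrightarrow> norm (f w) \<le> C" by (rule sphere_continuous_bounded[OF f]) blast
  have [measurable]: "f \<in> borel_measurable sphere_measure" by (rule sphere_continuous_measurable[OF f])
  have [measurable]: "g \<in> borel_measurable sphere_measure" using g by simp
  have "integrable sphere_measure (\<lambda>w. C *\<^sub>R g w)" using g by simp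
  then show ?thesis
  proof (rule Bochner_Integration.integrable_bound)
    show "AE w in sphere_measure. norm (g w * f w) \<le> norm (C *\<^sub>R g w)"
    proof (rule AE_I2)
      fix w :: 'a assume "w \<in> space sphere_measure"
      then have "norm (f w) \<le> \<bar>C\<bar>" using C[of w] by simp
      then have "norm (g w) * norm (f w) \<le> norm (g w) * \<bar>C\<bar>" by (rule mult_left_mono) simp
      then show "norm (g w * f w) \<le> norm (C *\<^sub>R g w)" by (simp add: norm_mult mult.commute)
    qed
  qed measurable
qed

text \<open>\<open>g\<close> will be a conjugated eigenfunction, possibly times coordinates of w. It
  is merely integrable, so all regularity in r has to come from \<open>\<phi>\<close>.\<close>

definition angular_integral :: "('a::euclidean_space \<Rightarrow> complex) \<Rightarrow> ('a \<Rightarrow> complex) \<Rightarrow> real \<Rightarrow> complex" where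
  "angular_integral g \<phi> r = (\<integral>w. g w * \<phi> (r *\<^sub>R w) \<partial>sphere_measure)"

lemma continuous_on_slice:
  assumes "smooth_punctured \<phi>" "r \<noteq> 0" shows "continuous_on (sphere 0 1) (\<lambda>w. \<phi> (r *\<^sub>R w))"
  by (rule continuous_on_compose2[OF smooth_punctured_continuous[OF assms(1)]])
    (use assms(2) in \<open>auto intro!: continuous_intros\<close>)

text \<open>Difference quotients are the form to which dominated convergence along sequences
  applies.\<close>

lemma has_vector_derivative_iff_quotient:
  "(f has_vector_derivative D) (at r) \<longleftrightarrow> ((\<lambda>s. (1 / (s - r)) *\<^sub>R (f s - f r)) \<longlongrightarrow> D) (at r)"
proof -
  have eq: "norm (f s - f r - (s - r) *\<^sub>R D) / norm (s - r) = norm ((1 / (s - r)) *\<^sub>R (f s - f r) - D)" if "s \<noteq> r" for s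
  proof -
    have "(1 / (s - r)) *\<^sub>R (f s - f r) - D = (1 / (s - r)) *\<^sub>R (f s - f r - (s - r) *\<^sub>R D)"
      using that by (simp add: scaleR_diff_right)
    then show ?thesis by (simp only: norm_scaleR) simp
  qed
  have "(f has_vector_derivative D) (at r) \<longleftrightarrow> ((\<lambda>s. norm (f s - f r - (s - r) *\<^sub>R D) / norm (s - r)) \<longlongrightarrow> 0) (at r)"
    unfolding has_vector_derivative_def has_derivative_iff_norm by (simp add: bounded_linear_scaleR_left)
  also have "\<dots> \<longleftrightarrow> ((\<lambda>s. norm ((1 / (s - r)) *\<^sub>R (f s - f r) - D)) \<longlongrightarrow> 0) (at r)"
    by (rule Lim_cong_within) (use eq in auto)
  also have "\<dots> \<longleftrightarrow> ((\<lambda>s. (1 / (s - r)) *\<^sub>R (f s - f r)) \<longlongrightarrow> D) (at r)"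
    unfolding tendsto_norm_zero_iff LIM_zero_iff ..
  finally show ?thesis .
qed

text \<open>Differentiation under the integral sign. For radii in the compact interval [r/2, 2r] the
  ray derivative is bounded by some C over the sphere, so by the mean value inequality C |g|
  dominates the difference quotients.\<close>

lemma angular_integral_deriv:
  assumes \<phi>: "smooth_punctured \<phi>" and g: "integrable sphere_measure (g :: 'a::euclidean_space \<Rightarrow> complex)" and r: "r > 0"
  shows "(angular_integral g \<phi> has_vector_derivative (\<integral>w. g w * ray_deriv \<phi> w (r *\<^sub>R w) \<partial>sphere_measure)) (at r)"
  unfolding has_vector_derivative_iff_quotient tendsto_at_iff_sequentially
proof (intro allI impI)
  fix X :: "nat \<Rightarrow> real" assume "\<forall>i. X i \<in> UNIV - {r}" and X: "X \<longlonglongrightarrow> r"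
  then have Xr: "X i \<noteq> r" for i by auto
  define J where "J = {r/2..2*r}"
  have nz: "s *\<^sub>R w \<noteq> 0" if "s \<in> J" "w \<in> sphere 0 1" for s and w :: 'a using that r by (auto simp: J_def)
  have "compact ((\<lambda>p. ray_deriv \<phi> (snd p) (fst p *\<^sub>R snd p)) ` (J \<times> sphere (0::'a) 1))"
    by (intro compact_continuous_image compact_Times continuous_on_ray_deriv \<phi> continuous_intros)
      (auto simp: J_def dest: nz[unfolded J_def])
  then have "bounded ((\<lambda>p. ray_deriv \<phi> (snd p) (fst p *\<^sub>R snd p)) ` (J \<times> sphere (0::'a) 1))"
    by (rule compact_imp_bounded)
  then obtain C where "\<forall>z\<in>(\<lambda>p. ray_deriv \<phi> (snd p) (fst p *\<^sub>R snd p)) ` (J \<times> sphere (0::'a) 1). norm z \<le> C"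
    unfolding bounded_iff by blast
  then have C: "norm (ray_deriv \<phi> w (s *\<^sub>R w)) \<le> C" if "s \<in> J" "w \<in> sphere (0::'a) 1" for s w
    using that by force
  have "\<forall>\<^sub>F i in sequentially. X i \<in> {r/2<..<2*r}"
    by (rule topological_tendstoD[OF X]) (use r in auto)
  then obtain N where N: "\<And>i. i \<ge> N \<Longrightarrow> X i \<in> {r/2<..<2*r}" unfolding eventually_sequentially by blast
  \<comment> \<open>The radii are known to lie in [r/2, 2r] only from index N on; the shift by N is
    undone at the end.\<close>
  have XJ: "X (i + N) \<in> J" for i using N[of "i + N"] by (auto simp: J_def)
  have rJ: "r \<in> J" using r by (simp add: J_def)
  define q where "q i w = g w * ((1 / (X (i + N) - r)) *\<^sub>R (\<phi> (X (i + N) *\<^sub>R w) - \<phi> (r *\<^sub>R w)))" for i w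
  have [measurable]: "g \<in> borel_measurable sphere_measure" using g by simp
  have slice [measurable]: "(\<lambda>w. \<phi> (s *\<^sub>R w)) \<in> borel_measurable sphere_measure" if "s \<in> J" for s
    using that r by (intro sphere_continuous_measurable continuous_on_slice[OF \<phi>]) (auto simp: J_def)
  have "(\<lambda>i. \<integral>w. q i w \<partial>sphere_measure) \<longlonglongrightarrow> (\<integral>w. g w * ray_deriv \<phi> w (r *\<^sub>R w) \<partial>sphere_measure)"
  proof (rule integral_dominated_convergence[where w = "\<lambda>w. C * norm (g w)"])
    have "(\<lambda>w. ray_deriv \<phi> w (r *\<^sub>R w)) \<in> borel_measurable (sphere_measure :: 'a measure)"
      by (intro sphere_continuous_measurable continuous_on_ray_deriv \<phi> continuous_intros) (use nz rJ in auto)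
    then show "(\<lambda>w. g w * ray_deriv \<phi> w (r *\<^sub>R w)) \<in> borel_measurable sphere_measure" by measurable
    show "q i \<in> borel_measurable sphere_measure" for i
      unfolding q_def using slice[OF XJ] slice[OF rJ] by measurable
    show "integrable sphere_measure (\<lambda>w. C * norm (g w))" using g by simp
    show "AE w in sphere_measure. (\<lambda>i. q i w) \<longlonglongrightarrow> g w * ray_deriv \<phi> w (r *\<^sub>R w)"
    proof (rule AE_I2)
      fix w :: 'a assume "w \<in> space sphere_measure"
      then have w: "r *\<^sub>R w \<noteq> 0" using nz rJ by auto
      have "((\<lambda>s. (1 / (s - r)) *\<^sub>R (\<phi> (s *\<^sub>R w) - \<phi> (r *\<^sub>R w))) \<longlongrightarrow> ray_deriv \<phi> w (r *\<^sub>R w)) (at r)"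
        using has_vector_derivative_ray[OF \<phi> w] unfolding has_vector_derivative_iff_quotient .
      moreover have "\<forall>i. X (i + N) \<in> UNIV - {r}" using Xr by auto
      ultimately have "(\<lambda>i. (1 / (X (i + N) - r)) *\<^sub>R (\<phi> (X (i + N) *\<^sub>R w) - \<phi> (r *\<^sub>R w))) \<longlonglongrightarrow> ray_deriv \<phi> w (r *\<^sub>R w)"
        using LIMSEQ_ignore_initial_segment[OF X, of N] unfolding tendsto_at_iff_sequentially by (fastforce simp: comp_def)
      then show "(\<lambda>i. q i w) \<longlonglongrightarrow> g w * ray_deriv \<phi> w (r *\<^sub>R w)"
        unfolding q_def by (intro tendsto_intros)
    qed
    show "AE w in sphere_measure. norm (q i w) \<le> C * norm (g w)" for i
    proof (rule AE_I2)
      fix w :: 'a assume "w \<in> space sphere_measure"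
      then have w: "w \<in> sphere 0 1" by simp
      have "norm (\<phi> (X (i + N) *\<^sub>R w) - \<phi> (r *\<^sub>R w)) \<le> C * norm (X (i + N) - r)"
      proof (rule differentiable_bound[of J "\<lambda>s. \<phi> (s *\<^sub>R w)" "\<lambda>s h. h *\<^sub>R ray_deriv \<phi> w (s *\<^sub>R w)"])
        fix s assume s: "s \<in> J"
        show "((\<lambda>s. \<phi> (s *\<^sub>R w)) has_derivative (\<lambda>h. h *\<^sub>R ray_deriv \<phi> w (s *\<^sub>R w))) (at s within J)"
          using has_vector_derivative_ray[OF \<phi> nz[OF s w]]
          by (simp add: has_vector_derivative_def has_derivative_at_withinI)
        have "C \<ge> 0" using C[OF s w] norm_ge_zero order_trans by blast
        then show "onorm (\<lambda>h. h *\<^sub>R ray_deriv \<phi> w (s *\<^sub>R w)) \<le> C"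
          using C[OF s w] by (intro onorm_bound) (auto simp: mult.commute[of C] intro: mult_left_mono)
      qed (use XJ rJ in \<open>auto simp: J_def\<close>)
      moreover have "\<bar>X (i + N) - r\<bar> > 0" using Xr[of "i + N"] by simp
      ultimately have "norm ((1 / (X (i + N) - r)) *\<^sub>R (\<phi> (X (i + N) *\<^sub>R w) - \<phi> (r *\<^sub>R w))) \<le> C"
        by (simp add: divide_le_eq)
      then show "norm (q i w) \<le> C * norm (g w)"
        unfolding q_def norm_mult by (subst mult.commute) (rule mult_right_mono, auto)
    qed
  qed
  moreover have "(\<integral>w. q i w \<partial>sphere_measure) = (1 / (X (i + N) - r)) *\<^sub>R (angular_integral g \<phi> (X (i + N)) - angular_integral g \<phi> r)" for i
  proof -
    have int: "integrable sphere_measure (\<lambda>w. g w * \<phi> (s *\<^sub>R w))" if "s \<in> J" for s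
      using that r by (intro integrable_mult_continuous g continuous_on_slice \<phi>) (auto simp: J_def)
    have "q i = (\<lambda>w. (1 / (X (i + N) - r)) *\<^sub>R (g w * \<phi> (X (i + N) *\<^sub>R w) - g w * \<phi> (r *\<^sub>R w)))"
      by (simp add: q_def fun_eq_iff right_diff_distrib)
    then show ?thesis
      using int[OF XJ] int[OF rJ] by (simp add: angular_integral_def)
  qed
  ultimately have "(\<lambda>i. (1 / (X (i + N) - r)) *\<^sub>R (angular_integral g \<phi> (X (i + N)) - angular_integral g \<phi> r))
      \<longlonglongrightarrow> (\<integral>w. g w * ray_deriv \<phi> w (r *\<^sub>R w) \<partial>sphere_measure)" by simp
  then show "((\<lambda>s. (1 / (s - r)) *\<^sub>R (angular_integral g \<phi> s - angular_integral g \<phi> r)) \<circ> X)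
      \<longlonglongrightarrow> (\<integral>w. g w * ray_deriv \<phi> w (r *\<^sub>R w) \<partial>sphere_measure)"
    unfolding comp_def by (rule LIMSEQ_offset)
qed

subsection \<open>The constant and the angular modes\<close>

text \<open>\<open>LEAST\<close> on the reals is meaningful only if a minimum is attained. A finite
  nonempty sublevel set supplies it as a \<open>Min\<close>.\<close>

lemma Least_le_of_finite_sublevels:
  fixes S :: "real set"
  assumes s: "s \<in> S" and fin: "finite {x\<in>S. x \<le> s}"
  shows "(LEAST c. c \<in> S) \<le> s"
proof -
  let ?T = "{x\<in>S. x \<le> s}"
  have T: "s \<in> ?T" using s by simp
  have "Min ?T \<in> ?T" using fin T by (intro Min_in) auto
  moreover have "Min ?T \<le> y" if "y \<in> S" for y
  proof (cases "y \<le> s")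
    case True
    then show ?thesis using that fin by (intro Min_le) auto
  next
    case False
    then show ?thesis using Min_le[OF fin T] by simp
  qed
  ultimately have "(LEAST c. c \<in> S) = Min ?T" by (intro Least_equality) auto
  then show ?thesis using Min_le[OF fin T] by simp
qed

lemma min_over_le:
  assumes "m \<in> A" "finite {n\<in>A. f n \<le> f m}"
  shows "min_over A f \<le> f m"
  unfolding min_over_def
proof (rule Least_le_of_finite_sublevels)
  have "{x \<in> f ` A. x \<le> f m} = f ` {n\<in>A. f n \<le> f m}" by auto
  then show "finite {x \<in> f ` A. x \<le> f m}" using assms(2) by simp
qed (use assms(1) in auto)

text \<open>The two bounds are the hypotheses on the constant in the radial inequality. For \<beta>
  nonzero most of the work is attainment: the quotients grow linearly in the eigenvalue, so their
  sublevel sets are finite and the minimum exists.\<close>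

lemma (in discrete_operator) hardy_rellich_const_le:
  fixes \<alpha> :: real and n :: nat
  defines "\<beta> \<equiv> (real n - \<alpha> - 4) / 2" and "\<gamma> \<equiv> (real n + \<alpha>) / 2"
    and "K \<equiv> hardy_rellich_const n \<alpha> I ev"
  assumes m: "m \<in> I"
  shows "K * (ev m + \<beta>\<^sup>2) \<le> (ev m + \<beta> * \<gamma>)\<^sup>2 \<and> K \<le> 2 * ev m + \<beta>\<^sup>2 + \<gamma>\<^sup>2"
proof (cases "\<beta> = 0")
  case False
  define f where "f m = (ev m + \<beta> * \<gamma>)\<^sup>2 / (ev m + \<beta>\<^sup>2)" for m
  have nz: "real n - \<alpha> - 4 = 2 * \<beta>" "real n + \<alpha> = 2 * \<gamma>" by (simp_all add: \<beta>_def \<gamma>_def)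
  have "(4 * ev m + (real n + \<alpha>) * (real n - \<alpha> - 4))\<^sup>2 / (4 * (4 * ev m + (real n - \<alpha> - 4)\<^sup>2)) = f m" for m
  proof -
    have "(4 * ev m + (real n + \<alpha>) * (real n - \<alpha> - 4))\<^sup>2 = 16 * (ev m + \<beta> * \<gamma>)\<^sup>2"
      unfolding nz by (simp add: power2_eq_square algebra_simps)
    moreover have "4 * (4 * ev m + (real n - \<alpha> - 4)\<^sup>2) = 16 * (ev m + \<beta>\<^sup>2)"
      unfolding nz by (simp add: power2_eq_square)
    ultimately show ?thesis unfolding f_def by (simp only:) (rule mult_divide_mult_cancel_left, simp)
  qed
  then have K: "K = min_over I f"
    using False nz(1) by (simp add: K_def hardy_rellich_const_def)
  have pos: "ev k + \<beta>\<^sup>2 > 0" if "k \<in> I" for k using ev_nonneg[OF that] False by (simp add: add_nonneg_pos)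
  have "finite {k\<in>I. f k \<le> f m}"
  proof (rule finite_subset)
    \<comment> \<open>For an eigenvalue e beyond the three thresholds, e + \<beta>\<gamma> \<ge>
      e/2, the denominator is at most 2e, and (e/2)^2 \<le> 2e f m would give e \<le> 8 f m.\<close>
    define B where "B = max (2 * \<bar>\<beta> * \<gamma>\<bar>) (max (\<beta>\<^sup>2) (8 * f m))"
    show "{k\<in>I. f k \<le> f m} \<subseteq> {k\<in>I. \<bar>ev k\<bar> \<le> B}"
    proof safe
      fix k assume k: "k \<in> I" "f k \<le> f m"
      note e = ev_nonneg[OF k(1)]
      show "\<bar>ev k\<bar> \<le> B"
      proof (rule ccontr)
        assume "\<not> \<bar>ev k\<bar> \<le> B"
        then have b: "ev k > 2 * \<bar>\<beta> * \<gamma>\<bar>" "ev k > \<beta>\<^sup>2" "ev k > 8 * f m" using e by (auto simp: B_def)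
        have f0: "f m \<ge> 0" using pos[OF m] by (simp add: f_def)
        have "ev k / 2 \<le> ev k + \<beta> * \<gamma>" using b(1) by linarith
        then have "(ev k / 2)\<^sup>2 \<le> (ev k + \<beta> * \<gamma>)\<^sup>2" using e by (intro power_mono) auto
        also have "\<dots> = f k * (ev k + \<beta>\<^sup>2)" using pos[OF k(1)] by (simp add: f_def)
        also have "\<dots> \<le> f m * (ev k + ev k)" using k(2) f0 b(2) pos[OF k(1)] by (intro mult_mono) auto
        finally have "ev k * ev k \<le> ev k * (8 * f m)" by (simp add: power2_eq_square algebra_simps)
        moreover have "ev k > 0" using b(1) by linarith
        ultimately show False using b(3) by simp
      qed
    qed
    show "finite {k\<in>I. \<bar>ev k\<bar> \<le> B}" using discrete_spectrum by (auto simp: purely_discrete_spectrum_def)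
  qed
  then have "K \<le> f m" unfolding K by (rule min_over_le[OF m])
  then have 1: "K * (ev m + \<beta>\<^sup>2) \<le> (ev m + \<beta> * \<gamma>)\<^sup>2" using pos[OF m] by (simp add: f_def field_simps)
  \<comment> \<open>Cauchy-Schwarz for the vectors (sqrt (ev m), \<beta>) and (sqrt (ev m),
    \<gamma>); it yields the second bound from the first.\<close>
  also have "(ev m + \<beta> * \<gamma>)\<^sup>2 \<le> (ev m + \<gamma>\<^sup>2) * (ev m + \<beta>\<^sup>2)"
  proof -
    have "0 \<le> ev m * (\<beta> - \<gamma>)\<^sup>2" using ev_nonneg[OF m] by simp
    then show ?thesis by (simp add: power2_eq_square algebra_simps)
  qed
  finally have "K \<le> ev m + \<gamma>\<^sup>2" using pos[OF m] by simp
  moreover have "ev m + \<gamma>\<^sup>2 \<le> 2 * ev m + \<beta>\<^sup>2 + \<gamma>\<^sup>2" using ev_nonneg[OF m] by simp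
  ultimately show ?thesis using 1 by linarith
next
  case True
  then have \<alpha>: "real n - \<alpha> - 4 = 0" by (simp add: \<beta>_def)
  then have K: "K = min ((real n - 2)\<^sup>2) (min_over {m\<in>I. ev m \<noteq> 0} ev)"
    by (simp add: K_def hardy_rellich_const_def)
  have \<gamma>: "\<gamma> = real n - 2" using \<alpha> by (simp add: \<gamma>_def)
  show ?thesis
  proof (cases "ev m = 0")
    \<comment> \<open>For a zero eigenvalue the first bound reads 0 \<le> 0, and the term (n - 2)^2
      = \<gamma>^2 of the constant provides the second.\<close>
    case True
    then show ?thesis using \<open>\<beta> = 0\<close> K \<gamma> by simp
  next
    case False
    have "finite {k\<in>{k\<in>I. ev k \<noteq> 0}. ev k \<le> ev m}"
    proof (rule finite_subset)
      show "{k\<in>{k\<in>I. ev k \<noteq> 0}. ev k \<le> ev m} \<subseteq> {k\<in>I. \<bar>ev k\<bar> \<le> ev m}" using ev_nonneg by auto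
      show "finite {k\<in>I. \<bar>ev k\<bar> \<le> ev m}" using discrete_spectrum by (auto simp: purely_discrete_spectrum_def)
    qed
    then have "min_over {m\<in>I. ev m \<noteq> 0} ev \<le> ev m" using m False by (intro min_over_le) auto
    then have le: "K \<le> ev m" using K by simp
    then have "K * ev m \<le> ev m * ev m" using ev_nonneg[OF m] by (intro mult_right_mono)
    moreover have "K \<le> 2 * ev m + \<gamma>\<^sup>2" using le ev_nonneg[OF m] zero_le_power2[of \<gamma>] by linarith
    ultimately show ?thesis using \<open>\<beta> = 0\<close> by (simp add: power2_eq_square)
  qed
qed

section \<open>Angular modes and their radial derivatives\<close>

lemma sgn_scaleR_unit: "r > 0 \<Longrightarrow> norm w = 1 \<Longrightarrow> sgn (r *\<^sub>R w) = (w :: 'a::euclidean_space)"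
  by (simp add: sgn_scaleR) (simp add: sgn_div_norm)

text \<open>Splitting the direction w into coordinates absorbs them into the weight and leaves the
  smooth functions \<open>partial i \<phi>\<close>, so that \<open>angular_integral_deriv\<close>
  applies once more and yields the second derivative of a mode.\<close>

lemma angular_integral_ray:
  assumes \<phi>: "smooth_punctured \<phi>" and g: "integrable sphere_measure (g :: 'a::euclidean_space \<Rightarrow> complex)" and r: "r > 0"
  shows "(\<integral>w. g w * ray_deriv \<phi> w (r *\<^sub>R w) \<partial>sphere_measure)
    = (\<Sum>i\<in>Basis. angular_integral (\<lambda>w. g w * complex_of_real (w \<bullet> i)) (partial i \<phi>) r)"
proof -
  have "integrable sphere_measure (\<lambda>w. (g w * complex_of_real (w \<bullet> i)) * partial i \<phi> (r *\<^sub>R w))" for i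
    using r by (intro integrable_mult_continuous g continuous_on_slice smooth_punctured_partial \<phi> continuous_intros) auto
  moreover have "g w * ray_deriv \<phi> w (r *\<^sub>R w) = (\<Sum>i\<in>Basis. (g w * complex_of_real (w \<bullet> i)) * partial i \<phi> (r *\<^sub>R w))" for w
    by (simp add: ray_deriv_def sum_distrib_left scaleR_conv_of_real mult.assoc)
  ultimately show ?thesis by (simp add: angular_integral_def)
qed

lemma integrable_mult_coordinate:
  "integrable sphere_measure (g :: 'a::euclidean_space \<Rightarrow> complex) \<Longrightarrow> integrable sphere_measure (\<lambda>w. g w * complex_of_real (w \<bullet> i))"
  by (intro integrable_mult_continuous continuous_intros)

context discrete_operator
begin

definition mode :: "'i \<Rightarrow> ('a \<Rightarrow> complex) \<Rightarrow> real \<Rightarrow> complex" where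
  "mode m \<phi> r = coef m (angular_slice \<phi> r)"

lemma mode_eq_angular_integral: "mode m \<phi> = angular_integral (\<lambda>w. cnj (u m w)) \<phi>"
  by (simp add: mode_def[abs_def] coef_def L2_inner_def angular_integral_def[abs_def] angular_slice_def)

lemma integrable_cnj_u: "m \<in> I \<Longrightarrow> integrable \<sigma> (\<lambda>w. cnj (u m w))"
  using L2_inner_integrable[OF u_L2 sphere_continuous_L2[of "\<lambda>_. 1"]] by simp

lemma mode_radial_deriv:
  assumes "smooth_punctured \<phi>" "r > 0"
  shows "mode m (radial_deriv \<phi>) r = (\<integral>w. cnj (u m w) * ray_deriv \<phi> w (r *\<^sub>R w) \<partial>\<sigma>)"
  unfolding mode_eq_angular_integral angular_integral_def
proof (rule Bochner_Integration.integral_cong[OF refl])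
  fix w :: 'a assume "w \<in> space \<sigma>"
  then have "sgn (r *\<^sub>R w) = w" "r *\<^sub>R w \<noteq> 0" using assms(2) by (auto simp: sgn_scaleR_unit)
  then show "cnj (u m w) * radial_deriv \<phi> (r *\<^sub>R w) = cnj (u m w) * ray_deriv \<phi> w (r *\<^sub>R w)"
    using radial_deriv_eq[OF assms(1), of "r *\<^sub>R w"] by simp
qed

lemma mode_radial_deriv_twice:
  assumes "smooth_punctured \<phi>" "r > 0" "m \<in> I"
  shows "mode m (radial_deriv (radial_deriv \<phi>)) r
    = (\<Sum>i\<in>Basis. \<integral>w. (cnj (u m w) * complex_of_real (w \<bullet> i)) * ray_deriv (partial i \<phi>) w (r *\<^sub>R w) \<partial>\<sigma>)"
proof -
  have "mode m (radial_deriv (radial_deriv \<phi>)) r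
      = (\<integral>w. (\<Sum>i\<in>Basis. (cnj (u m w) * complex_of_real (w \<bullet> i)) * ray_deriv (partial i \<phi>) w (r *\<^sub>R w)) \<partial>\<sigma>)"
    unfolding mode_eq_angular_integral angular_integral_def
  proof (rule Bochner_Integration.integral_cong[OF refl])
    fix w :: 'a assume "w \<in> space \<sigma>"
    then have "sgn (r *\<^sub>R w) = w" "r *\<^sub>R w \<noteq> 0" using assms(2) by (auto simp: sgn_scaleR_unit)
    then show "cnj (u m w) * radial_deriv (radial_deriv \<phi>) (r *\<^sub>R w)
        = (\<Sum>i\<in>Basis. (cnj (u m w) * complex_of_real (w \<bullet> i)) * ray_deriv (partial i \<phi>) w (r *\<^sub>R w))"
      using radial_deriv_twice_eq[OF assms(1), of "r *\<^sub>R w"]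
      by (simp add: sum_distrib_left scaleR_conv_of_real mult.assoc)
  qed
  also have "\<dots> = (\<Sum>i\<in>Basis. \<integral>w. (cnj (u m w) * complex_of_real (w \<bullet> i)) * ray_deriv (partial i \<phi>) w (r *\<^sub>R w) \<partial>\<sigma>)"
    using assms(2) by (intro Bochner_Integration.integral_sum integrable_mult_continuous integrable_mult_coordinate
        integrable_cnj_u assms(3) continuous_on_ray_deriv smooth_punctured_partial assms(1) continuous_intros) auto
  finally show ?thesis .
qed

lemma mode_deriv:
  assumes "smooth_punctured \<phi>" "r > 0" "m \<in> I"
  shows "(mode m \<phi> has_vector_derivative mode m (radial_deriv \<phi>) r) (at r)"
  unfolding mode_radial_deriv[OF assms(1,2)] unfolding mode_eq_angular_integral
  by (rule angular_integral_deriv[OF assms(1) integrable_cnj_u[OF assms(3)] assms(2)])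

lemma mode_deriv_twice:
  assumes "smooth_punctured \<phi>" "r > 0" "m \<in> I"
  shows "(mode m (radial_deriv \<phi>) has_vector_derivative mode m (radial_deriv (radial_deriv \<phi>)) r) (at r)"
proof (rule has_vector_derivative_transform_within_open[where S = "{0<..}"])
  show "((\<lambda>r. \<Sum>i\<in>Basis. angular_integral (\<lambda>w. cnj (u m w) * complex_of_real (w \<bullet> i)) (partial i \<phi>) r)
      has_vector_derivative mode m (radial_deriv (radial_deriv \<phi>)) r) (at r)"
    unfolding mode_radial_deriv_twice[OF assms]
    by (intro has_vector_derivative_sum angular_integral_deriv smooth_punctured_partial assms
        integrable_mult_coordinate integrable_cnj_u)
  show "(\<Sum>i\<in>Basis. angular_integral (\<lambda>w. cnj (u m w) * complex_of_real (w \<bullet> i)) (partial i \<phi>) s) = mode m (radial_deriv \<phi>) s"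
    if "s \<in> {0<..}" for s
    using that angular_integral_ray[OF assms(1) integrable_cnj_u[OF assms(3)], of s] mode_radial_deriv[OF assms(1), of s] by simp
qed (use assms in auto)

text \<open>Expanded into second partial derivatives, the function is a sum of integrals that are
  again differentiable in r. Continuity is what the fundamental theorem of calculus in the radial
  inequality demands.\<close>

lemma continuous_on_mode_deriv_twice:
  assumes "smooth_punctured \<phi>" "m \<in> I"
  shows "continuous_on {0<..} (mode m (radial_deriv (radial_deriv \<phi>)))"
proof -
  let ?g = "\<lambda>i j w. cnj (u m w) * complex_of_real (w \<bullet> i) * complex_of_real (w \<bullet> j)"
  have "continuous_on {0<..} (angular_integral (?g i j) (partial j (partial i \<phi>)))" for i j
  proof (intro continuous_at_imp_continuous_on ballI)
    fix r :: real assume "r \<in> {0<..}"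
    then have "r > 0" by simp
    show "isCont (angular_integral (?g i j) (partial j (partial i \<phi>))) r"
      by (rule has_vector_derivative_continuous, rule angular_integral_deriv)
        (intro smooth_punctured_partial assms integrable_mult_coordinate integrable_cnj_u \<open>r > 0\<close>)+
  qed
  then have "continuous_on {0<..} (\<lambda>r. \<Sum>i\<in>Basis. \<Sum>j\<in>Basis. angular_integral (?g i j) (partial j (partial i \<phi>)) r)"
    by (intro continuous_on_sum)
  then show ?thesis
  proof (rule continuous_on_eq)
    fix r :: real assume "r \<in> {0<..}"
    then have r: "r > 0" by simp
    show "(\<Sum>i\<in>Basis. \<Sum>j\<in>Basis. angular_integral (?g i j) (partial j (partial i \<phi>)) r) = mode m (radial_deriv (radial_deriv \<phi>)) r"
      unfolding mode_radial_deriv_twice[OF assms(1) r assms(2)]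
      using angular_integral_ray[OF smooth_punctured_partial[OF assms(1)] integrable_mult_coordinate[OF integrable_cnj_u[OF assms(2)]] r]
      by simp
  qed
qed

end

subsection \<open>The radial inequality\<close>

text \<open>The comparison of symbols is carried out pointwise, without a transform: L - K R is 1/r
  times a combination of |b|^2, |Db|^2 and |D^2 b|^2 with coefficients P^2 - K (e + \<beta>^2), 2P +
  \<kappa>^2 - K and 1, plus the derivative of a function G that vanishes off the support. The
  hypotheses on K say that the coefficients are nonnegative.\<close>

lemma hardy_rellich_radial:
  fixes a a1 a2 :: "real \<Rightarrow> complex" and d e \<alpha> K p q :: real
  defines "\<beta> \<equiv> (d - \<alpha> - 4) / 2" and "\<gamma> \<equiv> (d + \<alpha>) / 2"
  assumes a: "\<And>r. r > 0 \<Longrightarrow> (a has_vector_derivative a1 r) (at r)"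
    and a1: "\<And>r. r > 0 \<Longrightarrow> (a1 has_vector_derivative a2 r) (at r)"
    and a2: "continuous_on {0<..} a2"
    and pq: "0 < p" "p < q" and supp: "\<And>r. 0 < r \<Longrightarrow> r < p \<or> q < r \<Longrightarrow> a r = 0"
    and K: "0 \<le> K" "K * (e + \<beta>\<^sup>2) \<le> (e + \<beta> * \<gamma>)\<^sup>2" "K \<le> 2 * e + \<beta>\<^sup>2 + \<gamma>\<^sup>2" and e: "e \<ge> 0"
  shows "ennreal K * (\<integral>\<^sup>+r. indicator {0<..} r * ennreal (r powr (d - 3 - \<alpha>) * ((cmod (a1 r))\<^sup>2 + e * (cmod (a r))\<^sup>2 / r\<^sup>2)) \<partial>lborel)
    \<le> (\<integral>\<^sup>+r. indicator {0<..} r * ennreal (r powr (d - 1 - \<alpha>) *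
          (cmod (- a2 r - complex_of_real ((d - 1) / r) * a1 r + complex_of_real (e / r\<^sup>2) * a r))\<^sup>2) \<partial>lborel)"
proof -
  define L where "L r = r powr (d - 1 - \<alpha>) *
      (cmod (- a2 r - complex_of_real ((d - 1) / r) * a1 r + complex_of_real (e / r\<^sup>2) * a r))\<^sup>2" for r
  define R where "R r = r powr (d - 3 - \<alpha>) * ((cmod (a1 r))\<^sup>2 + e * (cmod (a r))\<^sup>2 / r\<^sup>2)" for r
  define P where "P = e + \<beta> * \<gamma>"
  define \<kappa> where "\<kappa> = \<gamma> - \<beta>"
  \<comment> \<open>\<open>b1\<close> and \<open>b2\<close> are Db and D^2 b. The power \<beta> is
    the one for which both sides become integrals against dr/r with constant coefficients.\<close>
  define b where "b r = r powr \<beta> *\<^sub>R a r" for r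
  define b1 where "b1 r = r powr \<beta> *\<^sub>R (r *\<^sub>R a1 r + \<beta> *\<^sub>R a r)" for r
  define b2 where "b2 r = r powr \<beta> *\<^sub>R (r\<^sup>2 *\<^sub>R a2 r + ((2 * \<beta> + 1) * r) *\<^sub>R a1 r + \<beta>\<^sup>2 *\<^sub>R a r)" for r
  \<comment> \<open>Primitive of the cross terms. D <b, Db> = |Db|^2 + <b, D^2 b> trades -2P <b, D^2
    b> for 2P |Db|^2, while 2 <b, Db> and 2 <Db, D^2 b> are D |b|^2 and D |Db|^2.\<close>
  define G where "G r = - 2 * P * inner (b r) (b1 r) + (K * \<beta> - P * \<kappa>) * inner (b r) (b r) + \<kappa> * inner (b1 r) (b1 r)" for r
  define G' where "G' r = (1 / r) * (- 2 * P * (inner (b1 r) (b1 r) + inner (b r) (b2 r))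
      + 2 * (K * \<beta> - P * \<kappa>) * inner (b r) (b1 r) + 2 * \<kappa> * inner (b1 r) (b2 r))" for r
  have db: "(b has_vector_derivative (1 / r) *\<^sub>R b1 r) (at r)" if r: "r > 0" for r
  proof -
    have "((\<lambda>r. r powr \<beta>) has_real_derivative \<beta> * r powr (\<beta> - 1)) (at r)"
      using r by (rule has_real_derivative_powr)
    from has_vector_derivative_scaleR[OF this a[OF r]]
    have "(b has_vector_derivative r powr \<beta> *\<^sub>R a1 r + (\<beta> * r powr (\<beta> - 1)) *\<^sub>R a r) (at r)"
      by (simp add: b_def[abs_def])
    moreover have "r powr \<beta> *\<^sub>R a1 r + (\<beta> * r powr (\<beta> - 1)) *\<^sub>R a r = (1 / r) *\<^sub>R b1 r"
      using r by (simp add: b1_def powr_diff scaleR_add_right)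
    ultimately show ?thesis by simp
  qed
  have db1: "(b1 has_vector_derivative (1 / r) *\<^sub>R b2 r) (at r)" if r: "r > 0" for r
  proof -
    have "((\<lambda>r. r powr \<beta>) has_real_derivative \<beta> * r powr (\<beta> - 1)) (at r)"
      using r by (rule has_real_derivative_powr)
    moreover have "((\<lambda>r. r *\<^sub>R a1 r + \<beta> *\<^sub>R a r) has_vector_derivative (r *\<^sub>R a2 r + 1 *\<^sub>R a1 r) + \<beta> *\<^sub>R a1 r) (at r)"
      by (intro has_vector_derivative_add has_vector_derivative_scaleR a1[OF r] DERIV_ident
          bounded_linear.has_vector_derivative[OF bounded_linear_scaleR_right] a[OF r])
    ultimately have "(b1 has_vector_derivative r powr \<beta> *\<^sub>R ((r *\<^sub>R a2 r + 1 *\<^sub>R a1 r) + \<beta> *\<^sub>R a1 r)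
        + (\<beta> * r powr (\<beta> - 1)) *\<^sub>R (r *\<^sub>R a1 r + \<beta> *\<^sub>R a r)) (at r)"
      unfolding b1_def[abs_def] by (rule has_vector_derivative_scaleR)
    moreover have "r powr \<beta> *\<^sub>R ((r *\<^sub>R a2 r + 1 *\<^sub>R a1 r) + \<beta> *\<^sub>R a1 r)
        + (\<beta> * r powr (\<beta> - 1)) *\<^sub>R (r *\<^sub>R a1 r + \<beta> *\<^sub>R a r) = (1 / r) *\<^sub>R b2 r"
      using r by (simp add: b2_def powr_diff algebra_simps power2_eq_square) (simp add: scaleR_conv_of_real)
    ultimately show ?thesis by simp
  qed
  have dG: "(G has_vector_derivative G' r) (at r)" if r: "r > 0" for r
  proof -
    note ip = bounded_bilinear.has_vector_derivative[OF bounded_bilinear_inner]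
    have "(G has_vector_derivative
        - 2 * P * (inner (b r) ((1 / r) *\<^sub>R b2 r) + inner ((1 / r) *\<^sub>R b1 r) (b1 r))
        + (K * \<beta> - P * \<kappa>) * (inner (b r) ((1 / r) *\<^sub>R b1 r) + inner ((1 / r) *\<^sub>R b1 r) (b r))
        + \<kappa> * (inner (b1 r) ((1 / r) *\<^sub>R b2 r) + inner ((1 / r) *\<^sub>R b2 r) (b1 r))) (at r)"
      unfolding G_def[abs_def]
      by (intro has_vector_derivative_add has_vector_derivative_mult_right ip db[OF r] db1[OF r])
    then show ?thesis by (rule has_vector_derivative_eq_rhs) (use r in \<open>simp add: G'_def inner_commute field_simps\<close>)
  qed
  have main: "L r - K * R r = (1 / r) * ((P\<^sup>2 - K * (e + \<beta>\<^sup>2)) * (cmod (b r))\<^sup>2 + (cmod (b2 r))\<^sup>2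
      + (2 * P + \<kappa>\<^sup>2 - K) * (cmod (b1 r))\<^sup>2) + G' r" if r: "r > 0" for r
  proof -
    have e1: "P *\<^sub>R b r - b2 r - \<kappa> *\<^sub>R b1 r = (r powr \<beta> * r\<^sup>2) *\<^sub>R
        (- a2 r - complex_of_real ((d - 1) / r) * a1 r + complex_of_real (e / r\<^sup>2) * a r)"
    proof -
      \<comment> \<open>Conjugation with \<open>r powr \<beta>\<close> turns r^2 times the radial
        operator into P - D^2 - \<kappa> D; the coefficients match once d and P are expressed
        through \<beta> and \<kappa>.\<close>
      have x: "d = 2 * \<beta> + 2 + \<kappa>" by (simp add: \<kappa>_def \<beta>_def \<gamma>_def field_simps)
      have y: "P = e + \<beta> * \<beta> + \<kappa> * \<beta>" by (simp add: \<kappa>_def P_def algebra_simps)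
      show ?thesis unfolding x y using r
        by (simp add: b_def b1_def b2_def complex_eq_iff field_simps power2_eq_square)
    qed
    have e2: "b1 r - \<beta> *\<^sub>R b r = (r powr \<beta> * r) *\<^sub>R a1 r"
      by (simp add: b_def b1_def algebra_simps)
    have w: "r powr (d - 1 - \<alpha>) = (1 / r) * (r powr \<beta> * r\<^sup>2)\<^sup>2" "r powr (d - 3 - \<alpha>) = (1 / r) * (r powr \<beta> * r)\<^sup>2"
    proof -
      have x: "d - 1 - \<alpha> = 2 * \<beta> + 3" "d - 3 - \<alpha> = 2 * \<beta> + 1" by (simp_all add: \<beta>_def field_simps)
      have "2 * \<beta> = \<beta> + \<beta>" by simp
      then have y: "r powr (2 * \<beta>) = (r powr \<beta>)\<^sup>2" by (simp only: powr_add power2_eq_square)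
      have "r powr (2 * \<beta> + 3) = (r powr \<beta>)\<^sup>2 * r ^ 3" "r powr (2 * \<beta> + 1) = (r powr \<beta>)\<^sup>2 * r"
        unfolding powr_add y using r by simp_all
      then show "r powr (d - 1 - \<alpha>) = (1 / r) * (r powr \<beta> * r\<^sup>2)\<^sup>2" "r powr (d - 3 - \<alpha>) = (1 / r) * (r powr \<beta> * r)\<^sup>2"
        unfolding x using r by (simp_all only: power_mult_distrib) (simp_all add: power2_eq_square power3_eq_cube)
    qed
    have "L r = (1 / r) * (cmod (P *\<^sub>R b r - b2 r - \<kappa> *\<^sub>R b1 r))\<^sup>2"
      unfolding e1 norm_scaleR L_def w by (simp add: power_mult_distrib)
    moreover have "R r = (1 / r) * ((cmod (b1 r - \<beta> *\<^sub>R b r))\<^sup>2 + e * (cmod (b r))\<^sup>2)"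
      unfolding e2 norm_scaleR R_def w using r by (simp add: power_mult_distrib b_def field_simps)
    ultimately have "L r - K * R r = (1 / r) * ((cmod (P *\<^sub>R b r - b2 r - \<kappa> *\<^sub>R b1 r))\<^sup>2
        - K * ((cmod (b1 r - \<beta> *\<^sub>R b r))\<^sup>2 + e * (cmod (b r))\<^sup>2))"
      by (simp only: right_diff_distrib mult.left_commute)
    also have "(cmod (P *\<^sub>R b r - b2 r - \<kappa> *\<^sub>R b1 r))\<^sup>2 - K * ((cmod (b1 r - \<beta> *\<^sub>R b r))\<^sup>2 + e * (cmod (b r))\<^sup>2)
      = ((P\<^sup>2 - K * (e + \<beta>\<^sup>2)) * (cmod (b r))\<^sup>2 + (cmod (b2 r))\<^sup>2 + (2 * P + \<kappa>\<^sup>2 - K) * (cmod (b1 r))\<^sup>2)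
        + (- 2 * P * (inner (b1 r) (b1 r) + inner (b r) (b2 r))
      + 2 * (K * \<beta> - P * \<kappa>) * inner (b r) (b1 r) + 2 * \<kappa> * inner (b1 r) (b2 r))"
      unfolding cmod_power2 inner_complex_def by (simp add: power2_eq_square algebra_simps)
    finally show ?thesis by (simp only: G'_def distrib_left)
  qed
  have zero: "a r = 0 \<and> a1 r = 0 \<and> a2 r = 0" if r: "r \<in> {0<..<p} \<union> {q<..}" for r
  proof -
    have op: "open ({0<..<p} \<union> {q<..})" by auto
    have r0: "s > 0" if "s \<in> {0<..<p} \<union> {q<..}" for s using that pq by auto
    have za: "a s = 0" if "s \<in> {0<..<p} \<union> {q<..}" for s using supp[OF r0[OF that]] that by auto
    have za1: "a1 s = 0" if s: "s \<in> {0<..<p} \<union> {q<..}" for s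
    proof -
      have "((\<lambda>_. 0) has_vector_derivative a1 s) (at s)"
        by (rule has_vector_derivative_transform_within_open[OF a[OF r0[OF s]] op s za])
      from vector_derivative_unique_at[OF this has_vector_derivative_const] show ?thesis .
    qed
    have "((\<lambda>_. 0) has_vector_derivative a2 r) (at r)"
      by (rule has_vector_derivative_transform_within_open[OF a1[OF r0[OF r]] op r za1])
    from vector_derivative_unique_at[OF this has_vector_derivative_const] have "a2 r = 0" .
    with za[OF r] za1[OF r] show ?thesis by simp
  qed
  \<comment> \<open>Wider than [p, q] on both sides, so that the end points lie in the open set
    where a and its derivatives vanish; G is zero there and the fundamental theorem leaves no
    boundary term.\<close>
  define J where "J = {p/2..2*q}"
  have Jpos: "r > 0" if "r \<in> J" for r using that pq by (auto simp: J_def)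
  have J0: "J \<subseteq> {0<..}" using Jpos by auto
  have cont: "continuous_on J a" "continuous_on J a1" "continuous_on J a2"
    using a a1 Jpos continuous_on_subset[OF a2 J0]
    by (auto intro!: continuous_at_imp_continuous_on has_vector_derivative_continuous)
  have ne: "r \<noteq> 0" if "r \<in> J" for r using Jpos[OF that] by simp
  have contL: "continuous_on J L" unfolding L_def[abs_def]
    by (intro continuous_intros cont) (auto dest: ne)
  have contR: "continuous_on J R" unfolding R_def[abs_def]
    by (intro continuous_intros cont) (auto dest: ne)
  have cb: "continuous_on J b" "continuous_on J b1" "continuous_on J b2"
    unfolding b_def[abs_def] b1_def[abs_def] b2_def[abs_def]
    by (intro continuous_intros cont; auto dest: ne)+
  have contG': "continuous_on J G'" unfolding G'_def[abs_def]
    by (intro continuous_intros cb) (auto dest: ne)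
  have intL: "integrable lborel (\<lambda>r. indicator J r *\<^sub>R L r)" and intR: "integrable lborel (\<lambda>r. indicator J r *\<^sub>R R r)"
    using borel_integrable_compact[OF _ contL] borel_integrable_compact[OF _ contR] by (auto simp: J_def)
  have z1: "a (p/2) = 0" "a1 (p/2) = 0" and z2: "a (2*q) = 0" "a1 (2*q) = 0"
    using zero[of "p/2"] zero[of "2*q"] pq by simp_all
  have "G (p/2) = 0" "G (2*q) = 0"
    unfolding G_def b_def b1_def z1 z2 by simp_all
  moreover have "has_bochner_integral lborel (\<lambda>r. indicator {p/2..2*q} r *\<^sub>R G' r) (G (2*q) - G (p/2))"
  proof (rule has_bochner_integral_FTC_Icc)
    show "(G has_vector_derivative G' r) (at r within {p/2..2*q})" if "p/2 \<le> r" "r \<le> 2*q" for r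
      by (rule has_vector_derivative_at_within[OF dG]) (use that pq in auto)
    show "continuous_on {p/2..2*q} G'" using contG' by (simp add: J_def)
  qed (use pq in auto)
  ultimately have intG: "has_bochner_integral lborel (\<lambda>r. indicator J r *\<^sub>R G' r) 0" by (simp add: J_def)
  have "0 \<le> (\<integral>r. indicator J r *\<^sub>R L r - K * (indicator J r *\<^sub>R R r) - indicator J r *\<^sub>R G' r \<partial>lborel)"
  proof (rule Bochner_Integration.integral_nonneg)
    fix r
    show "0 \<le> indicator J r *\<^sub>R L r - K * (indicator J r *\<^sub>R R r) - indicator J r *\<^sub>R G' r"
    proof (cases "r \<in> J")
      case True
      have "0 \<le> (1 / r) * ((P\<^sup>2 - K * (e + \<beta>\<^sup>2)) * (cmod (b r))\<^sup>2 + (cmod (b2 r))\<^sup>2 + (2 * P + \<kappa>\<^sup>2 - K) * (cmod (b1 r))\<^sup>2)"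
      proof -
        have "2 * P + \<kappa>\<^sup>2 = 2 * e + \<beta>\<^sup>2 + \<gamma>\<^sup>2" by (simp add: P_def \<kappa>_def power2_eq_square algebra_simps)
        then show ?thesis using K(2,3) Jpos[OF True] unfolding P_def[symmetric]
          by (intro mult_nonneg_nonneg add_nonneg_nonneg) auto
      qed
      then show ?thesis using main[OF Jpos[OF True]] True by simp
    qed simp
  qed
  also have "\<dots> = (\<integral>r. indicator J r *\<^sub>R L r \<partial>lborel) - K * (\<integral>r. indicator J r *\<^sub>R R r \<partial>lborel) - (\<integral>r. indicator J r *\<^sub>R G' r \<partial>lborel)"
    using intL intR intG by (simp add: has_bochner_integral_iff)
  also have "(\<integral>r. indicator J r *\<^sub>R G' r \<partial>lborel) = 0" using intG by (simp add: has_bochner_integral_iff)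
  finally have fin: "K * (\<integral>r. indicator J r *\<^sub>R R r \<partial>lborel) \<le> (\<integral>r. indicator J r *\<^sub>R L r \<partial>lborel)" by simp
  have L0: "0 \<le> L r" and R0: "0 \<le> R r" for r using e by (auto simp: L_def R_def)
  have out: "r \<in> {0<..<p} \<union> {q<..}" if "r > 0" "r \<notin> J" for r using that pq by (auto simp: J_def)
  have eqL: "indicator {0<..} r * ennreal (L r) = ennreal (indicator J r *\<^sub>R L r)" for r
    using zero[OF out, of r] Jpos[of r] by (cases "r \<in> J"; cases "r > 0") (auto simp: L_def)
  have eqR: "indicator {0<..} r * ennreal (R r) = ennreal (indicator J r *\<^sub>R R r)" for r
    using zero[OF out, of r] Jpos[of r] by (cases "r \<in> J"; cases "r > 0") (auto simp: R_def)
  have "ennreal K * (\<integral>\<^sup>+r. indicator {0<..} r * ennreal (R r) \<partial>lborel) = ennreal (K * (\<integral>r. indicator J r *\<^sub>R R r \<partial>lborel))"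
    unfolding eqR using intR R0 K(1) by (subst nn_integral_eq_integral) (auto simp: ennreal_mult)
  also have "\<dots> \<le> ennreal (\<integral>r. indicator J r *\<^sub>R L r \<partial>lborel)" by (rule ennreal_leI[OF fin])
  also have "\<dots> = (\<integral>\<^sup>+r. indicator {0<..} r * ennreal (L r) \<partial>lborel)"
    unfolding eqL using intL L0 by (subst nn_integral_eq_integral) auto
  finally show ?thesis unfolding L_def R_def .
qed

subsection \<open>Test functions in the domain\<close>

lemma measurable_sphere_id: "(\<lambda>w. w) \<in> borel_measurable (sphere_measure :: 'a::euclidean_space measure)"
  by (simp add: measurable_cong_sets[OF sets_sphere_measure refl] measurable_restrict_space1)

lemma angular_slice_measurable:
  assumes "f \<in> borel_measurable borel" shows "angular_slice f r \<in> borel_measurable sphere_measure"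
  unfolding angular_slice_def
  by (intro measurable_compose[OF _ assms] borel_measurable_scaleR measurable_sphere_id) simp

lemma angular_slice_pair_measurable:
  assumes "f \<in> borel_measurable borel"
  shows "(\<lambda>p. f (fst p *\<^sub>R snd p)) \<in> borel_measurable (borel \<Otimes>\<^sub>M (sphere_measure :: 'a::euclidean_space measure))"
  by (intro measurable_compose[OF _ assms] borel_measurable_scaleR measurable_fst
      measurable_compose[OF measurable_snd measurable_sphere_id])

lemma L2_compactly_supported:
  fixes f :: "'a::euclidean_space \<Rightarrow> complex"
  assumes "compact S" "continuous_on S f"
  shows "(\<lambda>x. indicator S x *\<^sub>R f x) \<in> L2 lborel"
proof -
  have "integrable lborel (\<lambda>x. indicator S x *\<^sub>R f x)" by (rule borel_integrable_compact[OF assms])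
  then have "(\<lambda>x. indicator S x *\<^sub>R f x) \<in> borel_measurable lborel" by simp
  moreover have "integrable lborel (\<lambda>x. indicator S x *\<^sub>R (cmod (f x))\<^sup>2)"
    by (intro borel_integrable_compact assms continuous_intros)
  moreover have "indicator S x *\<^sub>R (cmod (f x))\<^sup>2 = (cmod (indicator S x *\<^sub>R f x))\<^sup>2" for x
    by (auto split: split_indicator)
  ultimately show ?thesis by (simp add: L2_def)
qed

lemma borel_measurable_indicator_ennreal:
  assumes "continuous_on {0<..} (h :: real \<Rightarrow> real)"
  shows "(\<lambda>r. indicator {0<..} r * ennreal (h r)) \<in> borel_measurable borel"
proof -
  have "(\<lambda>r. indicator {0<..} r *\<^sub>R h r) \<in> borel_measurable borel"
    by (rule borel_measurable_continuous_on_indicator[OF _ assms]) simp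
  then have "(\<lambda>r. ennreal (indicator {0<..} r *\<^sub>R h r)) \<in> borel_measurable borel" by measurable
  moreover have "ennreal (indicator {0<..} r *\<^sub>R h r) = indicator {0<..} r * ennreal (h r)" for r
    by (auto split: split_indicator)
  ultimately show ?thesis by simp
qed

lemma continuous_on_radial_deriv_twice:
  assumes "smooth_punctured \<phi>" shows "continuous_on (- {0}) (radial_deriv (radial_deriv \<phi>))"
proof -
  have "continuous_on (- {0}) (\<lambda>x. \<Sum>i\<in>Basis. (sgn x \<bullet> i) *\<^sub>R ray_deriv (partial i \<phi>) (sgn x) x)"
    unfolding sgn_div_norm
    by (intro continuous_on_sum continuous_on_scaleR continuous_on_ray_deriv smooth_punctured_partial assms continuous_intros) auto
  then show ?thesis by (rule continuous_on_eq) (use radial_deriv_twice_eq[OF assms] in auto)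
qed

lemma continuous_on_radial_op:
  assumes "smooth_punctured \<phi>" shows "continuous_on (- {0}) (radial_op \<phi>)"
  unfolding radial_op_def[abs_def]
  by (intro continuous_intros continuous_on_radial_deriv continuous_on_radial_deriv_twice assms) auto

lemma angular_slice_L2:
  assumes "continuous_on (- {0}) f" "r > 0"
  shows "angular_slice f r \<in> L2 (sphere_measure :: 'a::euclidean_space measure)"
  unfolding angular_slice_def
  by (intro sphere_continuous_L2 continuous_on_compose2[OF assms(1)] continuous_intros) (use assms(2) in auto)

lemma test_function_annulus:
  fixes \<psi> :: "'a::euclidean_space \<Rightarrow> complex"
  assumes "\<psi> \<in> test_functions (- {0})"
  obtains p q where "0 < p" "p < q" "\<And>x. \<psi> x \<noteq> 0 \<Longrightarrow> p \<le> norm x \<and> norm x \<le> q"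
proof -
  let ?T = "closure {x. \<psi> x \<noteq> 0}"
  have T: "compact ?T" "0 \<notin> ?T" using assms by (auto simp: test_functions_def)
  obtain C where C: "\<And>x. x \<in> ?T \<Longrightarrow> norm x \<le> C"
    using compact_imp_bounded[OF T(1)] unfolding bounded_iff by blast
  have "open (- ?T)" by (rule open_Compl) (rule closed_closure)
  moreover have "0 \<in> - ?T" using T(2) by blast
  ultimately obtain p where p: "p > 0" "ball 0 p \<subseteq> - ?T" by (rule openE)
  show thesis
  proof (rule that[of p "max p C + 1"])
    fix x assume "\<psi> x \<noteq> 0"
    then have x: "x \<in> ?T" by (intro subsetD[OF closure_subset]) simp
    then have "x \<notin> ball 0 p" using p(2) by blast
    then have "p \<le> norm x" by simp
    then show "p \<le> norm x \<and> norm x \<le> max p C + 1" using C[OF x] by linarith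
  qed (use p(1) in auto)
qed

abbreviation polar_weight :: "nat \<Rightarrow> real \<Rightarrow> ennreal" where
  "polar_weight d r \<equiv> indicator {0<..} r * ennreal (r ^ (d - 1))"

locale dom_function = discrete_operator \<Lambda> I ev u
  for \<Lambda> :: "('a::euclidean_space \<Rightarrow> complex) rel" and I :: "'i set" and ev :: "'i \<Rightarrow> real" and u :: "'i \<Rightarrow> 'a \<Rightarrow> complex" +
  fixes \<psi> :: "'a \<Rightarrow> complex"
  assumes dom: "\<psi> \<in> dom_calL \<Lambda>"
begin

lemma test_function: "\<psi> \<in> test_functions (- {0})"
  using dom by (simp add: dom_calL_def)

lemma smooth: "smooth_punctured \<psi>"
  using test_function by (simp add: test_functions_def smooth_punctured_def)

lemma angular_version: "angular_version \<Lambda> \<psi> (angular_op \<Lambda> \<psi>)"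
proof -
  have "\<exists>w. angular_version \<Lambda> \<psi> w" using dom by (simp add: dom_calL_def)
  then show ?thesis unfolding angular_op_def by (rule someI_ex)
qed

lemma angular_op_graph:
  "AE r in lborel. 0 < r \<longrightarrow> (angular_slice \<psi> r, angular_slice (angular_op \<Lambda> \<psi>) r) \<in> \<Lambda>"
  using angular_version by (simp add: angular_version_def)

lemma calL_L2: "calL \<Lambda> \<psi> \<in> L2 lborel"
  using dom by (simp add: dom_calL_def)

lemma psi_slice_L2: "r > 0 \<Longrightarrow> angular_slice \<psi> r \<in> L2 \<sigma>"
  by (rule angular_slice_L2[OF smooth_punctured_continuous[OF smooth]])

lemma continuous_on_mode: "m \<in> I \<Longrightarrow> continuous_on {0<..} (mode m \<psi>)"
  by (intro continuous_at_imp_continuous_on ballI has_vector_derivative_continuous[OF mode_deriv[OF smooth]]) auto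

lemma continuous_on_mode_deriv: "m \<in> I \<Longrightarrow> continuous_on {0<..} (mode m (radial_deriv \<psi>))"
  by (intro continuous_at_imp_continuous_on ballI has_vector_derivative_continuous[OF mode_deriv_twice[OF smooth]]) auto

lemma mode_eq_0:
  assumes "\<And>w. norm w = 1 \<Longrightarrow> \<psi> (r *\<^sub>R w) = 0" shows "mode m \<psi> r = 0"
proof -
  have "mode m \<psi> r = L2_inner \<sigma> (u m) (\<lambda>_. 0)"
    unfolding mode_def coef_def L2_inner_def angular_slice_def
    using assms by (intro Bochner_Integration.integral_cong) auto
  then show ?thesis by simp
qed

text \<open>The share of the m-th mode in the squared norm, over the whole space and without a
  weight in |x|, of the square root of \<Lambda> applied to \<psi>.\<close>

definition energy :: "'i \<Rightarrow> ennreal" where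
  "energy m = (\<integral>\<^sup>+r. polar_weight DIM('a) r * ennreal (ev m * (cmod (mode m \<psi> r))\<^sup>2) \<partial>lborel)"

lemma weight_measurable:
  assumes "continuous_on {0<..} h"
  shows "(\<lambda>r. polar_weight DIM('a) r * ennreal (h r)) \<in> borel_measurable borel"
proof -
  have [measurable]: "(\<lambda>r. indicator {0<..} r * ennreal (h r)) \<in> borel_measurable borel"
    by (rule borel_measurable_indicator_ennreal[OF assms])
  have "(\<lambda>r. ennreal (r ^ (DIM('a) - 1)) * (indicator {0<..} r * ennreal (h r))) \<in> borel_measurable borel"
    by measurable
  then show ?thesis by (simp only: mult_ac)
qed

lemma sum_energy:
  assumes "finite F" "F \<subseteq> I"
  shows "(\<Sum>m\<in>F. energy m) = (\<integral>\<^sup>+r. polar_weight DIM('a) r * ennreal (\<Sum>m\<in>F. ev m * (cmod (mode m \<psi> r))\<^sup>2) \<partial>lborel)"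
proof -
  have "(\<Sum>m\<in>F. energy m) = (\<integral>\<^sup>+r. (\<Sum>m\<in>F. polar_weight DIM('a) r * ennreal (ev m * (cmod (mode m \<psi> r))\<^sup>2)) \<partial>lborel)"
    unfolding energy_def
  proof (rule nn_integral_sum[symmetric])
    fix m assume "m \<in> F"
    then have "m \<in> I" using assms(2) by blast
    then have "continuous_on {0<..} (\<lambda>r. ev m * (cmod (mode m \<psi> r))\<^sup>2)"
      by (intro continuous_intros continuous_on_mode)
    then show "(\<lambda>r. polar_weight DIM('a) r * ennreal (ev m * (cmod (mode m \<psi> r))\<^sup>2)) \<in> borel_measurable lborel"
      unfolding measurable_lborel2 by (rule weight_measurable)
  qed
  also have "\<dots> = (\<integral>\<^sup>+r. polar_weight DIM('a) r * ennreal (\<Sum>m\<in>F. ev m * (cmod (mode m \<psi> r))\<^sup>2) \<partial>lborel)"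
  proof (rule nn_integral_cong)
    fix r
    have "(\<Sum>m\<in>F. ennreal (ev m * (cmod (mode m \<psi> r))\<^sup>2)) = ennreal (\<Sum>m\<in>F. ev m * (cmod (mode m \<psi> r))\<^sup>2)"
      using assms(2) ev_nonneg by (intro sum_ennreal) auto
    then show "(\<Sum>m\<in>F. polar_weight DIM('a) r * ennreal (ev m * (cmod (mode m \<psi> r))\<^sup>2)) = polar_weight DIM('a) r * ennreal (\<Sum>m\<in>F. ev m * (cmod (mode m \<psi> r))\<^sup>2)"
      by (simp only: sum_distrib_left[symmetric])
  qed
  finally show ?thesis .
qed

text \<open>On the annulus containing the support, \<open>\<Lambda>\<psi> = r\<^sup>2 (\<L>\<psi> - L\<^sub>r \<psi>)\<close> is square integrable, and
  \<open>ev m \<le> 1 + (ev m)\<^sup>2\<close>.\<close>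

lemma sum_energy_bounded:
  obtains K where "K < \<infinity>" "\<And>F. finite F \<Longrightarrow> F \<subseteq> I \<Longrightarrow> (\<Sum>m\<in>F. energy m) \<le> K"
proof -
  obtain p q where pq: "0 < p" "p < q" and supp: "\<And>x. \<psi> x \<noteq> 0 \<Longrightarrow> p \<le> norm x \<and> norm x \<le> q"
    by (rule test_function_annulus[OF test_function]) (rule that)
  define S where "S = cball (0::'a) q - ball 0 p"
  have S: "compact S" "S \<subseteq> - {0}" using pq by (auto simp: S_def compact_diff)
  define A where "A = angular_op \<Lambda> \<psi>"
  \<comment> \<open>The cut-off keeps the factor |x|^2 bounded and the radial part away from the
    origin. Nothing is lost, as all modes of \<psi> vanish for radii outside the annulus.\<close>
  define A' where "A' x = indicator S x *\<^sub>R A x" for x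
  have "A' \<in> L2 lborel"
  proof -
    have "(\<lambda>x. complex_of_real (indicator S x * (norm x)\<^sup>2) * calL \<Lambda> \<psi> x) \<in> L2 lborel"
    proof (rule L2_dominated[OF _ calL_L2, of _ "q\<^sup>2"])
      have [measurable]: "calL \<Lambda> \<psi> \<in> borel_measurable borel" using L2_measurable[OF calL_L2] by simp
      have [measurable]: "S \<in> sets borel" using S(1) by (simp add: compact_imp_closed)
      show "(\<lambda>x. complex_of_real (indicator S x * (norm x)\<^sup>2) * calL \<Lambda> \<psi> x) \<in> borel_measurable lborel" by measurable
      show "cmod (complex_of_real (indicator S x * (norm x)\<^sup>2) * calL \<Lambda> \<psi> x) \<le> q\<^sup>2 * cmod (calL \<Lambda> \<psi> x)" for x
        using pq by (auto simp: norm_mult norm_power S_def intro!: mult_right_mono power_mono split: split_indicator)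
    qed
    moreover have "(\<lambda>x. indicator S x *\<^sub>R (complex_of_real ((norm x)\<^sup>2) * radial_op \<psi> x)) \<in> L2 lborel"
      by (intro L2_compactly_supported S continuous_intros continuous_on_subset[OF continuous_on_radial_op[OF smooth]])
    ultimately have "(\<lambda>x. complex_of_real (indicator S x * (norm x)\<^sup>2) * calL \<Lambda> \<psi> x
        - indicator S x *\<^sub>R (complex_of_real ((norm x)\<^sup>2) * radial_op \<psi> x)) \<in> L2 lborel"
      by (rule L2_diff)
    moreover have "(\<lambda>x. complex_of_real (indicator S x * (norm x)\<^sup>2) * calL \<Lambda> \<psi> x
        - indicator S x *\<^sub>R (complex_of_real ((norm x)\<^sup>2) * radial_op \<psi> x)) = A'"
      using S(2) by (auto simp: fun_eq_iff A'_def A_def calL_def algebra_simps split: split_indicator)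
    ultimately show ?thesis by simp
  qed
  moreover have "\<psi> \<in> L2 lborel"
  proof -
    have "(\<lambda>x. indicator S x *\<^sub>R \<psi> x) \<in> L2 lborel"
      by (intro L2_compactly_supported S continuous_on_subset[OF smooth_punctured_continuous[OF smooth]])
    moreover have "indicator S x *\<^sub>R \<psi> x = \<psi> x" for x using supp[of x] by (cases "\<psi> x = 0") (auto simp: S_def)
    ultimately show ?thesis by simp
  qed
  ultimately have fin: "(\<integral>\<^sup>+x. ennreal ((cmod (\<psi> x))\<^sup>2) + ennreal ((cmod (A' x))\<^sup>2) \<partial>lborel) < \<infinity>"
    by (subst nn_integral_add) (auto simp: nn_integral_L2 dest: L2_measurable)
  have [measurable]: "A' \<in> borel_measurable borel" "\<psi> \<in> borel_measurable borel"
    using L2_measurable[OF \<open>A' \<in> L2 lborel\<close>] L2_measurable[OF \<open>\<psi> \<in> L2 lborel\<close>] by simp_all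
  show thesis
  proof (rule that[OF fin])
    fix F assume F: "finite F" "F \<subseteq> I"
    let ?J = "\<lambda>r. \<integral>\<^sup>+w. ennreal ((cmod (\<psi> (r *\<^sub>R w)))\<^sup>2) + ennreal ((cmod (A' (r *\<^sub>R w)))\<^sup>2) \<partial>\<sigma>"
    let ?s = "\<lambda>r. \<Sum>m\<in>F. ev m * (cmod (mode m \<psi> r))\<^sup>2"
    have "(\<Sum>m\<in>F. energy m) \<le> (\<integral>\<^sup>+r. polar_weight DIM('a) r * ?J r \<partial>lborel)"
      unfolding sum_energy[OF F]
    proof (rule nn_integral_mono_AE)
      show "AE r in lborel. polar_weight DIM('a) r * ennreal (?s r)
        \<le> polar_weight DIM('a) r * ?J r"
        using angular_op_graph
      proof eventually_elim
        fix r assume graph: "0 < r \<longrightarrow> (angular_slice \<psi> r, angular_slice (angular_op \<Lambda> \<psi>) r) \<in> \<Lambda>"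
        show "polar_weight DIM('a) r * ennreal (?s r)
          \<le> polar_weight DIM('a) r * ?J r"
        proof (cases "r > 0")
          case r: True
          note sl = psi_slice_L2[OF r]
          have AG: "(angular_slice \<psi> r, angular_slice A r) \<in> \<Lambda>" using graph r by (simp add: A_def)
          have AL: "angular_slice A r \<in> L2 \<sigma>" using self_adjoint_L2[OF self_adjoint AG] by simp
          have "ennreal (?s r)
              \<le> ?J r"
          proof (cases "p \<le> r \<and> r \<le> q")
            case True
            have "?s r
                \<le> (\<Sum>m\<in>F. (cmod (coef m (angular_slice \<psi> r)))\<^sup>2 + (cmod (coef m (angular_slice A r)))\<^sup>2)"
            proof (rule sum_mono)
              fix m assume "m \<in> F"
              then have m: "m \<in> I" using F by blast
              have "ev m \<le> 1 + (ev m)\<^sup>2" using sum_squares_bound[of 1 "ev m"] ev_nonneg[OF m] by simp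
              then have "ev m * (cmod (mode m \<psi> r))\<^sup>2 \<le> (1 + (ev m)\<^sup>2) * (cmod (mode m \<psi> r))\<^sup>2"
                by (rule mult_right_mono) simp
              moreover have "cmod (coef m (angular_slice A r)) = ev m * cmod (mode m \<psi> r)"
                using coef_graph[OF AG m] ev_nonneg[OF m] by (simp add: mode_def norm_mult)
              ultimately show "ev m * (cmod (mode m \<psi> r))\<^sup>2 \<le> (cmod (coef m (angular_slice \<psi> r)))\<^sup>2 + (cmod (coef m (angular_slice A r)))\<^sup>2"
                by (simp add: mode_def power_mult_distrib algebra_simps)
            qed
            also have "\<dots> \<le> (L2_norm \<sigma> (angular_slice \<psi> r))\<^sup>2 + (L2_norm \<sigma> (angular_slice A r))\<^sup>2"
              unfolding sum.distrib by (intro add_mono bessel F sl AL)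
            finally have "ennreal (?s r)
                \<le> ennreal ((L2_norm \<sigma> (angular_slice \<psi> r))\<^sup>2) + ennreal ((L2_norm \<sigma> (angular_slice A r))\<^sup>2)"
              by (simp add: ennreal_leI flip: ennreal_plus)
            also have "\<dots> = (\<integral>\<^sup>+w. ennreal ((cmod (angular_slice \<psi> r w))\<^sup>2) + ennreal ((cmod (angular_slice A r w))\<^sup>2) \<partial>\<sigma>)"
              using sl AL by (subst nn_integral_add) (auto simp: nn_integral_L2 dest: L2_measurable)
            also have "\<dots> = ?J r"
              using True r by (intro nn_integral_cong) (auto simp: angular_slice_def A'_def S_def)
            finally show ?thesis .
          next
            case False
            have "\<psi> (r *\<^sub>R w) = 0" if "norm w = 1" for w
              using supp[of "r *\<^sub>R w"] that False r by auto
            from mode_eq_0[OF this] show ?thesis by simp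
          qed
          then show ?thesis by (rule mult_left_mono) simp
        qed simp
      qed
    qed
    also have "\<dots> = (\<integral>\<^sup>+x. ennreal ((cmod (\<psi> x))\<^sup>2) + ennreal ((cmod (A' x))\<^sup>2) \<partial>lborel)"
      by (rule nn_integral_polar[symmetric]) measurable
    finally show "(\<Sum>m\<in>F. energy m) \<le> (\<integral>\<^sup>+x. ennreal ((cmod (\<psi> x))\<^sup>2) + ennreal ((cmod (A' x))\<^sup>2) \<partial>lborel)" .
  qed
qed

end

subsection \<open>A measurable version of the square root\<close>

context dom_function
begin

lemma energy_finite: "m \<in> I \<Longrightarrow> energy m < \<infinity>"
proof -
  assume m: "m \<in> I"
  obtain K where "K < \<infinity>" "\<And>F. finite F \<Longrightarrow> F \<subseteq> I \<Longrightarrow> (\<Sum>m\<in>F. energy m) \<le> K"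
    by (rule sum_energy_bounded) (rule that)
  from this(2)[of "{m}"] this(1) m show ?thesis by (simp add: le_less_trans)
qed

text \<open>A finite section of the expansion of the square root, as a function of x. Each term is a
  continuous function of |x| times a measurable function of the direction, hence jointly measurable;
  the origin, where \<open>sgn\<close> leaves the sphere, is cut out.\<close>

definition partial_root :: "'i set \<Rightarrow> 'a \<Rightarrow> complex" where
  "partial_root F x = indicator (- {0}) x *\<^sub>R
    (\<Sum>m\<in>F. complex_of_real (sqrt (ev m)) * mode m \<psi> (norm x) * u m (sgn x))"

lemma partial_root_slice:
  "r > 0 \<Longrightarrow> norm w = 1 \<Longrightarrow> partial_root F (r *\<^sub>R w) = psum F (\<lambda>m. complex_of_real (sqrt (ev m)) * mode m \<psi> r) w"
  by (auto simp: partial_root_def psum_def sgn_scaleR_unit split: split_indicator)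

lemma partial_root_measurable:
  assumes "F \<subseteq> I" shows "partial_root F \<in> borel_measurable borel"
proof -
  let ?B = "restrict_space borel (- {0 :: 'a})"
  have "(\<lambda>x. complex_of_real (sqrt (ev m)) * mode m \<psi> (norm x) * u m (sgn x)) \<in> borel_measurable ?B" if "m \<in> F" for m
  proof -
    have m: "m \<in> I" using assms that by blast
    have "continuous_on (- {0}) (\<lambda>x :: 'a. mode m \<psi> (norm x))"
      by (rule continuous_on_compose2[OF continuous_on_mode[OF m]]) (auto intro!: continuous_intros)
    then have [measurable]: "(\<lambda>x. mode m \<psi> (norm x)) \<in> borel_measurable ?B"
      by (rule borel_measurable_continuous_on_restrict)
    have "sgn \<in> ?B \<rightarrow>\<^sub>M \<sigma>"
      unfolding measurable_cong_sets[OF refl sets_sphere_measure]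
      by (rule measurable_restrict_space2) (auto simp: space_restrict_space norm_sgn intro: measurable_restrict_space1)
    then have [measurable]: "(\<lambda>x. u m (sgn x)) \<in> borel_measurable ?B"
      by (rule measurable_compose) (rule L2_measurable[OF u_L2[OF m]])
    show ?thesis by measurable
  qed
  then have "(\<lambda>x. \<Sum>m\<in>F. complex_of_real (sqrt (ev m)) * mode m \<psi> (norm x) * u m (sgn x)) \<in> borel_measurable ?B"
    by (rule borel_measurable_sum)
  then show ?thesis
    unfolding partial_root_def[abs_def] by (subst (asm) borel_measurable_restrict_space_iff) auto
qed

lemma nn_integral_partial_root:
  assumes F: "finite F" "F \<subseteq> I"
  shows "(\<integral>\<^sup>+x. ennreal ((cmod (partial_root F x))\<^sup>2) \<partial>lborel) = (\<Sum>m\<in>F. energy m)"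
proof -
  have [measurable]: "partial_root F \<in> borel_measurable borel" by (rule partial_root_measurable[OF F(2)])
  have "(\<integral>\<^sup>+x. ennreal ((cmod (partial_root F x))\<^sup>2) \<partial>lborel)
      = (\<integral>\<^sup>+r. polar_weight DIM('a) r * (\<integral>\<^sup>+w. ennreal ((cmod (partial_root F (r *\<^sub>R w)))\<^sup>2) \<partial>\<sigma>) \<partial>lborel)"
    by (rule nn_integral_polar) measurable
  also have "\<dots> = (\<integral>\<^sup>+r. polar_weight DIM('a) r * ennreal (\<Sum>m\<in>F. ev m * (cmod (mode m \<psi> r))\<^sup>2) \<partial>lborel)"
  proof (rule nn_integral_cong)
    fix r :: real
    show "polar_weight DIM('a) r * (\<integral>\<^sup>+w. ennreal ((cmod (partial_root F (r *\<^sub>R w)))\<^sup>2) \<partial>\<sigma>)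
      = polar_weight DIM('a) r * ennreal (\<Sum>m\<in>F. ev m * (cmod (mode m \<psi> r))\<^sup>2)"
    proof (cases "r > 0")
      case r: True
      let ?c = "\<lambda>m. complex_of_real (sqrt (ev m)) * mode m \<psi> r"
      have "(\<integral>\<^sup>+w. ennreal ((cmod (partial_root F (r *\<^sub>R w)))\<^sup>2) \<partial>\<sigma>) = (\<integral>\<^sup>+w. ennreal ((cmod (psum F ?c w))\<^sup>2) \<partial>\<sigma>)"
        by (intro nn_integral_cong) (simp add: partial_root_slice[OF r])
      also have "\<dots> = ennreal (\<Sum>m\<in>F. (cmod (?c m))\<^sup>2)"
        using F by (simp add: nn_integral_L2 norm_psum)
      also have "(\<Sum>m\<in>F. (cmod (?c m))\<^sup>2) = (\<Sum>m\<in>F. ev m * (cmod (mode m \<psi> r))\<^sup>2)"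
        using F(2) ev_nonneg by (intro sum.cong) (auto simp: norm_mult power_mult_distrib subset_iff)
      finally show ?thesis by simp
    qed simp
  qed
  also have "\<dots> = (\<Sum>m\<in>F. energy m)" by (rule sum_energy[OF F, symmetric])
  finally show ?thesis .
qed

lemma partial_root_L2:
  assumes F: "finite F" "F \<subseteq> I"
  shows "partial_root F \<in> L2 lborel" "(L2_norm lborel (partial_root F))\<^sup>2 = (\<Sum>m\<in>F. enn2real (energy m))"
proof -
  have eq: "(\<Sum>m\<in>F. energy m) = ennreal (\<Sum>m\<in>F. enn2real (energy m))"
    using F(2) energy_finite by (subst sum_ennreal[symmetric]) (auto intro!: sum.cong simp: subset_iff less_top)
  show L2: "partial_root F \<in> L2 lborel"
    by (rule L2I_nn_integral) (use partial_root_measurable[OF F(2)] nn_integral_partial_root[OF F] eq in auto)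
  have "ennreal ((L2_norm lborel (partial_root F))\<^sup>2) = ennreal (\<Sum>m\<in>F. enn2real (energy m))"
    using nn_integral_L2[OF L2] nn_integral_partial_root[OF F] eq by simp
  then show "(L2_norm lborel (partial_root F))\<^sup>2 = (\<Sum>m\<in>F. enn2real (energy m))"
    by (subst (asm) ennreal_inj) (auto intro!: sum_nonneg)
qed

text \<open>Orthogonality turns the increments into sums of energies, which are bounded. Taking the
  limit in \<open>L2 lborel\<close>, and not radius by radius, is what makes it jointly
  measurable.\<close>

lemma partial_root_low_limit:
  obtains W where "W \<in> L2 lborel" "(\<lambda>n. L2_norm lborel (\<lambda>x. partial_root (low n) x - W x)) \<longlonglongrightarrow> 0"
proof -
  obtain K where K: "K < \<infinity>" "\<And>F. finite F \<Longrightarrow> F \<subseteq> I \<Longrightarrow> (\<Sum>m\<in>F. energy m) \<le> K"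
    by (rule sum_energy_bounded) (rule that)
  define S where "S n = (\<Sum>m\<in>low n. enn2real (energy m))" for n
  have S: "incseq S" unfolding S_def by (auto simp: incseq_def intro!: sum_mono2 low_mono)
  have bound: "S n \<le> enn2real K" for n
  proof -
    have "ennreal (S n) \<le> K"
      using nn_integral_L2[OF partial_root_L2(1)[OF finite_low low_subset], of n] K(2)[OF finite_low low_subset, of n]
      unfolding nn_integral_partial_root[OF finite_low low_subset] partial_root_L2(2)[OF finite_low low_subset] S_def
      by simp
    then show ?thesis using K(1) by (metis enn2real_mono enn2real_ennreal infinity_ennreal_def S_def sum_nonneg enn2real_nonneg)
  qed
  have diff: "(L2_norm lborel (\<lambda>x. partial_root (low n) x - partial_root (low k) x))\<^sup>2 = S n - S k" if "k \<le> n" for k n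
  proof -
    have sub: "low n - low k \<subseteq> I" using low_subset[of n] by blast
    have "(\<lambda>x. partial_root (low n) x - partial_root (low k) x) = partial_root (low n - low k)"
      using low_mono[OF that] by (auto simp: partial_root_def fun_eq_iff sum_diff split: split_indicator)
    then show ?thesis
      using partial_root_L2(2)[OF _ sub] low_mono[OF that] by (simp add: S_def sum_diff)
  qed
  show thesis
    by (rule L2_convergent_of_bounded_increments[OF partial_root_L2(1)[OF finite_low low_subset] S bound diff])
      (assumption | rule that)+
qed

lemma slice_L2_AE:
  assumes W: "W \<in> L2 lborel"
  shows "AE r in lborel. 0 < r \<longrightarrow> angular_slice W r \<in> L2 \<sigma>"
proof -
  have [measurable]: "W \<in> borel_measurable borel" using L2_measurable[OF W] by simp
  have m: "(\<lambda>r. polar_weight DIM('a) r * (\<integral>\<^sup>+w. ennreal ((cmod (W (r *\<^sub>R w)))\<^sup>2) \<partial>\<sigma>)) \<in> borel_measurable lborel"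
  proof -
    have "(\<lambda>p. ennreal ((cmod (W (fst p *\<^sub>R snd p)))\<^sup>2)) \<in> borel_measurable (borel \<Otimes>\<^sub>M \<sigma>)"
      using angular_slice_pair_measurable[of W] by measurable
    from sphere_measure.borel_measurable_nn_integral_fst[OF this] show ?thesis by simp
  qed
  have "(\<integral>\<^sup>+r. polar_weight DIM('a) r * (\<integral>\<^sup>+w. ennreal ((cmod (W (r *\<^sub>R w)))\<^sup>2) \<partial>\<sigma>) \<partial>lborel) \<noteq> \<infinity>"
    by (subst nn_integral_polar[symmetric]) (simp_all add: nn_integral_L2[OF W])
  from nn_integral_noteq_infinite[OF m this] show ?thesis
  proof eventually_elim
    fix r assume fin: "polar_weight DIM('a) r * (\<integral>\<^sup>+w. ennreal ((cmod (W (r *\<^sub>R w)))\<^sup>2) \<partial>\<sigma>) \<noteq> \<infinity>"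
    show "0 < r \<longrightarrow> angular_slice W r \<in> L2 \<sigma>"
    proof
      assume r: "0 < r"
      then have "(\<integral>\<^sup>+w. ennreal ((cmod (W (r *\<^sub>R w)))\<^sup>2) \<partial>\<sigma>) < \<infinity>"
        using fin by (auto simp: ennreal_mult_eq_top_iff less_top)
      then show "angular_slice W r \<in> L2 \<sigma>"
        by (intro L2I_nn_integral angular_slice_measurable) (auto simp: angular_slice_def)
    qed
  qed
qed

text \<open>Bessel's inequality for the single mode m, integrated over r, bounds the weighted square
  integral of the discrepancy \<open>z\<close> by the squared distance from the finite section to W,
  for every n with m in \<open>low n\<close>. The distance tends to 0, so \<open>z\<close> vanishes
  at almost every r > 0.\<close>

lemma root_mode_AE:
  assumes W: "W \<in> L2 lborel" and lim: "(\<lambda>n. L2_norm lborel (\<lambda>x. partial_root (low n) x - W x)) \<longlonglongrightarrow> 0"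
    and m: "m \<in> I"
  shows "AE r in lborel. 0 < r \<longrightarrow> coef m (angular_slice W r) = complex_of_real (sqrt (ev m)) * mode m \<psi> r"
proof -
  have [measurable]: "W \<in> borel_measurable borel" using L2_measurable[OF W] by simp
  define z where "z r = coef m (angular_slice W r) - complex_of_real (sqrt (ev m)) * (indicator {0<..} r *\<^sub>R mode m \<psi> r)" for r
  define h where "h r = polar_weight DIM('a) r * ennreal ((cmod (z r))\<^sup>2)" for r
  have [measurable]: "z \<in> borel_measurable borel"
  proof -
    have "(\<lambda>p. cnj (u m (snd p)) * W (fst p *\<^sub>R snd p)) \<in> borel_measurable (borel \<Otimes>\<^sub>M \<sigma>)"
      using angular_slice_pair_measurable[of W] measurable_compose[OF measurable_snd L2_measurable[OF u_L2[OF m]]]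
      by measurable
    then have [measurable]: "(\<lambda>r. coef m (angular_slice W r)) \<in> borel_measurable borel"
      unfolding coef_def L2_inner_def angular_slice_def
      by (intro sphere_measure.borel_measurable_lebesgue_integral) (simp add: case_prod_beta')
    have [measurable]: "(\<lambda>r. indicator {0<..} r *\<^sub>R mode m \<psi> r) \<in> borel_measurable borel"
      by (rule borel_measurable_continuous_on_indicator[OF _ continuous_on_mode[OF m]]) simp
    show ?thesis unfolding z_def by measurable
  qed
  have [measurable]: "h \<in> borel_measurable borel" unfolding h_def[abs_def] by measurable
  have le: "(\<integral>\<^sup>+r. h r \<partial>lborel) \<le> ennreal ((L2_norm lborel (\<lambda>x. partial_root (low n) x - W x))\<^sup>2)" if n: "m \<in> low n" for n
  proof -
    let ?V = "\<lambda>x. partial_root (low n) x - W x"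
    have V: "?V \<in> L2 lborel" by (intro L2_diff partial_root_L2 W finite_low low_subset)
    have [measurable]: "?V \<in> borel_measurable borel" using L2_measurable[OF V] by simp
    have "(\<integral>\<^sup>+r. h r \<partial>lborel) \<le> (\<integral>\<^sup>+r. polar_weight DIM('a) r * (\<integral>\<^sup>+w. ennreal ((cmod (?V (r *\<^sub>R w)))\<^sup>2) \<partial>\<sigma>) \<partial>lborel)"
    proof (rule nn_integral_mono_AE)
      show "AE r in lborel. h r \<le> polar_weight DIM('a) r * (\<integral>\<^sup>+w. ennreal ((cmod (?V (r *\<^sub>R w)))\<^sup>2) \<partial>\<sigma>)"
        using slice_L2_AE[OF W]
      proof eventually_elim
        fix r assume Wr: "0 < r \<longrightarrow> angular_slice W r \<in> L2 \<sigma>"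
        show "h r \<le> polar_weight DIM('a) r * (\<integral>\<^sup>+w. ennreal ((cmod (?V (r *\<^sub>R w)))\<^sup>2) \<partial>\<sigma>)"
        proof (cases "r > 0")
          case r: True
          let ?c = "\<lambda>m. complex_of_real (sqrt (ev m)) * mode m \<psi> r"
          let ?P = "psum (low n) ?c"
          have P: "?P \<in> L2 \<sigma>" and Wr: "angular_slice W r \<in> L2 \<sigma>" using Wr r low_subset by auto
          have "coef m (\<lambda>w. ?P w - angular_slice W r w) = - z r"
            using P Wr m n r low_subset by (simp add: coef_diff coef_psum z_def)
          then have "(cmod (z r))\<^sup>2 \<le> (L2_norm \<sigma> (\<lambda>w. ?P w - angular_slice W r w))\<^sup>2"
            using bessel[of "{m}", OF _ _ L2_diff[OF P Wr]] m by simp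
          then have "ennreal ((cmod (z r))\<^sup>2) \<le> (\<integral>\<^sup>+w. ennreal ((cmod (?P w - angular_slice W r w))\<^sup>2) \<partial>\<sigma>)"
            unfolding nn_integral_L2[OF L2_diff[OF P Wr]] by (rule ennreal_leI)
          also have "\<dots> = (\<integral>\<^sup>+w. ennreal ((cmod (?V (r *\<^sub>R w)))\<^sup>2) \<partial>\<sigma>)"
            by (intro nn_integral_cong) (simp add: partial_root_slice[OF r] angular_slice_def)
          finally show ?thesis unfolding h_def by (rule mult_left_mono) simp
        qed (simp add: h_def)
      qed
    qed
    also have "\<dots> = (\<integral>\<^sup>+x. ennreal ((cmod (?V x))\<^sup>2) \<partial>lborel)"
      by (rule nn_integral_polar[symmetric]) measurable
    also have "\<dots> = ennreal ((L2_norm lborel ?V)\<^sup>2)" by (rule nn_integral_L2[OF V])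
    finally show ?thesis .
  qed
  have "(\<lambda>n. ennreal ((L2_norm lborel (\<lambda>x. partial_root (low n) x - W x))\<^sup>2)) \<longlonglongrightarrow> ennreal (0\<^sup>2)"
    by (intro tendsto_ennrealI tendsto_power lim)
  then have "(\<integral>\<^sup>+r. h r \<partial>lborel) \<le> ennreal (0\<^sup>2)"
    by (rule tendsto_lowerbound) (use eventually_low[OF m] le in \<open>auto elim: eventually_mono\<close>)
  then have "(\<integral>\<^sup>+r. h r \<partial>lborel) = 0" by simp
  then have "AE r in lborel. h r = 0"
    by (subst (asm) nn_integral_0_iff_AE) (auto simp: h_def)
  then show ?thesis
  proof eventually_elim
    fix r assume h0: "h r = 0"
    show "0 < r \<longrightarrow> coef m (angular_slice W r) = complex_of_real (sqrt (ev m)) * mode m \<psi> r"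
    proof
      assume r: "0 < r"
      then have "r ^ (DIM('a) - Suc 0) \<le> 0 \<or> z r = 0" using h0 by (simp add: h_def ennreal_eq_0_iff)
      moreover have "\<not> r ^ (DIM('a) - Suc 0) \<le> 0" unfolding not_le by (rule zero_less_power[OF r])
      ultimately have "z r = 0" by blast
      then show "coef m (angular_slice W r) = complex_of_real (sqrt (ev m)) * mode m \<psi> r"
        using r by (simp add: z_def)
    qed
  qed
qed

lemma countable_I: "countable I"
proof -
  have "I \<subseteq> (\<Union>n. low n)" using real_arch_simple by (auto simp: low_def)
  then show ?thesis by (rule countable_subset) (simp add: countable_finite)
qed

text \<open>\<open>angular_op\<close> picks some version, so exhibiting one makes the defining
  property available for the one picked. The exceptional null set of radii depends on m, and
  countability of \<open>I\<close> allows a common one.\<close>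

theorem root_version: "angular_version (op_sqrt \<sigma> \<Lambda>) \<psi> (angular_op (op_sqrt \<sigma> \<Lambda>) \<psi>)"
proof -
  obtain W where W: "W \<in> L2 lborel" "(\<lambda>n. L2_norm lborel (\<lambda>x. partial_root (low n) x - W x)) \<longlonglongrightarrow> 0"
    by (rule partial_root_low_limit)
  have "AE r in lborel. \<forall>m\<in>I. 0 < r \<longrightarrow> coef m (angular_slice W r) = complex_of_real (sqrt (ev m)) * mode m \<psi> r"
    unfolding AE_ball_countable[OF countable_I] using root_mode_AE[OF W] by blast
  with slice_L2_AE[OF W(1)]
  have "AE r in lborel. 0 < r \<longrightarrow> (angular_slice \<psi> r, angular_slice W r) \<in> op_sqrt \<sigma> \<Lambda>"
  proof eventually_elim
    fix r
    assume "0 < r \<longrightarrow> angular_slice W r \<in> L2 \<sigma>"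
      and "\<forall>m\<in>I. 0 < r \<longrightarrow> coef m (angular_slice W r) = complex_of_real (sqrt (ev m)) * mode m \<psi> r"
    then show "0 < r \<longrightarrow> (angular_slice \<psi> r, angular_slice W r) \<in> op_sqrt \<sigma> \<Lambda>"
      unfolding op_sqrt_eq_multiplier by (simp add: multiplier_def psi_slice_L2 mode_def)
  qed
  then have "angular_version (op_sqrt \<sigma> \<Lambda>) \<psi> W"
    using L2_measurable[OF W(1)] by (simp add: angular_version_def)
  then show ?thesis unfolding angular_op_def
    by (rule someI[where P = "angular_version (op_sqrt \<sigma> \<Lambda>) \<psi>"])
qed

end

subsection \<open>The inequality\<close>

context dom_function
begin

definition mode_operator :: "'i \<Rightarrow> real \<Rightarrow> complex" where
  "mode_operator m r = - mode m (radial_deriv (radial_deriv \<psi>)) r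
    - complex_of_real ((real DIM('a) - 1) / r) * mode m (radial_deriv \<psi>) r + complex_of_real (ev m / r\<^sup>2) * mode m \<psi> r"

definition left_mode :: "real \<Rightarrow> 'i \<Rightarrow> ennreal" where
  "left_mode \<alpha> m = (\<integral>\<^sup>+r. indicator {0<..} r * ennreal (r powr (real DIM('a) - 1 - \<alpha>) * (cmod (mode_operator m r))\<^sup>2) \<partial>lborel)"

definition right_mode :: "real \<Rightarrow> 'i \<Rightarrow> ennreal" where
  "right_mode \<alpha> m = (\<integral>\<^sup>+r. indicator {0<..} r * ennreal (r powr (real DIM('a) - 3 - \<alpha>) *
      ((cmod (mode m (radial_deriv \<psi>) r))\<^sup>2 + ev m * (cmod (mode m \<psi> r))\<^sup>2 / r\<^sup>2)) \<partial>lborel)"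

lemma mode_inequality:
  assumes m: "m \<in> I"
  shows "ennreal (hardy_rellich_const DIM('a) \<alpha> I ev) * right_mode \<alpha> m \<le> left_mode \<alpha> m"
proof (cases "hardy_rellich_const DIM('a) \<alpha> I ev \<ge> 0")
  case True
  obtain p q where pq: "0 < p" "p < q" and supp: "\<And>x. \<psi> x \<noteq> 0 \<Longrightarrow> p \<le> norm x \<and> norm x \<le> q"
    by (rule test_function_annulus[OF test_function]) (rule that)
  have zero: "mode m \<psi> r = 0" if r: "0 < r" "r < p \<or> q < r" for r
  proof (rule mode_eq_0)
    show "\<psi> (r *\<^sub>R w) = 0" if "norm w = 1" for w
      using supp[of "r *\<^sub>R w"] that r by (cases "\<psi> (r *\<^sub>R w) = 0") auto
  qed
  show ?thesis
    unfolding left_mode_def right_mode_def mode_operator_def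
    by (rule hardy_rellich_radial[OF mode_deriv[OF smooth _ m] mode_deriv_twice[OF smooth _ m]
          continuous_on_mode_deriv_twice[OF smooth m] pq zero True
          conjunct1[OF hardy_rellich_const_le[OF m]] conjunct2[OF hardy_rellich_const_le[OF m]] ev_nonneg[OF m]])
\<comment> \<open>A negative constant becomes 0 under \<open>ennreal\<close>. This covers any
  unspecified negative value that \<open>min_over\<close> may take on an empty family.\<close>
qed (simp add: ennreal_neg)

lemma continuous_on_mode_operator: "m \<in> I \<Longrightarrow> continuous_on {0<..} (mode_operator m)"
  unfolding mode_operator_def[abs_def]
  by (intro continuous_intros continuous_on_mode continuous_on_mode_deriv continuous_on_mode_deriv_twice[OF smooth]) auto

lemma powr_weight:
  "r > 0 \<Longrightarrow> r ^ (DIM('a) - 1) / r powr \<alpha> = r powr (real DIM('a) - 1 - \<alpha>)"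
  using powr_realpow[of r "DIM('a) - 1"] DIM_positive[where 'a = 'a]
  by (simp add: powr_diff of_nat_diff)

text \<open>Taking the m-th coefficient turns \<Lambda> into multiplication by ev m, so on every
  radius where the graph relation holds \<open>calL\<close> acts on modes as an ordinary
  differential operator.\<close>

lemma calL_slice:
  assumes r: "r > 0" and graph: "(angular_slice \<psi> r, angular_slice (angular_op \<Lambda> \<psi>) r) \<in> \<Lambda>"
  shows "angular_slice (calL \<Lambda> \<psi>) r \<in> L2 \<sigma>"
    and "m \<in> I \<Longrightarrow> coef m (angular_slice (calL \<Lambda> \<psi>) r) = mode_operator m r"
proof -
  define A where "A = angular_slice (angular_op \<Lambda> \<psi>) r"
  define R1 where "R1 = angular_slice (radial_deriv \<psi>) r"
  define R2 where "R2 = angular_slice (radial_deriv (radial_deriv \<psi>)) r"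
  define g where "g w = (- 1 * R2 w - complex_of_real ((real DIM('a) - 1) / r) * R1 w) + complex_of_real (1 / r\<^sup>2) * A w" for w
  have A: "A \<in> L2 \<sigma>" using self_adjoint_L2[OF self_adjoint graph] by (simp add: A_def)
  have R: "R1 \<in> L2 \<sigma>" "R2 \<in> L2 \<sigma>" unfolding R1_def R2_def
    by (intro angular_slice_L2 continuous_on_radial_deriv continuous_on_radial_deriv_twice smooth r)+
  have g: "g \<in> L2 \<sigma>" unfolding g_def[abs_def] by (intro L2_add L2_diff L2_scale A R)
  have eq: "g w = angular_slice (calL \<Lambda> \<psi>) r w" if "w \<in> space \<sigma>" for w
    using that r by (simp add: g_def A_def R1_def R2_def angular_slice_def calL_def radial_op_def)
  have meas: "angular_slice (calL \<Lambda> \<psi>) r \<in> borel_measurable \<sigma>"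
    using L2_measurable[OF calL_L2] by (intro angular_slice_measurable) simp
  show "angular_slice (calL \<Lambda> \<psi>) r \<in> L2 \<sigma>"
    by (rule L2_cong_AE[OF g meas]) (use eq in auto)
  assume m: "m \<in> I"
  have "coef m (angular_slice (calL \<Lambda> \<psi>) r) = coef m g"
    by (rule coef_cong_AE[OF m meas L2_measurable[OF g]]) (use eq in auto)
  also have "\<dots> = (- 1 * coef m R2 - complex_of_real ((real DIM('a) - 1) / r) * coef m R1) + complex_of_real (1 / r\<^sup>2) * coef m A"
    unfolding g_def[abs_def] using m A R by (simp only: coef_add coef_diff coef_scale L2_add L2_diff L2_scale)
  also have "\<dots> = mode_operator m r"
    using coef_graph[OF graph m] by (simp add: mode_operator_def mode_def A_def R1_def R2_def)
  finally show "coef m (angular_slice (calL \<Lambda> \<psi>) r) = mode_operator m r" .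
qed

text \<open>For a lower bound on this side Bessel's inequality on almost every sphere suffices, with
  finitely many modes at a time.\<close>

lemma left_integral_bound:
  assumes F: "finite F" "F \<subseteq> I"
  shows "(\<Sum>m\<in>F. left_mode \<alpha> m) \<le> (\<integral>\<^sup>+x. ennreal ((cmod (calL \<Lambda> \<psi> x))\<^sup>2 / norm x powr \<alpha>) \<partial>lborel)"
proof -
  let ?S = "\<lambda>r. \<Sum>m\<in>F. indicator {0<..} r * ennreal (r powr (real DIM('a) - 1 - \<alpha>) * (cmod (mode_operator m r))\<^sup>2)"
  let ?J = "\<lambda>r. \<integral>\<^sup>+w. ennreal ((cmod (calL \<Lambda> \<psi> (r *\<^sub>R w)))\<^sup>2 / norm (r *\<^sub>R w) powr \<alpha>) \<partial>\<sigma>"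
  let ?N = "\<lambda>r. L2_norm \<sigma> (angular_slice (calL \<Lambda> \<psi>) r)"
  have [measurable]: "calL \<Lambda> \<psi> \<in> borel_measurable borel" using L2_measurable[OF calL_L2] by simp
  have "(\<Sum>m\<in>F. left_mode \<alpha> m) = (\<integral>\<^sup>+r. (\<Sum>m\<in>F. indicator {0<..} r *
      ennreal (r powr (real DIM('a) - 1 - \<alpha>) * (cmod (mode_operator m r))\<^sup>2)) \<partial>lborel)"
    unfolding left_mode_def
  proof (rule nn_integral_sum[symmetric])
    fix m assume "m \<in> F"
    then have "m \<in> I" using F by blast
    then have "continuous_on {0<..} (\<lambda>r. r powr (real DIM('a) - 1 - \<alpha>) * (cmod (mode_operator m r))\<^sup>2)"
      by (intro continuous_intros continuous_on_mode_operator) auto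
    then show "(\<lambda>r. indicator {0<..} r * ennreal (r powr (real DIM('a) - 1 - \<alpha>) * (cmod (mode_operator m r))\<^sup>2)) \<in> borel_measurable lborel"
      unfolding measurable_lborel2 by (rule borel_measurable_indicator_ennreal)
  qed
  also have "\<dots> \<le> (\<integral>\<^sup>+r. polar_weight DIM('a) r * ?J r \<partial>lborel)"
  proof (rule nn_integral_mono_AE)
    show "AE r in lborel. ?S r
      \<le> polar_weight DIM('a) r * ?J r"
      using angular_op_graph
    proof eventually_elim
      fix r assume graph: "0 < r \<longrightarrow> (angular_slice \<psi> r, angular_slice (angular_op \<Lambda> \<psi>) r) \<in> \<Lambda>"
      show "?S r
        \<le> polar_weight DIM('a) r * ?J r"
      proof (cases "r > 0")
        case r: True
        note sl = calL_slice[OF r mp[OF graph r]]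
        have "?S r
            = ennreal (\<Sum>m\<in>F. r powr (real DIM('a) - 1 - \<alpha>) * (cmod (mode_operator m r))\<^sup>2)"
          using r by (simp add: sum_ennreal)
        also have "(\<Sum>m\<in>F. r powr (real DIM('a) - 1 - \<alpha>) * (cmod (mode_operator m r))\<^sup>2)
            = r powr (real DIM('a) - 1 - \<alpha>) * (\<Sum>m\<in>F. (cmod (coef m (angular_slice (calL \<Lambda> \<psi>) r)))\<^sup>2)"
          unfolding sum_distrib_left using sl(2) F(2) by (intro sum.cong) (auto simp: subset_iff)
        also have "\<dots> \<le> r powr (real DIM('a) - 1 - \<alpha>) * (?N r)\<^sup>2"
          by (intro mult_left_mono bessel F sl(1)) simp
        also have "ennreal \<dots> = polar_weight DIM('a) r * (ennreal (1 / r powr \<alpha>) * ennreal ((?N r)\<^sup>2))"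
          unfolding powr_weight[OF r, symmetric] using r by (simp add: ennreal_mult[symmetric])
        also have "ennreal (1 / r powr \<alpha>) * ennreal ((?N r)\<^sup>2)
            = (\<integral>\<^sup>+w. ennreal (1 / r powr \<alpha>) * ennreal ((cmod (angular_slice (calL \<Lambda> \<psi>) r w))\<^sup>2) \<partial>\<sigma>)"
          unfolding nn_integral_L2[OF sl(1), symmetric]
          by (intro nn_integral_cmult[symmetric] measurable_compose[OF L2_measurable[OF sl(1)]]) measurable
        also have "\<dots> = ?J r"
          using r by (intro nn_integral_cong) (simp add: angular_slice_def ennreal_mult[symmetric])
        finally show ?thesis by (simp add: ennreal_leI)
      qed simp
    qed
  qed
  also have "\<dots> = (\<integral>\<^sup>+x. ennreal ((cmod (calL \<Lambda> \<psi> x))\<^sup>2 / norm x powr \<alpha>) \<partial>lborel)"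
    by (rule nn_integral_polar[symmetric]) measurable
  finally show ?thesis .
qed

text \<open>An upper bound is needed on this side, so almost every slice is expanded by Parseval's
  identity, both for the radial derivative and for the square root. All terms are nonnegative, and
  monotone convergence exchanges the supremum over finite sections with the integral.\<close>

lemma right_integral_eq:
  "(\<integral>\<^sup>+x. ennreal (calD \<Lambda> \<psi> x / norm x powr (\<alpha> + 2)) \<partial>lborel) = (SUP n. \<Sum>m\<in>low n. right_mode \<alpha> m)"
proof -
  let ?J = "\<lambda>r. \<integral>\<^sup>+w. ennreal (calD \<Lambda> \<psi> (r *\<^sub>R w) / norm (r *\<^sub>R w) powr (\<alpha> + 2)) \<partial>\<sigma>"
  define B where "B = angular_op (op_sqrt \<sigma> \<Lambda>) \<psi>"
  have [measurable]: "B \<in> borel_measurable borel" using root_version by (simp add: B_def angular_version_def)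
  have [measurable]: "radial_deriv \<psi> \<in> borel_measurable borel" by (rule borel_measurable_radial_deriv[OF smooth])
  have calD: "calD \<Lambda> \<psi> x = (cmod (radial_deriv \<psi> x))\<^sup>2 + (cmod (B x))\<^sup>2 / (norm x)\<^sup>2" for x
    by (simp add: calD_def B_def)
  define t where "t m r = r powr (real DIM('a) - 3 - \<alpha>) *
      ((cmod (mode m (radial_deriv \<psi>) r))\<^sup>2 + ev m * (cmod (mode m \<psi> r))\<^sup>2 / r\<^sup>2)" for m r
  let ?T = "\<lambda>n r. \<Sum>m\<in>low n. indicator {0<..} r * ennreal (t m r)"
  have t0: "0 \<le> t m r" if "m \<in> I" for m r using ev_nonneg[OF that] by (simp add: t_def)
  have t_meas: "(\<lambda>r. indicator {0<..} r * ennreal (t m r)) \<in> borel_measurable lborel" if "m \<in> I" for m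
  proof -
    have "continuous_on {0<..} (t m)" unfolding t_def[abs_def]
      by (intro continuous_intros continuous_on_mode continuous_on_mode_deriv that) auto
    then show ?thesis unfolding measurable_lborel2 by (rule borel_measurable_indicator_ennreal)
  qed
  have "(\<integral>\<^sup>+x. ennreal (calD \<Lambda> \<psi> x / norm x powr (\<alpha> + 2)) \<partial>lborel)
    = (\<integral>\<^sup>+r. polar_weight DIM('a) r * ?J r \<partial>lborel)"
    unfolding calD by (rule nn_integral_polar) measurable
  also have "\<dots> = (\<integral>\<^sup>+r. (SUP n. ?T n r) \<partial>lborel)"
  proof (rule nn_integral_cong_AE)
    have "AE r in lborel. 0 < r \<longrightarrow> (angular_slice \<psi> r, angular_slice B r) \<in> op_sqrt \<sigma> \<Lambda>"
      using root_version by (simp add: B_def angular_version_def)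
    then show "AE r in lborel. polar_weight DIM('a) r * ?J r
        = (SUP n. ?T n r)"
    proof eventually_elim
      fix r assume graph: "0 < r \<longrightarrow> (angular_slice \<psi> r, angular_slice B r) \<in> op_sqrt \<sigma> \<Lambda>"
      show "polar_weight DIM('a) r * ?J r
        = (SUP n. ?T n r)"
      proof (cases "r > 0")
        case r: True
        let ?R = "angular_slice (radial_deriv \<psi>) r" and ?B = "angular_slice B r"
        have BL: "?B \<in> L2 \<sigma>" and Bcoef: "\<And>m. m \<in> I \<Longrightarrow> coef m ?B = complex_of_real (sqrt (ev m)) * mode m \<psi> r"
          using mp[OF graph r] unfolding op_sqrt_eq_multiplier by (auto simp: multiplier_def mode_def)
        have RL: "?R \<in> L2 \<sigma>" by (intro angular_slice_L2 continuous_on_radial_deriv smooth r)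
        have [measurable]: "?B \<in> borel_measurable \<sigma>" "?R \<in> borel_measurable \<sigma>" using BL RL by (auto dest: L2_measurable)
        define c where "c = r powr (real DIM('a) - 3 - \<alpha>)"
        have c: "r ^ (DIM('a) - 1) / r powr (\<alpha> + 2) = c"
          unfolding powr_weight[OF r] c_def by (simp add: algebra_simps)
        have "polar_weight DIM('a) r * ?J r
            = ennreal (r ^ (DIM('a) - 1)) * (\<integral>\<^sup>+w. ennreal (1 / r powr (\<alpha> + 2)) *
                (ennreal ((cmod (?R w))\<^sup>2) + ennreal (1 / r\<^sup>2) * ennreal ((cmod (?B w))\<^sup>2)) \<partial>\<sigma>)"
          using r by (intro arg_cong2[where f = "(*)"] nn_integral_cong)
            (simp_all add: calD angular_slice_def ennreal_mult[symmetric] ennreal_plus[symmetric] del: ennreal_plus)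
        also have "\<dots> = ennreal (r ^ (DIM('a) - 1)) * (ennreal (1 / r powr (\<alpha> + 2)) *
                (ennreal ((L2_norm \<sigma> ?R)\<^sup>2) + ennreal (1 / r\<^sup>2) * ennreal ((L2_norm \<sigma> ?B)\<^sup>2)))"
          by (simp add: nn_integral_cmult nn_integral_add nn_integral_L2[OF RL] nn_integral_L2[OF BL])
        also have "\<dots> = ennreal (c * ((L2_norm \<sigma> ?R)\<^sup>2 + (1 / r\<^sup>2) * (L2_norm \<sigma> ?B)\<^sup>2))"
          unfolding c[symmetric] using r by (simp add: ennreal_mult[symmetric] flip: ennreal_plus)
        also have "\<dots> = (SUP n. ennreal (\<Sum>m\<in>low n. t m r))"
        proof (rule LIMSEQ_unique)
          have "(\<lambda>n. c * ((\<Sum>m\<in>low n. (cmod (coef m ?R))\<^sup>2) + (1 / r\<^sup>2) * (\<Sum>m\<in>low n. (cmod (coef m ?B))\<^sup>2)))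
              \<longlonglongrightarrow> c * ((L2_norm \<sigma> ?R)\<^sup>2 + (1 / r\<^sup>2) * (L2_norm \<sigma> ?B)\<^sup>2)"
            by (intro tendsto_intros parseval RL BL)
          moreover have "c * ((\<Sum>m\<in>low n. (cmod (coef m ?R))\<^sup>2) + (1 / r\<^sup>2) * (\<Sum>m\<in>low n. (cmod (coef m ?B))\<^sup>2))
              = (\<Sum>m\<in>low n. t m r)" for n
          proof -
            have "c * ((cmod (coef m ?R))\<^sup>2 + (1 / r\<^sup>2) * (cmod (coef m ?B))\<^sup>2) = t m r" if "m \<in> low n" for m
            proof -
              have m: "m \<in> I" using that low_subset by blast
              then show ?thesis using ev_nonneg[OF m]
                by (simp add: t_def c_def Bcoef norm_mult power_mult_distrib mode_def)
            qed
            then have "(\<Sum>m\<in>low n. c * ((cmod (coef m ?R))\<^sup>2 + (1 / r\<^sup>2) * (cmod (coef m ?B))\<^sup>2)) = (\<Sum>m\<in>low n. t m r)"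
              by (intro sum.cong refl)
            then show ?thesis by (simp only: sum_distrib_left sum.distrib distrib_left)
          qed
          ultimately show "(\<lambda>n. ennreal (\<Sum>m\<in>low n. t m r)) \<longlonglongrightarrow> ennreal (c * ((L2_norm \<sigma> ?R)\<^sup>2 + (1 / r\<^sup>2) * (L2_norm \<sigma> ?B)\<^sup>2))"
            by (intro tendsto_ennrealI) simp
          show "(\<lambda>n. ennreal (\<Sum>m\<in>low n. t m r)) \<longlonglongrightarrow> (SUP n. ennreal (\<Sum>m\<in>low n. t m r))"
          proof (rule LIMSEQ_SUP)
            show "incseq (\<lambda>n. ennreal (\<Sum>m\<in>low n. t m r))"
            proof (rule incseq_SucI, rule ennreal_leI, rule sum_mono2)
              fix n m assume "m \<in> low (Suc n) - low n"
              then have "m \<in> I" using low_subset[of "Suc n"] by blast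
              then show "0 \<le> t m r" by (rule t0)
            qed (simp_all add: low_mono)
          qed
        qed
        also have "\<dots> = (SUP n. ?T n r)"
        proof (rule SUP_cong[OF refl])
          show "ennreal (\<Sum>m\<in>low n. t m r) = ?T n r" for n
            using r t0 low_subset[of n] by (subst sum_ennreal[symmetric]) (auto simp: subset_iff)
        qed
        finally show ?thesis .
      qed simp
    qed
  qed
  also have "\<dots> = (SUP n. \<integral>\<^sup>+r. ?T n r \<partial>lborel)"
  proof (rule nn_integral_monotone_convergence_SUP)
    show "incseq (\<lambda>n r. ?T n r)"
      by (intro incseq_SucI le_funI sum_mono2) (simp_all add: low_mono)
    show "(\<lambda>r. ?T n r) \<in> borel_measurable lborel" for n
      using low_subset[of n] by (intro borel_measurable_sum t_meas) auto
  qed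
  also have "\<dots> = (SUP n. \<Sum>m\<in>low n. right_mode \<alpha> m)"
  proof (rule SUP_cong[OF refl])
    show "(\<integral>\<^sup>+r. ?T n r \<partial>lborel) = (\<Sum>m\<in>low n. right_mode \<alpha> m)" for n
      unfolding right_mode_def t_def[symmetric] using low_subset[of n] by (intro nn_integral_sum t_meas) auto
  qed
  finally show ?thesis .
qed

end

theorem theorem1p1:
  fixes \<Lambda> :: "('a::euclidean_space \<Rightarrow> complex) rel"
    and I :: "'i set" and ev :: "'i \<Rightarrow> real" and u :: "'i \<Rightarrow> 'a \<Rightarrow> complex"
    and \<alpha> :: real and \<psi> :: "'a \<Rightarrow> complex"
  assumes "DIM('a) \<ge> 2"
    and "self_adjoint sphere_measure \<Lambda>" and "nonneg_op sphere_measure \<Lambda>"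
    and "countable I"
    and "purely_discrete_spectrum sphere_measure \<Lambda> I ev u"
    and "\<psi> \<in> dom_calL \<Lambda>"
    and "(\<lambda>x. complex_of_real (norm x powr (- \<alpha> / 2)) * calL \<Lambda> \<psi> x) \<in> L2 lborel"
  shows "(\<integral>\<^sup>+ x. ennreal ((cmod (calL \<Lambda> \<psi> x))\<^sup>2 / norm x powr \<alpha>) \<partial>lborel)
       \<ge> ennreal (hardy_rellich_const DIM('a) \<alpha> I ev)
          * (\<integral>\<^sup>+ x. ennreal (calD \<Lambda> \<psi> x / norm x powr (\<alpha> + 2)) \<partial>lborel)"
proof -
  interpret dom_function \<Lambda> I ev u \<psi>
    by unfold_locales (rule assms)+
  let ?C = "ennreal (hardy_rellich_const DIM('a) \<alpha> I ev)"
  \<comment> \<open>In \<open>ennreal\<close> the constant passes through the supremum even if the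
    integral is infinite, so the claim reduces to finite sums of mode inequalities.\<close>
  have "?C * (\<integral>\<^sup>+ x. ennreal (calD \<Lambda> \<psi> x / norm x powr (\<alpha> + 2)) \<partial>lborel) = (SUP n. ?C * (\<Sum>m\<in>low n. right_mode \<alpha> m))"
    unfolding right_integral_eq by (rule SUP_mult_left_ennreal)
  also have "\<dots> \<le> (\<integral>\<^sup>+ x. ennreal ((cmod (calL \<Lambda> \<psi> x))\<^sup>2 / norm x powr \<alpha>) \<partial>lborel)"
  proof (rule SUP_least)
    fix n
    have "?C * (\<Sum>m\<in>low n. right_mode \<alpha> m) \<le> (\<Sum>m\<in>low n. left_mode \<alpha> m)"
      unfolding sum_distrib_left using low_subset[of n] by (intro sum_mono mode_inequality) auto
    also have "\<dots> \<le> (\<integral>\<^sup>+ x. ennreal ((cmod (calL \<Lambda> \<psi> x))\<^sup>2 / norm x powr \<alpha>) \<partial>lborel)"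
      by (rule left_integral_bound[OF finite_low low_subset])
    finally show "?C * (\<Sum>m\<in>low n. right_mode \<alpha> m) \<le> (\<integral>\<^sup>+ x. ennreal ((cmod (calL \<Lambda> \<psi> x))\<^sup>2 / norm x powr \<alpha>) \<partial>lborel)" .
  qed
  finally show ?thesis .
qed

end
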